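(* Let $V$ be a finite-dimensional complex vector space equipped with three complete decreasing filtrations $F_0^\bullet,F_1^\bullet,F_2^\bullet$. Then $$\mathrm{ch}\big(\xi_{\mathbf P^2}(V,F_0^\bullet,F_1^\bullet,F_2^\bullet)\big)=\dim_{\mathbf C}V+\sum_{p,q,r}\dim_{\mathbf C}\big(Gr^q_{F_2}Gr^p_{F_1}Gr^r_{F_0}V\big)\Big((r+p+q)\,w^2+\tfrac12(r^2+2rp+2rq)\,w^4\Big)+\sum_{p,q}\dim_{\mathbf C}\big(Gr^q_{F_2}Gr^p_{F_1}V\big)\,\tfrac12(p+q)^2\,w^4 .$$
   Context: A decreasing filtration $F^\bullet$ (indexed by $\mathbf Z$) of $V$ is complete if $F^p=V$ for some $p$ and $F^q=0$ for some $q$. Iterated gradeds use induced filtrations. Rees bundle. For two filtrations $F^\bullet,G^\bullet$ of $V$ set $R^2(V,F,G)=\sum_{(p,q)\in\mathbf Z^2}u^{-p}v^{-q}(F^p\cap G^q)\subset \mathbf C[u,v,u^{-1},v^{-1}]\otimes V$, a free $\mathbf C[u,v]$-module. Let $\mathbf P^2$ have homogeneous coordinates $(u_0:u_1:u_2)$ and $U_k=\{u_k\ne0\}$. For $\{i,j,k\}=\{0,1,2\}$ with $i<j$, take on $U_k=\mathrm{Spec}\,\mathbf C[\frac{u_i}{u_k},\frac{u_j}{u_k}]$ the vector bundle associated with $R^2(V,F_i,F_j)$, where $u=\frac{u_i}{u_k}$ is attached to $F_i$ and $v=\frac{u_j}{u_k}$ to $F_j$. These are subsheaves of the push-forward of $\mathcal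 O_{U_0\cap U_1\cap U_2}\otimes V$ which coincide on overlaps; they glue to the vector bundle $\xi_{\mathbf P^2}(V,F_0^\bullet,F_1^\bullet,F_2^\bullet)$. $w^2\in H^2(\mathbf P^2,\mathbf Z)$ is the class of a line and $w^4\in H^4(\mathbf P^2,\mathbf Z)$ the class of a point. *)

theory Defs
  imports
    Complex_Main
    "HOL-Library.Poly_Mapping"
    "HOL-Library.Product_Plus"
    "HOL-Library.FuncSet"
    "Jordan_Normal_Form.Matrix"
begin

section \<open>Filtered complex vector spaces\<close>

text \<open>
  A complex vector space is a type \<open>'v\<close> with a scalar multiplication \<open>s\<close> satisfying
  \<^locale>\<open>vector_space\<close>; the space itself is \<open>UNIV :: 'v set\<close>.
\<close>

definition complete_filtration ::
    "(complex \<Rightarrow> 'v \<Rightarrow> 'v::ab_group_add) \<Rightarrow> (int \<Rightarrow> 'v set) \<Rightarrow> bool" where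
  "complete_filtration s F \<longleftrightarrow>
     (\<forall>p. module.subspace s (F p)) \<and> antimono F \<and> (\<exists>p. F p = UNIV) \<and> (\<exists>q. F q = {0})"

text \<open>
  A subquotient \<open>X / Y\<close> of \<open>V\<close>, where \<open>Y \<subseteq> X\<close>, is represented by the pair \<open>(X, Y)\<close>, and
  a subspace of it by its preimage in \<open>X\<close>. A filtration \<open>F\<close> of a space (of which
  \<open>X / Y\<close> is a subquotient) induces on \<open>X / Y\<close> the filtration by the images of \<open>F p \<inter> X\<close>,
  whose preimages in \<open>X\<close> are \<open>(F p \<inter> X) + Y\<close>.
\<close>

definition gr :: "(int \<Rightarrow> 'v set) \<Rightarrow> int \<Rightarrow> 'v set \<times> 'v set" where
  "gr F p = (F p, F (p + 1))"

definition induced :: "'v::ab_group_add set \<times> 'v set \<Rightarrow> (int \<Rightarrow> 'v set) \<Rightarrow> int \<Rightarrow> 'v set" where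
  "induced Q F p = {x + y | x y. x \<in> F p \<inter> fst Q \<and> y \<in> snd Q}"

definition quot_dim :: "(complex \<Rightarrow> 'v \<Rightarrow> 'v::ab_group_add) \<Rightarrow> 'v set \<times> 'v set \<Rightarrow> nat" where
  "quot_dim s Q = vector_space.dim s (fst Q) - vector_space.dim s (snd Q)"

text \<open>\<open>gr2 F G p q\<close> is \<open>Gr\<^sub>G\<^sup>q Gr\<^sub>F\<^sup>p V\<close>, and \<open>gr3 E F G r p q\<close> is \<open>Gr\<^sub>G\<^sup>q Gr\<^sub>F\<^sup>p Gr\<^sub>E\<^sup>r V\<close>.\<close>

definition gr2 ::
    "(int \<Rightarrow> 'v::ab_group_add set) \<Rightarrow> (int \<Rightarrow> 'v set) \<Rightarrow> int \<Rightarrow> int \<Rightarrow> 'v set \<times> 'v set" where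
  "gr2 F G p q = gr (induced (gr F p) G) q"

definition gr3 ::
    "(int \<Rightarrow> 'v::ab_group_add set) \<Rightarrow> (int \<Rightarrow> 'v set) \<Rightarrow> (int \<Rightarrow> 'v set) \<Rightarrow>
     int \<Rightarrow> int \<Rightarrow> int \<Rightarrow> 'v set \<times> 'v set" where
  "gr3 E F G r p q = gr2 (induced (gr E r) F) (induced (gr E r) G) p q"


section \<open>Functions on the standard affine charts of the projective plane\<close>

text \<open>
  With \<open>U\<^sub>k = {u\<^sub>k \<noteq> 0}\<close>, the ring of functions on \<open>U\<^sub>0 \<inter> U\<^sub>1 \<inter> U\<^sub>2\<close> consists of the
  Laurent polynomials of degree 0 in \<open>u\<^sub>0, u\<^sub>1, u\<^sub>2\<close>, that is, of the Laurent polynomials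
  in \<open>u\<^sub>1/u\<^sub>0\<close> and \<open>u\<^sub>2/u\<^sub>0\<close>; the index \<open>(a, b)\<close> stands for the monomial
  \<open>(u\<^sub>1/u\<^sub>0)\<^sup>a (u\<^sub>2/u\<^sub>0)\<^sup>b\<close>. Sections of \<open>\<O> \<otimes> V\<close> over the triple intersection are the
  Laurent polynomials with coefficients in \<open>V\<close>.
\<close>

type_synonym 'v laurent = "(int \<times> int) \<Rightarrow>\<^sub>0 'v"

text \<open>The exponent of \<open>u\<^sub>i\<close> in the monomial with index \<open>e\<close>.\<close>

definition hom_exp :: "nat \<Rightarrow> int \<times> int \<Rightarrow> int" where
  "hom_exp i e = (if i = 1 then fst e else if i = 2 then snd e else - (fst e + snd e))"

text \<open>The functions on the intersection of the charts \<open>U\<^sub>k\<close>, \<open>k \<in> S\<close> (for nonempty \<open>S\<close>).\<close>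

definition regular :: "nat set \<Rightarrow> complex laurent set" where
  "regular S = {f. \<forall>e \<in> Poly_Mapping.keys f. \<forall>i \<in> {0, 1, 2} - S. hom_exp i e \<ge> 0}"

definition laurent_scale ::
    "(complex \<Rightarrow> 'v \<Rightarrow> 'v::ab_group_add) \<Rightarrow> complex laurent \<Rightarrow> 'v laurent \<Rightarrow> 'v laurent" where
  "laurent_scale s f m =
     (\<Sum>a \<in> Poly_Mapping.keys f. \<Sum>b \<in> Poly_Mapping.keys m.
        Poly_Mapping.single (a + b) (s (Poly_Mapping.lookup f a) (Poly_Mapping.lookup m b)))"


section \<open>Algebraic vector bundles on the projective plane\<close>

text \<open>
  Since vector bundles on affine planes are trivial (Quillen--Suslin), every vector bundle on
  \<open>\<P>\<^sup>2\<close> is given by transition matrices for the covering by \<open>U\<^sub>0, U\<^sub>1, U\<^sub>2\<close>. The pair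
  \<open>(n, g)\<close> stands for the bundle of rank \<open>n\<close> with frames \<open>e\<^sub>k\<close> (row vectors of sections over
  \<open>U\<^sub>k\<close>) related by \<open>e\<^sub>l = e\<^sub>k g\<^sub>k\<^sub>l\<close> over \<open>U\<^sub>k \<inter> U\<^sub>l\<close>. Only indices \<open>k, l < 3\<close> matter.
\<close>

type_synonym vbundle = "nat \<times> (nat \<Rightarrow> nat \<Rightarrow> complex laurent mat)"

definition regular_mat :: "nat set \<Rightarrow> nat \<Rightarrow> nat \<Rightarrow> complex laurent mat set" where
  "regular_mat S m n = {A \<in> carrier_mat m n. \<forall>i<m. \<forall>j<n. A $$ (i, j) \<in> regular S}"

definition regular_vec :: "nat set \<Rightarrow> nat \<Rightarrow> complex laurent vec set" where
  "regular_vec S n = {x \<in> carrier_vec n. \<forall>i<n. x $ i \<in> regular S}"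

fun vector_bundle :: "vbundle \<Rightarrow> bool" where
  "vector_bundle (n, g) \<longleftrightarrow>
     (\<forall>k<3. \<forall>l<3. g k l \<in> regular_mat {k, l} n n) \<and>
     (\<forall>k<3. g k k = 1\<^sub>m n) \<and>
     (\<forall>k<3. \<forall>l<3. \<forall>m<3. g k l * g l m = g k m)"

text \<open>
  A homomorphism is given over \<open>U\<^sub>k\<close> by a matrix \<open>\<phi>\<^sub>k\<close> acting on the coordinates with respect
  to the frames.
\<close>

fun bundle_hom :: "vbundle \<Rightarrow> vbundle \<Rightarrow> (nat \<Rightarrow> complex laurent mat) \<Rightarrow> bool" where
  "bundle_hom (m, g) (n, h) \<phi> \<longleftrightarrow>
     (\<forall>k<3. \<phi> k \<in> regular_mat {k} n m) \<and>
     (\<forall>k<3. \<forall>l<3. \<phi> k * g k l = h k l * \<phi> l)"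

text \<open>Short exact sequences \<open>0 \<rightarrow> E \<rightarrow> E' \<rightarrow> E'' \<rightarrow> 0\<close>; exactness is tested over each affine \<open>U\<^sub>k\<close>.\<close>

definition short_exact :: "vbundle \<Rightarrow> vbundle \<Rightarrow> vbundle \<Rightarrow> bool" where
  "short_exact E E' E'' \<longleftrightarrow>
     (\<exists>\<phi> \<psi>. bundle_hom E E' \<phi> \<and> bundle_hom E' E'' \<psi> \<and>
       (\<forall>k<3.
         inj_on (\<lambda>x. \<phi> k *\<^sub>v x) (regular_vec {k} (fst E)) \<and>
         (\<lambda>x. \<phi> k *\<^sub>v x) ` regular_vec {k} (fst E) =
           {y \<in> regular_vec {k} (fst E'). \<psi> k *\<^sub>v y = 0\<^sub>v (fst E'')} \<and>
         (\<lambda>y. \<psi> k *\<^sub>v y) ` regular_vec {k} (fst E') = regular_vec {k} (fst E'')))"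

text \<open>The line bundle \<open>\<O>(d)\<close>, with frame \<open>u\<^sub>k\<^sup>d\<close> over \<open>U\<^sub>k\<close>, so that \<open>g\<^sub>k\<^sub>l = (u\<^sub>l/u\<^sub>k)\<^sup>d\<close>.\<close>

definition monomial_index :: "nat \<Rightarrow> int \<times> int" where
  "monomial_index i = (if i = 1 then (1, 0) else if i = 2 then (0, 1) else (0, 0))"

definition ratio_power :: "nat \<Rightarrow> nat \<Rightarrow> int \<Rightarrow> complex laurent" where
  "ratio_power l k d =
     (let (a, b) = monomial_index l - monomial_index k in Poly_Mapping.single (d * a, d * b) 1)"

definition line_bundle :: "int \<Rightarrow> vbundle" where
  "line_bundle d = (1, \<lambda>k l. mat 1 1 (\<lambda>_. ratio_power l k d))"


section \<open>Rational cohomology of the projective plane\<close>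

text \<open>
  \<open>H\<^sup>*(\<P>\<^sup>2, \<rat>) = \<rat>[w\<^sup>2]/(w\<^sup>6)\<close>, where \<open>w\<^sup>2\<close> has degree 2: \<open>Coh a b c\<close> stands for
  \<open>a + b w\<^sup>2 + c w\<^sup>4\<close>.
\<close>

datatype coh_P2 = Coh rat rat rat

instantiation coh_P2 :: comm_ring_1
begin

definition "0 = Coh 0 0 0"
definition "1 = Coh 1 0 0"

fun plus_coh_P2 where
  "Coh a b c + Coh a' b' c' = Coh (a + a') (b + b') (c + c')"

fun minus_coh_P2 where
  "Coh a b c - Coh a' b' c' = Coh (a - a') (b - b') (c - c')"

fun uminus_coh_P2 where
  "- Coh a b c = Coh (- a) (- b) (- c)"

fun times_coh_P2 where
  "Coh a b c * Coh a' b' c' = Coh (a * a') (a * b' + b * a') (a * c' + b * b' + c * a')"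

instance
proof
  fix x y z :: coh_P2
  show "x + y + z = x + (y + z)" by (cases x; cases y; cases z) simp
  show "x + y = y + x" by (cases x; cases y) simp
  show "0 + x = x" by (cases x) (simp add: zero_coh_P2_def)
  show "- x + x = 0" by (cases x) (simp add: zero_coh_P2_def)
  show "x - y = x + - y" by (cases x; cases y) simp
  show "x * y * z = x * (y * z)" by (cases x; cases y; cases z) (simp add: algebra_simps)
  show "x * y = y * x" by (cases x; cases y) (simp add: algebra_simps)
  show "1 * x = x" by (cases x) (simp add: one_coh_P2_def)
  show "(x + y) * z = x * z + y * z" by (cases x; cases y; cases z) (simp add: algebra_simps)
  show "(0::coh_P2) \<noteq> 1" by (simp add: zero_coh_P2_def one_coh_P2_def)
qed

end

fun scaleQ :: "rat \<Rightarrow> coh_P2 \<Rightarrow> coh_P2" (infixr \<open>*\<^sub>Q\<close> 75) where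
  "t *\<^sub>Q Coh a b c = Coh (t * a) (t * b) (t * c)"

definition w2 :: coh_P2 where "w2 = Coh 0 1 0"
definition w4 :: coh_P2 where "w4 = Coh 0 0 1"

lemma w2_squared: "w2 ^ 2 = w4"
  by (simp add: w2_def w4_def power2_eq_square)

lemma w2_cubed: "w2 ^ 3 = 0"
  by (simp add: w2_def zero_coh_P2_def power3_eq_cube)


section \<open>The Chern character\<close>

text \<open>
  The Chern character is the additive invariant of vector bundles with
  \<open>ch(L) = exp(c\<^sub>1(L))\<close> for line bundles. On \<open>\<P>\<^sup>2\<close> the line bundles are the \<open>\<O>(d)\<close>, with
  \<open>c\<^sub>1(\<O>(d)) = d w\<^sup>2\<close>; their classes generate \<open>K\<^sub>0(\<P>\<^sup>2)\<close>, so that these two properties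
  determine the Chern character. A function with these properties exists also by a direct argument:
  the coefficients of \<open>1, w\<^sup>2, w\<^sup>4\<close> are obtained from transition matrices as the rank and the
  residues of the traces of the first two powers of the Atiyah class. The exponential stops at degree 2 because \<open>w\<^sup>6 = 0\<close>.
\<close>

definition is_chern_character :: "(vbundle \<Rightarrow> coh_P2) \<Rightarrow> bool" where
  "is_chern_character \<chi> \<longleftrightarrow>
     (\<forall>E E' E''. vector_bundle E \<and> vector_bundle E' \<and> vector_bundle E'' \<and> short_exact E E' E''
        \<longrightarrow> \<chi> E' = \<chi> E + \<chi> E'') \<and>
     (\<forall>d. \<chi> (line_bundle d) = (\<Sum>k\<le>2. (1 / fact k) *\<^sub>Q (of_int d * w2) ^ k))"

definition chern_character :: "vbundle \<Rightarrow> coh_P2" where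
  "chern_character = (SOME \<chi>. is_chern_character \<chi>)"

text \<open>
  A subsheaf of the push-forward of \<open>\<O> \<otimes> V\<close> from \<open>U\<^sub>0 \<inter> U\<^sub>1 \<inter> U\<^sub>2\<close> is given by its modules of
  sections \<open>M k\<close> over \<open>U\<^sub>k\<close>, \<open>k < 3\<close>. It is the sheaf of sections of the bundle \<open>(n, g)\<close> if these
  modules have bases (over the functions on \<open>U\<^sub>k\<close>) that are related by the matrices \<open>g\<^sub>k\<^sub>l\<close>.
\<close>

definition module_basis ::
    "(complex \<Rightarrow> 'v \<Rightarrow> 'v::ab_group_add) \<Rightarrow> complex laurent set \<Rightarrow> 'v laurent set \<Rightarrow>
     nat \<Rightarrow> (nat \<Rightarrow> 'v laurent) \<Rightarrow> bool" where
  "module_basis s A M n b \<longleftrightarrow>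
     bij_betw (\<lambda>f. \<Sum>a<n. laurent_scale s (f a) (b a)) ({..<n} \<rightarrow>\<^sub>E A) M"

fun sections_of ::
    "(complex \<Rightarrow> 'v \<Rightarrow> 'v::ab_group_add) \<Rightarrow> (nat \<Rightarrow> 'v laurent set) \<Rightarrow> vbundle \<Rightarrow> bool" where
  "sections_of s M (n, g) \<longleftrightarrow>
     vector_bundle (n, g) \<and>
     (\<exists>b. (\<forall>k<3. module_basis s (regular {k}) (M k) n (b k)) \<and>
          (\<forall>k<3. \<forall>l<3. \<forall>c<n. b l c = (\<Sum>a<n. laurent_scale s (g k l $$ (a, c)) (b k a))))"

definition sheaf_chern_character ::
    "(complex \<Rightarrow> 'v \<Rightarrow> 'v::ab_group_add) \<Rightarrow> (nat \<Rightarrow> 'v laurent set) \<Rightarrow> coh_P2" where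
  "sheaf_chern_character s M = chern_character (SOME E. sections_of s M E)"


section \<open>The Rees bundle of three filtrations\<close>

text \<open>
  \<open>R\<^sup>2(V, F, G) = \<Sum> u\<^sup>-\<^sup>p v\<^sup>-\<^sup>q (F\<^sup>p \<inter> G\<^sup>q)\<close>, as a set of Laurent polynomials in \<open>u, v\<close>
  (here the index \<open>(a, b)\<close> stands for \<open>u\<^sup>a v\<^sup>b\<close>). As the sum is direct, membership is a condition on
  each coefficient.
\<close>

definition rees2 :: "(int \<Rightarrow> 'v::ab_group_add set) \<Rightarrow> (int \<Rightarrow> 'v set) \<Rightarrow> 'v laurent set" where
  "rees2 F G = {m. \<forall>p q. Poly_Mapping.lookup m (- p, - q) \<in> F p \<inter> G q}"

text \<open>
  For \<open>{i, j, k} = {0, 1, 2}\<close> with \<open>i < j\<close>, the index of \<open>(u\<^sub>i/u\<^sub>k)\<^sup>a (u\<^sub>j/u\<^sub>k)\<^sup>b\<close> as a monomial in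
  \<open>u\<^sub>1/u\<^sub>0\<close> and \<open>u\<^sub>2/u\<^sub>0\<close>. Accordingly \<open>Poly_Mapping.map_key (chart_index k)\<close> rewrites a Laurent
  polynomial in the coordinates \<open>u = u\<^sub>i/u\<^sub>k\<close> and \<open>v = u\<^sub>j/u\<^sub>k\<close> of \<open>U\<^sub>k\<close>.
\<close>

definition chart_index :: "nat \<Rightarrow> int \<times> int \<Rightarrow> int \<times> int" where
  "chart_index k = (\<lambda>(a, b).
     if k = 0 then (a, b) else if k = 1 then (- a - b, b) else (b, - a - b))"

definition rees_bundle ::
    "(int \<Rightarrow> 'v::ab_group_add set) \<Rightarrow> (int \<Rightarrow> 'v set) \<Rightarrow> (int \<Rightarrow> 'v set) \<Rightarrow>
     nat \<Rightarrow> 'v laurent set" where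
  "rees_bundle F0 F1 F2 k =
     {m. Poly_Mapping.map_key (chart_index k) m \<in>
           (if k = 0 then rees2 F1 F2 else if k = 1 then rees2 F0 F2 else rees2 F0 F1)}"

end

theory Submission
  imports Defs
begin

text \<open>
  The Chern character exists because rank and the residues of the traces of the first two powers of
  the Atiyah class are computed from transition matrices, do not depend on the frames, and are
  additive: a short exact sequence splits over each chart, so after a change of frames the
  transition matrices of the middle term are block triangular.

  A short sequence of Rees bundles is exact as soon as it is exact in each degree over each chart.
  Two filtrations of a finite-dimensional space always have a common adapted basis, which makes the
  Rees modules free, with transition matrices consisting of monomials. If \<open>F0\<close> has a single jump,
  splitting off one adapted vector at a time gives a sum of line bundles. In general, the top step
  \<open>F0 r\<close> is shrunk to a hyperplane. This changes the Rees bundle by \<open>\<O>(d)\<close> minus \<open>\<O>(d - 1)\<close>, where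
  \<open>d = r + p + q\<close> and \<open>p\<close>, \<open>q\<close> are the degrees of the filtrations induced by \<open>F1\<close>, \<open>F2\<close> on the
  one-dimensional quotient. Both sides of the formula change in the same way.
\<close>


section \<open>Logarithmic derivatives of Laurent polynomials\<close>

text \<open>Two filtrations have a common adapted basis, three in general do not; otherwise the
  bundle would be a sum of line bundles of degrees r + p + q. This is why the formula has two sums:
  r^2 + 2rp + 2rq is (r + p + q)^2 - (p + q)^2, so for simultaneously split filtrations the sums
  combine to the exponentials of the line bundles, while in general the bidegrees (p, q) counted on
  V and on the graded pieces of F0 may differ. The proof can still use exact sequences because each
  chart sees only two of the filtrations, so exactness concerns pairwise intersections only. The
  statement is about objects picked by choice: the Chern character itself and the bundle that
  presents a sheaf. So a Chern character has to be constructed before anything can be computed, and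
  bundles with the same sections must be shown to have the same value. All residue arguments rest on
  one remark: u_i d/du_i kills the monomials without u_i, so it turns a function regular along u_i =
  0 into one that vanishes there and has no constant term.\<close>

abbreviation (input) lookup where "lookup \<equiv> Poly_Mapping.lookup"
abbreviation (input) keys where "keys \<equiv> Poly_Mapping.keys"
abbreviation (input) single where "single \<equiv> Poly_Mapping.single"

section \<open>Orders along the coordinate lines, and regular functions\<close>

lemma hom_exp_add: "hom_exp i (a + b) = hom_exp i a + hom_exp i b"
  by (simp add: hom_exp_def)

lemma hom_exp_zero [simp]: "hom_exp i 0 = 0"
  by (simp add: hom_exp_def)

lemma hom_exp_diff: "hom_exp i (a - b) = hom_exp i a - hom_exp i b"
  by (simp add: hom_exp_def)

text \<open>The Laurent polynomials of order at least \<open>m\<close> along the line u_i =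
  0.\<close>

definition vanish_ge :: "nat \<Rightarrow> int \<Rightarrow> complex laurent set" where
  "vanish_ge i m = {f. \<forall>e \<in> keys f. hom_exp i e \<ge> m}"

lemma vanish_ge_add: "f \<in> vanish_ge i m \<Longrightarrow> g \<in> vanish_ge i m \<Longrightarrow> f + g \<in> vanish_ge i m"
  using keys_add[of f g] by (auto simp: vanish_ge_def)

lemma vanish_ge_zero [simp]: "0 \<in> vanish_ge i m"
  by (simp add: vanish_ge_def)

lemma vanish_ge_sum: "(\<And>x. x \<in> A \<Longrightarrow> f x \<in> vanish_ge i m) \<Longrightarrow> sum f A \<in> vanish_ge i m"
  by (induction A rule: infinite_finite_induct) (auto intro: vanish_ge_add)

lemma vanish_ge_mult:
  assumes "f \<in> vanish_ge i m" "g \<in> vanish_ge i n"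
  shows "f * g \<in> vanish_ge i (m + n)"
  unfolding vanish_ge_def
proof (clarify)
  fix a b assume "(a, b) \<in> keys (f * g)"
  then obtain x y where "(a, b) = x + y" "x \<in> keys f" "y \<in> keys g"
    using keys_mult[of f g] by blast
  with assms show "hom_exp i (a, b) \<ge> m + n"
    by (metis (mono_tags, lifting) add_mono hom_exp_add mem_Collect_eq vanish_ge_def)
qed

text \<open>Index 0 is the constant monomial, of exponent 0 in every variable. Its coefficient
  serves as the residue with respect to dx/x and dy/y, where x = u_1/u_0 and y = u_2/u_0.\<close>

lemma vanish_ge_coeff_0: "f \<in> vanish_ge i 1 \<Longrightarrow> lookup f 0 = 0"
  by (auto simp: vanish_ge_def in_keys_iff dest: bspec[of _ _ 0])

lemma regular_iff: "f \<in> regular S \<longleftrightarrow> (\<forall>i \<in> {0, 1, 2} - S. f \<in> vanish_ge i 0)"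
  by (auto simp: regular_def vanish_ge_def)

lemma regular_add: "f \<in> regular S \<Longrightarrow> g \<in> regular S \<Longrightarrow> f + g \<in> regular S"
  by (simp add: regular_iff vanish_ge_add)

lemma regular_zero [simp]: "0 \<in> regular S"
  by (simp add: regular_iff)

lemma regular_one [simp]: "1 \<in> regular S"
  by (simp add: regular_def)

lemma regular_mult: "f \<in> regular S \<Longrightarrow> g \<in> regular S \<Longrightarrow> f * g \<in> regular S"
  using vanish_ge_mult[of f _ 0 g 0] by (auto simp: regular_iff)

lemma regular_sum: "(\<And>x. x \<in> A \<Longrightarrow> f x \<in> regular S) \<Longrightarrow> sum f A \<in> regular S"
  by (induction A rule: infinite_finite_induct) (auto intro: regular_add)

lemma regular_uminus: "f \<in> regular S \<Longrightarrow> - f \<in> regular S"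
  by (auto simp: regular_def)

lemma regular_diff: "f \<in> regular S \<Longrightarrow> g \<in> regular S \<Longrightarrow> f - g \<in> regular S"
  using regular_add[of f S "- g"] regular_uminus[of g S] by simp

lemma regular_mono: "S \<subseteq> T \<Longrightarrow> f \<in> regular S \<Longrightarrow> f \<in> regular T"
  by (auto simp: regular_def)

text \<open>The operator u_i d/du_i. Monomials are eigenvectors, so supports do not grow, and unlike
  a plain partial derivative it keeps functions of degree 0 in degree 0.\<close>

definition log_deriv :: "nat \<Rightarrow> complex laurent \<Rightarrow> complex laurent" where
  "log_deriv i f = Poly_Mapping.mapp (\<lambda>e c. of_int (hom_exp i e) * c) f"

lemma lookup_log_deriv:
  "lookup (log_deriv i f) e = of_int (hom_exp i e) * lookup f e"
  by (simp add: log_deriv_def lookup_mapp in_keys_iff when_def)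

lemma log_deriv_add: "log_deriv i (f + g) = log_deriv i f + log_deriv i g"
  by (rule poly_mapping_eqI) (simp add: lookup_log_deriv lookup_add algebra_simps)

lemma log_deriv_zero [simp]: "log_deriv i 0 = 0"
  by (rule poly_mapping_eqI) (simp add: lookup_log_deriv)

lemma log_deriv_one [simp]: "log_deriv i 1 = 0"
  by (rule poly_mapping_eqI) (simp add: lookup_log_deriv lookup_one when_def)

lemma log_deriv_sum: "log_deriv i (sum f A) = (\<Sum>x\<in>A. log_deriv i (f x))"
  by (induction A rule: infinite_finite_induct) (auto simp: log_deriv_add)

lemma log_deriv_single:
  "log_deriv i (single e c) = single e (of_int (hom_exp i e) * c)"
  by (rule poly_mapping_eqI) (simp add: lookup_log_deriv lookup_single when_def)

text \<open>Euler's relation: the functions have degree 0 in u_0, u_1, u_2, so the three operators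
  add up to zero. It lets the index 0 be treated like the other two.\<close>

lemma log_deriv_euler: "log_deriv 0 f = - log_deriv 1 f - log_deriv 2 f"
  by (rule poly_mapping_eqI)
    (simp add: lookup_log_deriv lookup_minus hom_exp_def algebra_simps)

lemma poly_mapping_sum_single:
  fixes f :: "'a \<Rightarrow>\<^sub>0 'b::comm_monoid_add"
  shows "f = (\<Sum>e \<in> keys f. single e (lookup f e))"
  by (rule poly_mapping_eqI)
    (auto simp: lookup_sum lookup_single when_def in_keys_iff sum.delta' if_distrib cong: if_cong)

lemma poly_mapping_single_induct [case_names zero add single]:
  fixes f :: "'a \<Rightarrow>\<^sub>0 'b::comm_monoid_add"
  assumes "P 0" and "\<And>f g. P f \<Longrightarrow> P g \<Longrightarrow> P (f + g)"
    and "\<And>e c. P (single e c)"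
  shows "P f"
proof -
  have "P (\<Sum>e \<in> A. single e (lookup f e))" for A
    by (induction A rule: infinite_finite_induct) (use assms in auto)
  then show ?thesis using poly_mapping_sum_single[of f] by metis
qed

lemma log_deriv_mult: "log_deriv i (f * g) = log_deriv i f * g + f * log_deriv i g"
proof (induction f rule: poly_mapping_single_induct)
  case (single e c)
  show ?case
  proof (induction g rule: poly_mapping_single_induct)
    case (single e' c')
    show ?case
      by (simp add: mult_single log_deriv_single hom_exp_add algebra_simps flip: single_add)
  qed (auto simp: log_deriv_add algebra_simps)
qed (auto simp: log_deriv_add algebra_simps)

lemma keys_log_deriv: "keys (log_deriv i f) \<subseteq> keys f"
  by (simp add: log_deriv_def keys_mapp_subset)

lemma log_deriv_vanish_ge: "f \<in> vanish_ge i m \<Longrightarrow> log_deriv j f \<in> vanish_ge i m"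
  using keys_log_deriv[of j f] by (auto simp: vanish_ge_def)

text \<open>The terms of exponent 0 in u_i are exactly those that the operator kills. Every
  vanishing of a residue below comes from here.\<close>

lemma log_deriv_vanish_ge_1: "f \<in> vanish_ge i 0 \<Longrightarrow> log_deriv i f \<in> vanish_ge i 1"
proof -
  assume f: "f \<in> vanish_ge i 0"
  have "hom_exp i e \<ge> 1" if "e \<in> keys (log_deriv i f)" for e
  proof -
    have "hom_exp i e \<noteq> 0" using that by (auto simp: in_keys_iff lookup_log_deriv)
    moreover have "hom_exp i e \<ge> 0" using that keys_log_deriv[of i f] f by (auto simp: vanish_ge_def)
    ultimately show ?thesis by simp
  qed
  then show ?thesis by (auto simp: vanish_ge_def)
qed

section \<open>Residues of traces\<close>

definition res_trace :: "complex laurent mat \<Rightarrow> complex" where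
  "res_trace A = lookup (\<Sum>i<dim_row A. A $$ (i, i)) 0"

abbreviation mat_deriv :: "nat \<Rightarrow> complex laurent mat \<Rightarrow> complex laurent mat" where
  "mat_deriv i \<equiv> map_mat (log_deriv i)"

lemma res_trace_add:
  "A \<in> carrier_mat n n \<Longrightarrow> B \<in> carrier_mat n n \<Longrightarrow> res_trace (A + B) = res_trace A + res_trace B"
  by (simp add: res_trace_def lookup_add sum.distrib)

lemma res_trace_minus:
  "A \<in> carrier_mat n n \<Longrightarrow> B \<in> carrier_mat n n \<Longrightarrow> res_trace (A - B) = res_trace A - res_trace B"
  by (simp add: res_trace_def lookup_minus sum_subtractf)

lemma res_trace_uminus: "A \<in> carrier_mat n n \<Longrightarrow> res_trace (- A) = - res_trace A"
  by (simp add: res_trace_def sum_negf)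

lemma res_trace_mult_commute:
  assumes "A \<in> carrier_mat m n" "B \<in> carrier_mat n m"
  shows "res_trace (A * B) = res_trace (B * A)"
proof -
  have "(\<Sum>i<m. (A * B) $$ (i, i)) = (\<Sum>i<m. \<Sum>j<n. A $$ (i, j) * B $$ (j, i))"
    using assms by (simp add: scalar_prod_def atLeast0LessThan)
  also have "\<dots> = (\<Sum>j<n. \<Sum>i<m. B $$ (j, i) * A $$ (i, j))"
    by (subst sum.swap) (simp add: mult.commute)
  also have "\<dots> = (\<Sum>j<n. (B * A) $$ (j, j))"
    using assms by (simp add: scalar_prod_def atLeast0LessThan)
  finally show ?thesis
    using assms by (simp add: res_trace_def)
qed

lemma mat_deriv_mult:
  assumes "A \<in> carrier_mat m n" "B \<in> carrier_mat n k"
  shows "mat_deriv i (A * B) = mat_deriv i A * B + A * mat_deriv i B"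
  using assms
  by (intro eq_matI) (simp_all add: scalar_prod_def log_deriv_sum log_deriv_mult sum.distrib)

lemma regular_matD: "A \<in> regular_mat S m n \<Longrightarrow> A \<in> carrier_mat m n"
  by (simp add: regular_mat_def)

lemma regular_mat_mult:
  "A \<in> regular_mat S m n \<Longrightarrow> B \<in> regular_mat S n k \<Longrightarrow> A * B \<in> regular_mat S m k"
  by (auto simp: regular_mat_def scalar_prod_def intro!: regular_sum regular_mult)

lemma regular_mat_one: "1\<^sub>m n \<in> regular_mat S n n"
  by (auto simp: regular_mat_def)

lemma regular_mat_mono: "S \<subseteq> T \<Longrightarrow> A \<in> regular_mat S m n \<Longrightarrow> A \<in> regular_mat T m n"
  by (auto simp: regular_mat_def intro: regular_mono)

definition vanish_mat :: "nat \<Rightarrow> int \<Rightarrow> nat \<Rightarrow> nat \<Rightarrow> complex laurent mat set" where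
  "vanish_mat i m a b = {A \<in> carrier_mat a b. \<forall>j<a. \<forall>k<b. A $$ (j, k) \<in> vanish_ge i m}"

lemma vanish_mat_mult:
  assumes "A \<in> vanish_mat i m a b" "B \<in> vanish_mat i n b c"
  shows "A * B \<in> vanish_mat i (m + n) a c"
  using assms by (auto simp: vanish_mat_def scalar_prod_def intro!: vanish_ge_sum vanish_ge_mult)

lemma vanish_mat_deriv: "A \<in> vanish_mat i m a b \<Longrightarrow> mat_deriv j A \<in> vanish_mat i m a b"
  by (auto simp: vanish_mat_def intro!: log_deriv_vanish_ge)

lemma vanish_mat_deriv_1: "A \<in> vanish_mat i 0 a b \<Longrightarrow> mat_deriv i A \<in> vanish_mat i 1 a b"
  by (auto simp: vanish_mat_def intro!: log_deriv_vanish_ge_1)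

lemma res_trace_vanish: "A \<in> vanish_mat i 1 n n \<Longrightarrow> res_trace A = 0"
  by (auto simp: res_trace_def vanish_mat_def intro!: vanish_ge_coeff_0 vanish_ge_sum)

lemma regular_mat_vanish:
  "A \<in> regular_mat S a b \<Longrightarrow> i \<in> {0, 1, 2} - S \<Longrightarrow> A \<in> vanish_mat i 0 a b"
  unfolding regular_mat_def vanish_mat_def regular_iff by blast

section \<open>Residues of tr(P dX) and tr(P dX Q dY)\<close>

context
  fixes n :: nat
begin

lemmas sq_assoc = assoc_mult_mat[of _ n n _ n _ n]

lemmas sq_simps = sq_assoc mult_add_distrib_mat[of _ n n _ n] add_mult_distrib_mat[of _ n n _ _ n]
  mult_carrier_mat[of _ n n _ n] mat_deriv_mult[of _ n n _ n]
  res_trace_add[of _ n] add_carrier_mat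

end

text \<open>The residue of tr(P dX) in the direction of x = u_1/u_0.\<close>

definition dlog_form :: "complex laurent mat \<Rightarrow> complex laurent mat \<Rightarrow> complex" where
  "dlog_form P X = res_trace (P * mat_deriv 1 X)"

text \<open>The residue of tr(P dX Q dY): antisymmetrising in the two derivatives gives the
  coefficient of a 2-form. The slot \<open>Q\<close> receives the factor that the Leibniz rule
  leaves between the two differentials.\<close>

definition wedge_form ::
    "complex laurent mat \<Rightarrow> complex laurent mat \<Rightarrow> complex laurent mat \<Rightarrow> complex laurent mat
     \<Rightarrow> complex" where
  "wedge_form P X Q Y =
     res_trace (P * mat_deriv 1 X * Q * mat_deriv 2 Y)
     - res_trace (P * mat_deriv 2 X * Q * mat_deriv 1 Y)"

text \<open>The Leibniz rule; the factor left behind the differential is moved to the front by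
  cyclicity of the trace.\<close>

lemma dlog_form_mult:
  assumes "P \<in> carrier_mat n n" "X \<in> carrier_mat n n" "Y \<in> carrier_mat n n"
  shows "dlog_form P (X * Y) = dlog_form (Y * P) X + dlog_form (P * X) Y"
proof -
  have "res_trace (P * (mat_deriv 1 X * Y)) = res_trace (Y * (P * mat_deriv 1 X))"
    using res_trace_mult_commute[of "P * mat_deriv 1 X" n n Y] assms by (simp add: sq_simps[of _ n])
  then show ?thesis
    using assms by (simp add: dlog_form_def sq_simps[of _ n])
qed

lemma wedge_form_mult_left:
  assumes "P \<in> carrier_mat n n" "X \<in> carrier_mat n n" "X' \<in> carrier_mat n n"
    "Q \<in> carrier_mat n n" "Y \<in> carrier_mat n n"
  shows "wedge_form P (X * X') Q Y = wedge_form P X (X' * Q) Y + wedge_form (P * X) X' Q Y"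
  using assms by (simp add: wedge_form_def sq_simps[of _ n])

lemma wedge_form_mult_right:
  assumes "P \<in> carrier_mat n n" "X \<in> carrier_mat n n" "Y \<in> carrier_mat n n"
    "Q \<in> carrier_mat n n" "Y' \<in> carrier_mat n n"
  shows "wedge_form P X Q (Y * Y') = wedge_form (Y' * P) X Q Y + wedge_form P X (Q * Y) Y'"
proof -
  have "res_trace (P * (mat_deriv i X * (Q * (mat_deriv j Y * Y')))) =
        res_trace (Y' * (P * (mat_deriv i X * (Q * mat_deriv j Y))))" for i j
    using res_trace_mult_commute[of "P * (mat_deriv i X * (Q * mat_deriv j Y))" n n Y'] assms
    by (simp add: sq_simps[of _ n])
  then show ?thesis
    using assms by (simp add: wedge_form_def sq_simps[of _ n])
qed

text \<open>A form that is regular on a whole affine chart has no residue: for either coordinate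
  line of the chart, the derivative of that index raises the order along the line.\<close>

lemma dlog_form_regular:
  assumes "P \<in> regular_mat S n n" "X \<in> regular_mat S n n" "{0, 1, 2} - S = {i, j}" "i \<noteq> j"
  shows "dlog_form P X = 0"
proof -
  have z: "res_trace (P * mat_deriv k X) = 0" if "k \<in> {i, j}" for k
  proof -
    have "k \<in> {0, 1, 2} - S" using that assms(3) by simp
    then have "P * mat_deriv k X \<in> vanish_mat k (0 + 1) n n"
      using assms(1,2) by (intro vanish_mat_mult vanish_mat_deriv_1 regular_mat_vanish)
    then show ?thesis by (simp add: res_trace_vanish)
  qed
  show ?thesis
  proof (cases "1 \<in> {i, j}")
    case True
    with z show ?thesis by (simp add: dlog_form_def)
  next
    case False
    have ij: "i \<in> {0,1,2}" "j \<in> {0,1,2}" using assms(3) by blast+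
    \<comment> \<open>Only the chart U_1 remains. There the derivative of index 1 is minus the sum
      of the other two, and both of these have no residue.\<close>
    with False assms(4) have "{i, j} = {0, 2}" by auto
    then have z0: "res_trace (P * mat_deriv 0 X) = 0" and z2: "res_trace (P * mat_deriv 2 X) = 0"
      using z by blast+
    have c: "P \<in> carrier_mat n n" "X \<in> carrier_mat n n"
      using assms(1,2) by (auto dest: regular_matD)
    have "mat_deriv 1 X = - mat_deriv 0 X - mat_deriv 2 X"
      using c by (intro eq_matI) (auto simp: log_deriv_euler)
    then have "P * mat_deriv 1 X = - (P * mat_deriv 0 X) - P * mat_deriv 2 X"
      using c by (simp add: mult_minus_distrib_mat[of _ n n _ n])
    then have "dlog_form P X = - res_trace (P * mat_deriv 0 X) - res_trace (P * mat_deriv 2 X)"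
      using c by (simp add: dlog_form_def res_trace_minus[of _ n] res_trace_uminus[of _ n])
    with z0 z2 show ?thesis by simp
  qed
qed

text \<open>Regularity along one line u_i = 0 is enough for a 2-form, since up to Euler's relation
  every term contains the derivative of index i. Hence forms on the overlap of two charts have no
  residue, and only those that involve all three charts count.\<close>

lemma wedge_form_regular:
  assumes "P \<in> regular_mat S n n" "X \<in> regular_mat S n n" "Q \<in> regular_mat S n n"
    "Y \<in> regular_mat S n n" "i \<in> {0, 1, 2} - S"
  shows "wedge_form P X Q Y = 0"
proof -
  note v = assms(1-4)[THEN regular_mat_vanish, OF assms(5)]
  have c: "P \<in> carrier_mat n n" "X \<in> carrier_mat n n" "Q \<in> carrier_mat n n" "Y \<in> carrier_mat n n"
    using assms(1-4) by (auto dest: regular_matD)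
  have z1: "res_trace (P * mat_deriv i X * Q * mat_deriv j Y) = 0" for j
  proof -
    have "P * mat_deriv i X * Q * mat_deriv j Y \<in> vanish_mat i (0 + 1 + 0 + 0) n n"
      by (rule vanish_mat_mult[OF vanish_mat_mult[OF vanish_mat_mult[OF v(1)
            vanish_mat_deriv_1[OF v(2)]] v(3)] vanish_mat_deriv[OF v(4)]])
    then show ?thesis by (simp add: res_trace_vanish)
  qed
  have z2: "res_trace (P * mat_deriv j X * Q * mat_deriv i Y) = 0" for j
  proof -
    have "P * mat_deriv j X * Q * mat_deriv i Y \<in> vanish_mat i (0 + 0 + 0 + 1) n n"
      by (rule vanish_mat_mult[OF vanish_mat_mult[OF vanish_mat_mult[OF v(1)
            vanish_mat_deriv[OF v(2)]] v(3)] vanish_mat_deriv_1[OF v(4)]])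
    then show ?thesis by (simp add: res_trace_vanish)
  qed
  consider "i = 1" | "i = 2" | "i = 0" using assms(5) by auto
  then show ?thesis
  proof cases
    case 3
    \<comment> \<open>For i = 0 the derivative of index 1 is eliminated; the terms in which index 2
      then occurs twice cancel in the difference.\<close>
    have e1: "mat_deriv 1 Z = - mat_deriv 0 Z - mat_deriv 2 Z" if "Z \<in> carrier_mat n n" for Z
      using that by (intro eq_matI) (auto simp: log_deriv_euler)
    have "res_trace (P * mat_deriv 1 X * Q * mat_deriv 2 Y) =
        - res_trace (P * mat_deriv 0 X * Q * mat_deriv 2 Y) - res_trace (P * mat_deriv 2 X * Q * mat_deriv 2 Y)"
      using c by (simp add: e1[unfolded One_nat_def] mult_minus_distrib_mat[of _ n n _ n] minus_mult_distrib_mat[of _ n n _ _ n]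
          res_trace_minus[of _ n] res_trace_uminus[of _ n] sq_simps[of _ n])
    moreover have "res_trace (P * mat_deriv 2 X * Q * mat_deriv 1 Y) =
        - res_trace (P * mat_deriv 2 X * Q * mat_deriv 0 Y) - res_trace (P * mat_deriv 2 X * Q * mat_deriv 2 Y)"
      using c by (simp add: e1[unfolded One_nat_def] mult_minus_distrib_mat[of _ n n _ n] minus_mult_distrib_mat[of _ n n _ _ n]
          res_trace_minus[of _ n] res_trace_uminus[of _ n] sq_simps[of _ n])
    ultimately show ?thesis using z1[of 2] z2[of 2] 3 by (simp add: wedge_form_def)
  qed (use z1 z2 in \<open>simp_all add: wedge_form_def\<close>)
qed

section \<open>Invariance under changes of frames\<close>

text \<open>Both matrices are required to be regular: \<open>H k\<close> is invertible over the
  functions on U_k, not merely on the triple intersection.\<close>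

definition frame_change ::
    "nat \<Rightarrow> (nat \<Rightarrow> complex laurent mat) \<Rightarrow> (nat \<Rightarrow> complex laurent mat) \<Rightarrow> bool" where
  "frame_change n H K \<longleftrightarrow>
     (\<forall>k<3. H k \<in> regular_mat {k} n n \<and> K k \<in> regular_mat {k} n n \<and>
        H k * K k = 1\<^sub>m n \<and> K k * H k = 1\<^sub>m n)"

definition reframe ::
    "(nat \<Rightarrow> complex laurent mat) \<Rightarrow> (nat \<Rightarrow> complex laurent mat) \<Rightarrow>
     (nat \<Rightarrow> nat \<Rightarrow> complex laurent mat) \<Rightarrow> nat \<Rightarrow> nat \<Rightarrow> complex laurent mat" where
  "reframe H K g k l = H k * g k l * K l"

text \<open>The residue of tr(g^-1 dg). The first Chern class is the degree on the line u_2 = 0,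
  which U_0 and U_1 cover, so one transition matrix and one derivative suffice.\<close>

definition chern_1 :: "(nat \<Rightarrow> nat \<Rightarrow> complex laurent mat) \<Rightarrow> complex" where
  "chern_1 g = dlog_form (g 1 0) (g 0 1)"

text \<open>
  The residue of \<open>tr (dg\<^sub>0\<^sub>1 \<and> dg\<^sub>1\<^sub>2 g\<^sub>2\<^sub>0)\<close>, the trace of the square of the Atiyah class; in
  \<open>wedge_form\<close> the derivatives \<open>x \<partial>/\<partial>x\<close>, \<open>y \<partial>/\<partial>y\<close> replace \<open>d\<close>, and the residue with respect to
  \<open>dx/x \<and> dy/y\<close> is the coefficient of index \<open>0\<close>.
\<close>

definition chern_2 :: "nat \<Rightarrow> (nat \<Rightarrow> nat \<Rightarrow> complex laurent mat) \<Rightarrow> complex" where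
  "chern_2 n g = wedge_form (g 2 0) (g 0 1) (1\<^sub>m n) (g 1 2)"

section \<open>Transition matrices under changes of frames\<close>

lemma vector_bundleD:
  assumes "vector_bundle (n, g)" "k < 3" "l < 3"
  shows "g k l \<in> regular_mat {k, l} n n" "g k l \<in> carrier_mat n n" "g k k = 1\<^sub>m n"
    "m < 3 \<Longrightarrow> g k l * g l m = g k m"
  using assms by (auto dest: regular_matD)

lemma reframe_vector_bundle:
  assumes vb: "vector_bundle (n, g)" and fr: "frame_change n H K"
  shows "vector_bundle (n, reframe H K g)"
proof -
  have HK: "H k \<in> regular_mat {k} n n" "K k \<in> regular_mat {k} n n"
    "H k \<in> carrier_mat n n" "K k \<in> carrier_mat n n" "H k * K k = 1\<^sub>m n" "K k * H k = 1\<^sub>m n" if "k < 3" for k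
    using fr that by (auto simp: frame_change_def dest: regular_matD)
  note g = vector_bundleD[OF vb]
  have 1: "reframe H K g k l \<in> regular_mat {k, l} n n" if "k < 3" "l < 3" for k l
    unfolding reframe_def
    by (rule regular_mat_mult[OF regular_mat_mult[OF regular_mat_mono[OF _ HK(1)] g(1)]
          regular_mat_mono[OF _ HK(2)]]) (use that in auto)
  have 2: "reframe H K g k k = 1\<^sub>m n" if "k < 3" for k
    using HK[OF that] g(3)[OF that that] by (simp add: reframe_def)
  have 3: "reframe H K g k l * reframe H K g l m = reframe H K g k m"
    if "k < 3" "l < 3" "m < 3" for k l m
  proof -
    note c = g(2)[OF that(1,2)] g(2)[OF that(2,3)] HK(3,4)[OF that(1)] HK(3,4)[OF that(2)] HK(3,4)[OF that(3)]
    have "reframe H K g k l * reframe H K g l m = H k * (g k l * ((K l * H l) * (g l m * K m)))"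
      using c by (simp add: reframe_def sq_simps[of _ n])
    also have "\<dots> = H k * (g k l * g l m) * K m"
      unfolding HK(6)[OF that(2)] using c by (simp add: sq_simps[of _ n])
    finally show ?thesis
      using g(4)[OF that] by (simp add: reframe_def)
  qed
  show ?thesis using 1 2 3 by simp
qed

lemma transition_regular:
  assumes "vector_bundle (n, g)" "a < 3" "b < 3" "a \<in> S" "b \<in> S"
  shows "g a b \<in> regular_mat S n n"
  using regular_mat_mono[OF _ vector_bundleD(1)[OF assms(1-3)], of S] assms(4,5) by simp

lemma transition_carrier:
  assumes "vector_bundle (n, g)"
  shows "g 0 1 \<in> carrier_mat n n" "g 1 0 \<in> carrier_mat n n" "g 0 2 \<in> carrier_mat n n"
    "g 2 0 \<in> carrier_mat n n" "g 1 2 \<in> carrier_mat n n" "g 2 1 \<in> carrier_mat n n"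
  by (rule vector_bundleD(2)[OF assms]; simp)+

lemma frame_regular:
  assumes "h \<in> regular_mat {j} n n" "k \<in> regular_mat {j} n n" "j \<in> S"
  shows "h \<in> regular_mat S n n" "k \<in> regular_mat S n n"
  using regular_mat_mono[OF _ assms(1), of S] regular_mat_mono[OF _ assms(2), of S] assms(3) by simp_all

text \<open>Expanding d(h g_01) leaves the original form and tr(k dh), which lives on U_0 alone and
  so has no residue. The frame over U_1 is treated in the same way.\<close>

lemma chern_1_frame_0:
  assumes vb: "vector_bundle (n, g)" and h: "h \<in> regular_mat {0} n n" "k \<in> regular_mat {0} n n"
    and inv: "k * h = 1\<^sub>m n"
  shows "dlog_form (g 1 0 * k) (h * g 0 1) = dlog_form (g 1 0) (g 0 1)"
proof -
  note g = vector_bundleD[OF vb]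
  have c: "g 1 0 \<in> carrier_mat n n" "g 0 1 \<in> carrier_mat n n" "h \<in> carrier_mat n n" "k \<in> carrier_mat n n"
    using g(2) h by (auto dest: regular_matD)
  have "dlog_form (g 1 0 * k) (h * g 0 1) =
      dlog_form (g 0 1 * (g 1 0 * k)) h + dlog_form (g 1 0 * k * h) (g 0 1)"
    using c by (intro dlog_form_mult) auto
  moreover have "g 0 1 * (g 1 0 * k) = k"
    using c g(4)[of 0 1 0] g(3)[of 0 0] by (simp add: sq_assoc[of _ n, symmetric])
  moreover have "g 1 0 * k * h = g 1 0"
    using c inv by (simp add: sq_assoc[of _ n])
  moreover have "dlog_form k h = 0"
    by (rule dlog_form_regular[OF h(2,1), of 1 2]) auto
  ultimately show ?thesis by simp
qed

lemma chern_1_frame_1: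
  assumes vb: "vector_bundle (n, g)" and h: "h \<in> regular_mat {1} n n" "k \<in> regular_mat {1} n n"
    and inv: "k * h = 1\<^sub>m n"
  shows "dlog_form (h * g 1 0) (g 0 1 * k) = dlog_form (g 1 0) (g 0 1)"
proof -
  note g = vector_bundleD[OF vb]
  have c: "g 1 0 \<in> carrier_mat n n" "g 0 1 \<in> carrier_mat n n" "h \<in> carrier_mat n n" "k \<in> carrier_mat n n"
    using g(2) h by (auto dest: regular_matD)
  have "dlog_form (h * g 1 0) (g 0 1 * k) =
      dlog_form (k * (h * g 1 0)) (g 0 1) + dlog_form (h * g 1 0 * g 0 1) k"
    using c by (intro dlog_form_mult) auto
  moreover have "k * (h * g 1 0) = g 1 0"
    using c inv by (simp add: sq_assoc[of _ n, symmetric])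
  moreover have "h * g 1 0 * g 0 1 = h"
    using c g(4)[of 1 0 1] g(3)[of 1 1] by (simp add: sq_assoc[of _ n])
  moreover have "dlog_form h k = 0"
    by (rule dlog_form_regular[OF h, of 0 2]) auto
  ultimately show ?thesis by simp
qed

text \<open>The extra term pairs dh with dg_12 and involves all three charts. As g_01 g_12 = g_02,
  the Leibniz rule writes it as a difference of two terms, one on U_0 \<inter> U_2 and one on U_0
  \<inter> U_1, and these have no residue.\<close>

lemma chern_2_frame_0:
  assumes vb: "vector_bundle (n, g)" and h: "h \<in> regular_mat {0} n n" "k \<in> regular_mat {0} n n"
    and inv: "k * h = 1\<^sub>m n"
  shows "wedge_form (g 2 0 * k) (h * g 0 1) (1\<^sub>m n) (g 1 2) = wedge_form (g 2 0) (g 0 1) (1\<^sub>m n) (g 1 2)"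
proof -
  note g = vector_bundleD[OF vb] and gS = transition_regular[OF vb]
    and cc = transition_carrier[OF vb] and hS = frame_regular[OF h]
  have ch: "h \<in> carrier_mat n n" "k \<in> carrier_mat n n"
    using h by (auto dest: regular_matD)
  let ?w = "\<lambda>P X Y. wedge_form P X (1\<^sub>m n) Y"
  have q: "g 0 1 * g 1 2 = g 0 2" "g 1 2 * g 2 0 = g 1 0"
    using g(4)[of 0 1 2] g(4)[of 1 2 0] by simp_all
  have p: "g 2 0 * k * h = g 2 0" "g 1 2 * (g 2 0 * k) = g 1 0 * k" "g 0 1 * g 1 2 = g 0 2"
    by (simp_all only: sq_assoc[OF cc(4) ch(2,1)] inv right_mult_one_mat[OF cc(4)] q
        sq_assoc[OF cc(5,4) ch(2), symmetric])
  have e1: "?w (g 2 0 * k) (h * g 0 1) (g 1 2) =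
      wedge_form (g 2 0 * k) h (g 0 1) (g 1 2) + ?w (g 2 0) (g 0 1) (g 1 2)"
    using wedge_form_mult_left[of "g 2 0 * k" n h "g 0 1" "1\<^sub>m n" "g 1 2"] cc ch
    by (simp only: p mult_carrier_mat one_carrier_mat right_mult_one_mat)
  have e2: "?w (g 2 0 * k) h (g 0 2) =
      ?w (g 1 0 * k) h (g 0 1) + wedge_form (g 2 0 * k) h (g 0 1) (g 1 2)"
    using wedge_form_mult_right[of "g 2 0 * k" n h "g 0 1" "1\<^sub>m n" "g 1 2"] cc ch
    by (simp only: p mult_carrier_mat one_carrier_mat left_mult_one_mat)
  have "?w (g 2 0 * k) h (g 0 2) = 0"
    by (rule wedge_form_regular[where S = "{0, 2}" and i = 1,
          OF regular_mat_mult[OF gS hS(2)] hS(1) regular_mat_one gS]) auto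
  moreover have "?w (g 1 0 * k) h (g 0 1) = 0"
    by (rule wedge_form_regular[where S = "{0, 1}" and i = 2,
          OF regular_mat_mult[OF gS hS(2)] hS(1) regular_mat_one gS]) auto
  ultimately show ?thesis
    using e1 e2 by (metis add_0)
qed

text \<open>Here the new frame enters between the two differentials. Expanding both products leaves,
  besides the original, one term on U_1 \<inter> U_2 and one on U_0 \<inter> U_1.\<close>

lemma chern_2_frame_1:
  assumes vb: "vector_bundle (n, g)" and h: "h \<in> regular_mat {1} n n" "k \<in> regular_mat {1} n n"
    and inv: "k * h = 1\<^sub>m n"
  shows "wedge_form (g 2 0) (g 0 1 * k) (1\<^sub>m n) (h * g 1 2) = wedge_form (g 2 0) (g 0 1) (1\<^sub>m n) (g 1 2)"
proof -
  note g = vector_bundleD[OF vb] and gS = transition_regular[OF vb]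
    and cc = transition_carrier[OF vb] and hS = frame_regular[OF h]
  have ch: "h \<in> carrier_mat n n" "k \<in> carrier_mat n n"
    using h by (auto dest: regular_matD)
  let ?w = "\<lambda>P X Y. wedge_form P X (1\<^sub>m n) Y"
  have p: "g 2 0 * g 0 1 = g 2 1" "g 1 2 * g 2 0 = g 1 0"
    using g(4)[of 2 0 1] g(4)[of 1 2 0] by simp_all
  have e1: "?w (g 2 0) (g 0 1 * k) (h * g 1 2) =
      wedge_form (g 2 0) (g 0 1) k (h * g 1 2) + ?w (g 2 1) k (h * g 1 2)"
    using wedge_form_mult_left[of "g 2 0" n "g 0 1" k "1\<^sub>m n" "h * g 1 2"] cc ch
    by (simp only: p mult_carrier_mat one_carrier_mat right_mult_one_mat)
  have e2: "wedge_form (g 2 0) (g 0 1) k (h * g 1 2) =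
      wedge_form (g 1 0) (g 0 1) k h + ?w (g 2 0) (g 0 1) (g 1 2)"
    using wedge_form_mult_right[of "g 2 0" n "g 0 1" h k "g 1 2"] cc ch
    by (simp only: p inv)
  have "?w (g 2 1) k (h * g 1 2) = 0"
    by (rule wedge_form_regular[where S = "{1, 2}" and i = 0,
          OF gS hS(2) regular_mat_one regular_mat_mult[OF hS(1) gS]]) auto
  moreover have "wedge_form (g 1 0) (g 0 1) k h = 0"
    by (rule wedge_form_regular[where S = "{0, 1}" and i = 2,
          OF gS gS hS(2) hS(1)]) auto
  ultimately show ?thesis
    using e1 e2 by (metis add_0 add_0_right)
qed

text \<open>As for the frame over U_0, the mixed term is rewritten through d(g_01 g_12) = dg_02, now
  as a difference of terms on U_0 \<inter> U_2 and on U_1 \<inter> U_2.\<close>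

lemma chern_2_frame_2:
  assumes vb: "vector_bundle (n, g)" and h: "h \<in> regular_mat {2} n n" "k \<in> regular_mat {2} n n"
    and inv: "k * h = 1\<^sub>m n"
  shows "wedge_form (h * g 2 0) (g 0 1) (1\<^sub>m n) (g 1 2 * k) = wedge_form (g 2 0) (g 0 1) (1\<^sub>m n) (g 1 2)"
proof -
  note g = vector_bundleD[OF vb] and gS = transition_regular[OF vb]
    and cc = transition_carrier[OF vb] and hS = frame_regular[OF h]
  have ch: "h \<in> carrier_mat n n" "k \<in> carrier_mat n n"
    using h by (auto dest: regular_matD)
  let ?w = "\<lambda>P X Y. wedge_form P X (1\<^sub>m n) Y"
  have q: "g 0 1 * g 1 2 = g 0 2" "g 2 0 * g 0 1 = g 2 1"
    using g(4)[of 0 1 2] g(4)[of 2 0 1] by simp_all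
  have p: "k * (h * g 2 0) = g 2 0" "g 0 1 * g 1 2 = g 0 2" "h * g 2 0 * g 0 1 = h * g 2 1"
    by (simp_all only: sq_assoc[OF ch(1) cc(4,1)] inv left_mult_one_mat[OF cc(4)] q
        sq_assoc[OF ch(2,1) cc(4), symmetric])
  have e1: "?w (h * g 2 0) (g 0 1) (g 1 2 * k) =
      ?w (g 2 0) (g 0 1) (g 1 2) + wedge_form (h * g 2 0) (g 0 1) (g 1 2) k"
    using wedge_form_mult_right[of "h * g 2 0" n "g 0 1" "g 1 2" "1\<^sub>m n" k] cc ch
    by (simp only: p mult_carrier_mat one_carrier_mat left_mult_one_mat)
  have e2: "?w (h * g 2 0) (g 0 2) k =
      wedge_form (h * g 2 0) (g 0 1) (g 1 2) k + ?w (h * g 2 1) (g 1 2) k"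
    using wedge_form_mult_left[of "h * g 2 0" n "g 0 1" "g 1 2" "1\<^sub>m n" k] cc ch
    by (simp only: p mult_carrier_mat one_carrier_mat right_mult_one_mat)
  have "?w (h * g 2 0) (g 0 2) k = 0"
    by (rule wedge_form_regular[where S = "{0, 2}" and i = 1,
          OF regular_mat_mult[OF hS(1) gS] gS regular_mat_one hS(2)]) auto
  moreover have "?w (h * g 2 1) (g 1 2) k = 0"
    by (rule wedge_form_regular[where S = "{1, 2}" and i = 0,
          OF regular_mat_mult[OF hS(1) gS] gS regular_mat_one hS(2)]) auto
  ultimately show ?thesis
    using e1 e2 by (metis add_0 add_0_right)
qed

definition at_index :: "nat \<Rightarrow> nat \<Rightarrow> complex laurent mat \<Rightarrow> nat \<Rightarrow> complex laurent mat" where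
  "at_index n j h k = (if k = j then h else 1\<^sub>m n)"

lemma frame_change_at_index:
  "frame_change n H K \<Longrightarrow> j < 3 \<Longrightarrow> frame_change n (at_index n j (H j)) (at_index n j (K j))"
  by (auto simp: frame_change_def at_index_def regular_mat_one)

lemma chern_reframe:
  assumes vb: "vector_bundle (n, g)" and fr: "frame_change n H K"
  shows "chern_1 (reframe H K g) = chern_1 g" "chern_2 n (reframe H K g) = chern_2 n g"
proof -
  have HK: "H k \<in> regular_mat {k} n n" "K k \<in> regular_mat {k} n n"
    "H k \<in> carrier_mat n n" "K k \<in> carrier_mat n n" "H k * K k = 1\<^sub>m n" "K k * H k = 1\<^sub>m n" if "k < 3" for k
    using fr that by (auto simp: frame_change_def dest: regular_matD)
  note cc = transition_carrier[OF vb]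
  \<comment> \<open>One chart is changed at a time, with identity matrices on the other two, so that
    each change is one of the preceding computations.\<close>
  let ?r = "\<lambda>j. reframe (at_index n j (H j)) (at_index n j (K j))"
  define g0 where "g0 = ?r 0 g"
  define g1 where "g1 = ?r 1 g0"
  have vb0: "vector_bundle (n, g0)" and vb1: "vector_bundle (n, g1)"
    unfolding g0_def g1_def by (intro reframe_vector_bundle frame_change_at_index vb fr; simp)+
  note cc0 = transition_carrier[OF vb0]
  have g0: "g0 0 1 = H 0 * g 0 1" "g0 1 0 = g 1 0 * K 0" "g0 2 0 = g 2 0 * K 0" "g0 1 2 = g 1 2"
    unfolding g0_def reframe_def at_index_def using cc HK(3,4)[of 0] by auto
  have g1: "g1 0 1 = g0 0 1 * K 1" "g1 1 0 = H 1 * g0 1 0" "g1 2 0 = g0 2 0" "g1 1 2 = H 1 * g0 1 2"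
    unfolding g1_def reframe_def at_index_def using cc0 HK(3,4)[of 1] by auto
  have r: "reframe H K g 0 1 = g1 0 1" "reframe H K g 1 0 = g1 1 0"
    "reframe H K g 2 0 = H 2 * g1 2 0" "reframe H K g 1 2 = g1 1 2 * K 2"
    unfolding reframe_def g1 g0 using cc HK(3,4)[of 0] HK(3,4)[of 1] HK(3,4)[of 2]
    by (simp_all add: sq_assoc[of _ n])
  have s0: "chern_1 g0 = chern_1 g" "chern_2 n g0 = chern_2 n g"
    unfolding chern_1_def chern_2_def g0 using HK[of 0]
    by (simp_all add: chern_1_frame_0[OF vb, simplified] chern_2_frame_0[OF vb, simplified])
  have s1: "chern_1 g1 = chern_1 g0" "chern_2 n g1 = chern_2 n g0"
    unfolding chern_1_def chern_2_def g1
    by (rule chern_1_frame_1[OF vb0] chern_2_frame_1[OF vb0]; use HK[of 1] in simp)+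
  have s2: "chern_1 (reframe H K g) = chern_1 g1" "chern_2 n (reframe H K g) = chern_2 n g1"
    unfolding chern_1_def chern_2_def r
    by (rule refl chern_2_frame_2[OF vb1]; use HK[of 2] in simp)+
  show "chern_1 (reframe H K g) = chern_1 g" "chern_2 n (reframe H K g) = chern_2 n g"
    using s0 s1 s2 by simp_all
qed

section \<open>Additivity and existence of the Chern character\<close>

lemma regular_mat_diff:
  "A \<in> regular_mat S m n \<Longrightarrow> B \<in> regular_mat S m n \<Longrightarrow> A - B \<in> regular_mat S m n"
  by (auto simp: regular_mat_def intro!: regular_diff minus_carrier_mat)

lemma regular_mat_four_block:
  assumes "A \<in> regular_mat S a c" "B \<in> regular_mat S a d" "C \<in> regular_mat S b c" "D \<in> regular_mat S b d"
  shows "four_block_mat A B C D \<in> regular_mat S (a + b) (c + d)"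
  using assms by (auto simp: regular_mat_def)

lemma regular_mat_zero: "0\<^sub>m a b \<in> regular_mat S a b"
  by (auto simp: regular_mat_def)

lemma regular_vec_col: "A \<in> regular_mat S m n \<Longrightarrow> j < n \<Longrightarrow> col A j \<in> regular_vec S m"
  by (auto simp: regular_mat_def regular_vec_def)

lemma mat_factor_through:
  assumes M: "M \<in> carrier_mat m n" and N: "N \<in> carrier_mat m p"
    and cols: "\<And>j. j < p \<Longrightarrow> col N j \<in> (\<lambda>x. M *\<^sub>v x) ` regular_vec S n"
  shows "\<exists>X \<in> regular_mat S n p. M * X = N"
proof -
  have "\<forall>j\<in>{..<p}. \<exists>x. x \<in> regular_vec S n \<and> M *\<^sub>v x = col N j" using cols by fastforce
  then obtain x where x: "\<And>j. j < p \<Longrightarrow> x j \<in> regular_vec S n \<and> M *\<^sub>v x j = col N j"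
    by (metis lessThan_iff)
  define X where "X = mat n p (\<lambda>(i, j). x j $ i)"
  have c: "col X j = x j" if "j < p" for j
    using x[OF that] that by (auto simp: X_def regular_vec_def)
  have X: "X \<in> regular_mat S n p"
    using x by (auto simp: X_def regular_mat_def regular_vec_def)
  moreover have "M * X = N"
  proof (rule mat_col_eqI)
    fix j assume "j < dim_col N"
    then have j: "j < p" using N by simp
    then show "col (M * X) j = col N j"
      using M x[OF j] c[OF j] X by (simp add: regular_mat_def col_mult2[of _ m n _ p])
  qed (use M N X in \<open>auto simp: regular_mat_def\<close>)
  ultimately show ?thesis by blast
qed

lemma mult_unit_vec: "(A :: 'a::semiring_1 mat) \<in> carrier_mat m n \<Longrightarrow> j < n \<Longrightarrow> A *\<^sub>v unit_vec n j = col A j"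
  by (intro eq_vecI)
    (auto simp: scalar_prod_def unit_vec_def if_distrib cong: if_cong)

lemma unit_vec_regular: "j < n \<Longrightarrow> unit_vec n j \<in> regular_vec S n"
  by (auto simp: regular_vec_def unit_vec_def)

text \<open>The quotient is free, so lifting the unit vectors gives a section \<sigma>. The
  projection 1 - \<sigma>\<psi> lands in the kernel of \<psi> and therefore factors through \<phi>;
  the factor is \<tau>. The identities for \<tau>\<phi> and \<tau>\<sigma> follow by cancelling the
  injective \<phi>.\<close>

lemma split_exact_over_chart:
  assumes \<phi>: "\<phi> \<in> regular_mat S n' n" and \<psi>: "\<psi> \<in> regular_mat S n'' n'"
    and inj: "inj_on (\<lambda>x. \<phi> *\<^sub>v x) (regular_vec S n)"
    and ker: "(\<lambda>x. \<phi> *\<^sub>v x) ` regular_vec S n = {y \<in> regular_vec S n'. \<psi> *\<^sub>v y = 0\<^sub>v n''}"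
    and surj: "(\<lambda>y. \<psi> *\<^sub>v y) ` regular_vec S n' = regular_vec S n''"
  obtains \<sigma> \<tau> where "\<sigma> \<in> regular_mat S n' n''" "\<tau> \<in> regular_mat S n n'"
    "\<psi> * \<sigma> = 1\<^sub>m n''" "\<tau> * \<phi> = 1\<^sub>m n" "\<psi> * \<phi> = 0\<^sub>m n'' n" "\<tau> * \<sigma> = 0\<^sub>m n n''"
    "\<phi> * \<tau> + \<sigma> * \<psi> = 1\<^sub>m n'"
proof -
  note c = regular_matD[OF \<phi>] regular_matD[OF \<psi>]
  have inj_mat: "X = Y" if XY: "X \<in> regular_mat S n p" "Y \<in> regular_mat S n p" "\<phi> * X = \<phi> * Y" for X Y p
  proof (rule mat_col_eqI)
    note cXY = regular_matD[OF XY(1)] regular_matD[OF XY(2)]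
    fix j assume "j < dim_col Y"
    then have j: "j < p" using cXY by simp
    have "\<phi> *\<^sub>v col X j = \<phi> *\<^sub>v col Y j"
      using arg_cong[OF XY(3), of "\<lambda>A. col A j"] j
      by (simp add: col_mult2[OF c(1) cXY(1)] col_mult2[OF c(1) cXY(2)])
    then show "col X j = col Y j"
      using inj_onD[OF inj] regular_vec_col XY(1,2) j by blast
  qed (use regular_matD[OF XY(1)] regular_matD[OF XY(2)] in auto)
  obtain \<sigma> where \<sigma>: "\<sigma> \<in> regular_mat S n' n''" "\<psi> * \<sigma> = 1\<^sub>m n''"
    using mat_factor_through[OF c(2) one_carrier_mat, of S] surj unit_vec_regular by fastforce
  note c\<sigma> = regular_matD[OF \<sigma>(1)]
  have \<psi>\<phi>: "\<psi> * \<phi> = 0\<^sub>m n'' n"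
  proof (rule mat_col_eqI)
    fix j assume "j < dim_col (0\<^sub>m n'' n :: complex laurent mat)"
    then have j: "j < n" by simp
    have "\<phi> *\<^sub>v unit_vec n j \<in> {y \<in> regular_vec S n'. \<psi> *\<^sub>v y = 0\<^sub>v n''}"
      unfolding ker[symmetric] using unit_vec_regular[OF j] by blast
    then show "col (\<psi> * \<phi>) j = col (0\<^sub>m n'' n) j"
      using j by (simp add: mult_unit_vec[OF c(1)] col_mult2[OF c(2) c(1)])
  qed (use c in auto)
  define N where "N = 1\<^sub>m n' - \<sigma> * \<psi>"
  have N: "N \<in> regular_mat S n' n'"
    unfolding N_def by (intro regular_mat_diff regular_mat_one regular_mat_mult[OF \<sigma>(1) \<psi>])
  note cN = regular_matD[OF N]
  have "\<psi> * N = \<psi> * 1\<^sub>m n' - \<psi> * (\<sigma> * \<psi>)"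
    unfolding N_def by (rule mult_minus_distrib_mat) (use c c\<sigma> in auto)
  also have "\<psi> * (\<sigma> * \<psi>) = \<psi>"
    using assoc_mult_mat[OF c(2) c\<sigma> c(2)] \<sigma>(2) c by simp
  finally have \<psi>N: "\<psi> * N = 0\<^sub>m n'' n'" using c by simp
  obtain \<tau> where \<tau>: "\<tau> \<in> regular_mat S n n'" "\<phi> * \<tau> = N"
  proof -
    have "col N j \<in> (\<lambda>x. \<phi> *\<^sub>v x) ` regular_vec S n" if "j < n'" for j
      unfolding ker using regular_vec_col[OF N that] arg_cong[OF \<psi>N, of "\<lambda>A. col A j"] that
      by (simp add: col_mult2[OF c(2) cN])
    then show ?thesis using mat_factor_through[OF c(1) cN, of S] that by blast
  qed
  note c\<tau> = regular_matD[OF \<tau>(1)]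
  have "\<phi> * (\<tau> * \<phi>) = N * \<phi>"
    using assoc_mult_mat[OF c(1) c\<tau> c(1)] \<tau>(2) by simp
  also have "\<dots> = 1\<^sub>m n' * \<phi> - \<sigma> * \<psi> * \<phi>"
    unfolding N_def by (rule minus_mult_distrib_mat) (use c c\<sigma> in auto)
  also have "\<dots> = \<phi> * 1\<^sub>m n"
    using assoc_mult_mat[OF c\<sigma> c(2) c(1)] \<psi>\<phi> c c\<sigma> by (auto intro!: eq_matI)
  finally have \<tau>\<phi>: "\<tau> * \<phi> = 1\<^sub>m n"
    by (rule inj_mat[OF regular_mat_mult[OF \<tau>(1) \<phi>] regular_mat_one])
  have "\<phi> * (\<tau> * \<sigma>) = N * \<sigma>"
    using assoc_mult_mat[OF c(1) c\<tau> c\<sigma>] \<tau>(2) by simp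
  also have "\<dots> = 1\<^sub>m n' * \<sigma> - \<sigma> * \<psi> * \<sigma>"
    unfolding N_def by (rule minus_mult_distrib_mat) (use c c\<sigma> in auto)
  also have "\<dots> = \<phi> * 0\<^sub>m n n''"
    using assoc_mult_mat[OF c\<sigma> c(2) c\<sigma>] \<sigma>(2) c c\<sigma> by (auto intro!: eq_matI)
  finally have \<tau>\<sigma>: "\<tau> * \<sigma> = 0\<^sub>m n n''"
    by (rule inj_mat[OF regular_mat_mult[OF \<tau>(1) \<sigma>(1)] regular_mat_zero])
  have "\<phi> * \<tau> + \<sigma> * \<psi> = 1\<^sub>m n'"
    unfolding \<tau>(2) N_def using c c\<sigma> by (auto intro!: eq_matI)
  with \<sigma> \<tau>(1) \<psi>\<phi> \<tau>\<phi> \<tau>\<sigma> show ?thesis using that by blast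
qed

section \<open>Traces of block triangular matrices, and additivity\<close>

lemma res_trace_one: "res_trace (1\<^sub>m n) = of_nat n"
  by (simp add: res_trace_def lookup_of_nat)

lemma res_trace_four_block:
  assumes "A \<in> carrier_mat n n" "D \<in> carrier_mat m m"
  shows "res_trace (four_block_mat A B C D) = res_trace A + res_trace D"
proof -
  have s: "{..<n + m} = {..<n} \<union> (\<lambda>i. n + i) ` {..<m}"
  proof -
    have "x \<in> (\<lambda>i. n + i) ` {..<m}" if "x < n + m" "\<not> x < n" for x
      using that by (intro image_eqI[of _ _ "x - n"]) auto
    then show ?thesis by auto
  qed
  have "(\<Sum>i<n + m. four_block_mat A B C D $$ (i, i)) =
     (\<Sum>i<n. four_block_mat A B C D $$ (i, i)) + (\<Sum>i\<in>(\<lambda>i. n + i) ` {..<m}. four_block_mat A B C D $$ (i, i))"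
    unfolding s by (rule sum.union_disjoint) auto
  also have "\<dots> = (\<Sum>i<n. A $$ (i, i)) + (\<Sum>i<m. D $$ (i, i))"
    using assms by (simp add: sum.reindex)
  finally show ?thesis
    using assms by (simp add: res_trace_def lookup_add)
qed

definition tri_mat :: "complex laurent mat \<Rightarrow> complex laurent mat \<Rightarrow> complex laurent mat \<Rightarrow> complex laurent mat" where
  "tri_mat A B D = four_block_mat A B (0\<^sub>m (dim_row D) (dim_col A)) D"

lemma tri_mat_mult:
  assumes "A \<in> carrier_mat n n" "B \<in> carrier_mat n m" "D \<in> carrier_mat m m"
    "A' \<in> carrier_mat n n" "B' \<in> carrier_mat n m" "D' \<in> carrier_mat m m"
  shows "tri_mat A B D * tri_mat A' B' D' = tri_mat (A * A') (A * B' + B * D') (D * D')"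
  using assms unfolding tri_mat_def
  by (subst mult_four_block_mat[of _ n n _ m _ m _ _ n _ m]) (auto intro!: cong_four_block_mat)

lemma tri_mat_deriv:
  assumes "A \<in> carrier_mat n n" "B \<in> carrier_mat n m" "D \<in> carrier_mat m m"
  shows "mat_deriv i (tri_mat A B D) = tri_mat (mat_deriv i A) (mat_deriv i B) (mat_deriv i D)"
  using assms unfolding tri_mat_def
  by (subst map_four_block_mat[of _ n n _ m _ m]) (auto intro!: cong_four_block_mat)

lemma res_trace_tri_mat:
  "A \<in> carrier_mat n n \<Longrightarrow> D \<in> carrier_mat m m \<Longrightarrow> res_trace (tri_mat A B D) = res_trace A + res_trace D"
  unfolding tri_mat_def by (rule res_trace_four_block)

lemma tri_mat_one: "1\<^sub>m (n + m) = tri_mat (1\<^sub>m n) (0\<^sub>m n m) (1\<^sub>m m)"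
  by (simp add: tri_mat_def)

lemma dlog_form_tri_mat:
  assumes "A \<in> carrier_mat n n" "B \<in> carrier_mat n m" "D \<in> carrier_mat m m"
    "A' \<in> carrier_mat n n" "B' \<in> carrier_mat n m" "D' \<in> carrier_mat m m"
  shows "dlog_form (tri_mat A B D) (tri_mat A' B' D') = dlog_form A A' + dlog_form D D'"
  using assms unfolding dlog_form_def
  by (simp add: tri_mat_deriv[of _ n _ m] tri_mat_mult[of _ n _ m] res_trace_tri_mat[of _ n _ m])

lemma wedge_form_tri_mat:
  assumes "A \<in> carrier_mat n n" "B \<in> carrier_mat n m" "D \<in> carrier_mat m m"
    "A1 \<in> carrier_mat n n" "B1 \<in> carrier_mat n m" "D1 \<in> carrier_mat m m"
    "A2 \<in> carrier_mat n n" "B2 \<in> carrier_mat n m" "D2 \<in> carrier_mat m m"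
    "A3 \<in> carrier_mat n n" "B3 \<in> carrier_mat n m" "D3 \<in> carrier_mat m m"
  shows "wedge_form (tri_mat A B D) (tri_mat A1 B1 D1) (tri_mat A2 B2 D2) (tri_mat A3 B3 D3) =
    wedge_form A A1 A2 A3 + wedge_form D D1 D2 D3"
  using assms unfolding wedge_form_def
  by (simp add: tri_mat_deriv[of _ n _ m] tri_mat_mult[of _ n _ m] res_trace_tri_mat[of _ n _ m]
      mult_carrier_mat[of _ n n _ m] mult_carrier_mat[of _ n n _ n] mult_carrier_mat[of _ m m _ m]
      mult_carrier_mat[of _ n m _ m] del: assoc_mult_mat)

lemma chern_short_exact:
  assumes vb: "vector_bundle (n, g)" "vector_bundle (n', g')" "vector_bundle (n'', g'')"
    and ex: "short_exact (n, g) (n', g') (n'', g'')"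
  shows "n' = n + n''" "chern_1 g' = chern_1 g + chern_1 g''"
    "chern_2 n' g' = chern_2 n g + chern_2 n'' g''"
proof -
  obtain \<phi> \<psi> where h\<phi>: "bundle_hom (n, g) (n', g') \<phi>" and h\<psi>: "bundle_hom (n', g') (n'', g'') \<psi>"
    and E: "\<forall>k<3. inj_on (\<lambda>x. \<phi> k *\<^sub>v x) (regular_vec {k} n) \<and>
       (\<lambda>x. \<phi> k *\<^sub>v x) ` regular_vec {k} n = {y \<in> regular_vec {k} n'. \<psi> k *\<^sub>v y = 0\<^sub>v n''} \<and>
       (\<lambda>y. \<psi> k *\<^sub>v y) ` regular_vec {k} n' = regular_vec {k} n''"
    using ex unfolding short_exact_def fst_conv by (elim exE conjE)
  have \<phi>: "\<phi> k \<in> regular_mat {k} n' n" and \<psi>: "\<psi> k \<in> regular_mat {k} n'' n'" if "k < 3" for k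
    using h\<phi> h\<psi> that by auto
  have com: "\<phi> k * g k l = g' k l * \<phi> l" "\<psi> k * g' k l = g'' k l * \<psi> l" if "k < 3" "l < 3" for k l
    using h\<phi> h\<psi> that by auto
  have "\<exists>\<sigma> \<tau>. \<sigma> \<in> regular_mat {k} n' n'' \<and> \<tau> \<in> regular_mat {k} n n' \<and>
      \<psi> k * \<sigma> = 1\<^sub>m n'' \<and> \<tau> * \<phi> k = 1\<^sub>m n \<and> \<psi> k * \<phi> k = 0\<^sub>m n'' n \<and> \<tau> * \<sigma> = 0\<^sub>m n n'' \<and>
      \<phi> k * \<tau> + \<sigma> * \<psi> k = 1\<^sub>m n'" if "k < 3" for k
  proof -
    have e: "inj_on (\<lambda>x. \<phi> k *\<^sub>v x) (regular_vec {k} n)"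
      "(\<lambda>x. \<phi> k *\<^sub>v x) ` regular_vec {k} n = {y \<in> regular_vec {k} n'. \<psi> k *\<^sub>v y = 0\<^sub>v n''}"
      "(\<lambda>y. \<psi> k *\<^sub>v y) ` regular_vec {k} n' = regular_vec {k} n''"
      using E that by simp_all
    show ?thesis
      by (rule split_exact_over_chart[OF \<phi>[OF that] \<psi>[OF that] e]) (intro exI conjI)
  qed
  then obtain \<sigma> \<tau> where st: "\<And>k. k < 3 \<Longrightarrow> \<sigma> k \<in> regular_mat {k} n' n'' \<and> \<tau> k \<in> regular_mat {k} n n' \<and>
      \<psi> k * \<sigma> k = 1\<^sub>m n'' \<and> \<tau> k * \<phi> k = 1\<^sub>m n \<and> \<psi> k * \<phi> k = 0\<^sub>m n'' n \<and> \<tau> k * \<sigma> k = 0\<^sub>m n n'' \<and>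
      \<phi> k * \<tau> k + \<sigma> k * \<psi> k = 1\<^sub>m n'"
    by metis
  have c: "\<phi> k \<in> carrier_mat n' n" "\<psi> k \<in> carrier_mat n'' n'" "\<sigma> k \<in> carrier_mat n' n''"
    "\<tau> k \<in> carrier_mat n n'" if "k < 3" for k
    using \<phi>[OF that] \<psi>[OF that] st[OF that] by (auto dest: regular_matD)
  note cg = vector_bundleD(2)[OF vb(1)] and cg' = vector_bundleD(2)[OF vb(2)]
    and cg'' = vector_bundleD(2)[OF vb(3)]
  \<comment> \<open>The rank is the trace of the identity, evaluated on \<phi>\<tau> +
    \<sigma>\<psi> by cyclicity of the trace.\<close>
  have "(of_nat n' :: complex) = res_trace (\<phi> 0 * \<tau> 0 + \<sigma> 0 * \<psi> 0)"
    using st[of 0] by (simp add: res_trace_one)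
  also have "\<dots> = res_trace (\<phi> 0 * \<tau> 0) + res_trace (\<sigma> 0 * \<psi> 0)"
    using c[of 0] by (intro res_trace_add mult_carrier_mat) auto
  also have "\<dots> = res_trace (\<tau> 0 * \<phi> 0) + res_trace (\<psi> 0 * \<sigma> 0)"
    using res_trace_mult_commute[of "\<phi> 0" n' n "\<tau> 0"] res_trace_mult_commute[of "\<sigma> 0" n' n'' "\<psi> 0"] c[of 0]
    by simp
  also have "\<dots> = of_nat (n + n'')"
    using st[of 0] by (simp add: res_trace_one)
  finally show rank: "n' = n + n''" by (simp only: of_nat_eq_iff)
  \<comment> \<open>The matrix with blocks \<phi>, \<sigma> side by side and its inverse with \<tau>
    above \<psi>, both completed by empty blocks so that the multiplication rule for four blocks
    applies.\<close>
  define H where "H k = four_block_mat (\<phi> k) (\<sigma> k) (0\<^sub>m 0 n) (0\<^sub>m 0 n'')" for k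
  define K where "K k = four_block_mat (\<tau> k) (0\<^sub>m n 0) (\<psi> k) (0\<^sub>m n'' 0)" for k
  have fr: "frame_change n' K H"
    unfolding frame_change_def
  proof (intro allI impI conjI)
    fix k :: nat assume k: "k < 3"
    show "K k \<in> regular_mat {k} n' n'"
      using regular_mat_four_block[of "\<tau> k" "{k}" n n' "0\<^sub>m n 0" 0 "\<psi> k" n'' "0\<^sub>m n'' 0"] st[OF k] \<psi>[OF k]
      by (simp add: K_def regular_mat_zero rank)
    show "H k \<in> regular_mat {k} n' n'"
      using regular_mat_four_block[of "\<phi> k" "{k}" n' n "\<sigma> k" n'' "0\<^sub>m 0 n" 0 "0\<^sub>m 0 n''"] st[OF k] \<phi>[OF k]
      by (simp add: H_def regular_mat_zero rank)
    show "K k * H k = 1\<^sub>m n'"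
      unfolding H_def K_def
      by (subst mult_four_block_mat[of _ n n' _ 0 _ n'' _ _ n _ n''])
        (use st[OF k] c[OF k] in \<open>auto simp: rank\<close>)
    have "H k * K k = four_block_mat (1\<^sub>m n') (0\<^sub>m n' 0) (0\<^sub>m 0 n') (0\<^sub>m 0 0)"
      unfolding H_def K_def
      by (subst mult_four_block_mat[of _ n' n _ n'' _ 0 _ _ n' _ 0])
        (use st[OF k] c[OF k] in \<open>auto intro!: cong_four_block_mat\<close>)
    also have "\<dots> = 1\<^sub>m n'"
      by (intro eq_matI) auto
    finally show "H k * K k = 1\<^sub>m n'" .
  qed
  \<comment> \<open>The off-diagonal block compares the splittings over two charts and represents
    the extension class; the traces do not see it.\<close>
  define \<theta> where "\<theta> k l = \<tau> k * g' k l * \<sigma> l" for k l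
  have \<theta>: "\<theta> k l \<in> carrier_mat n n''" if "k < 3" "l < 3" for k l
    unfolding \<theta>_def using c[OF that(1)] c[OF that(2)] cg'[OF that] by auto
  have tri: "reframe K H g' k l = tri_mat (g k l) (\<theta> k l) (g'' k l)" if k: "k < 3" and l: "l < 3" for k l
  proof -
    note ck = c[OF k] and cl = c[OF l] and cgg = cg[OF k l] cg'[OF k l] cg''[OF k l]
    have g1: "\<tau> k * g' k l * \<phi> l = g k l"
    proof -
      have "\<tau> k * g' k l * \<phi> l = \<tau> k * (\<phi> k * g k l)"
        unfolding com[OF k l] by (rule assoc_mult_mat[OF ck(4) cgg(2) cl(1)])
      also have "\<dots> = \<tau> k * \<phi> k * g k l"
        by (rule assoc_mult_mat[OF ck(4) ck(1) cgg(1), symmetric])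
      finally show ?thesis using st[OF k] cgg by simp
    qed
    have g2: "\<psi> k * g' k l * \<phi> l = 0\<^sub>m n'' n"
      unfolding com[OF k l] assoc_mult_mat[OF cgg(3) cl(2) cl(1)] using st[OF l] cgg by simp
    have g3: "\<psi> k * g' k l * \<sigma> l = g'' k l"
      unfolding com[OF k l] assoc_mult_mat[OF cgg(3) cl(2) cl(3)] using st[OF l] cgg by simp
    have KG: "K k * g' k l = four_block_mat (\<tau> k * g' k l) (0\<^sub>m n 0) (\<psi> k * g' k l) (0\<^sub>m n'' 0)"
    proof -
      have "K k * four_block_mat (g' k l) (0\<^sub>m n' 0) (0\<^sub>m 0 n') (0\<^sub>m 0 0) =
        four_block_mat (\<tau> k * g' k l) (0\<^sub>m n 0) (\<psi> k * g' k l) (0\<^sub>m n'' 0)"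
        unfolding K_def
        by (subst mult_four_block_mat[of _ n n' _ 0 _ n'' _ _ n' _ 0])
          (use ck cgg in \<open>auto intro!: cong_four_block_mat\<close>)
      moreover have "four_block_mat (g' k l) (0\<^sub>m n' 0) (0\<^sub>m 0 n') (0\<^sub>m 0 0) = g' k l"
        using cgg by (intro eq_matI) auto
      ultimately show ?thesis by simp
    qed
    have "K k * g' k l * H l = four_block_mat (\<tau> k * g' k l * \<phi> l) (\<tau> k * g' k l * \<sigma> l)
        (\<psi> k * g' k l * \<phi> l) (\<psi> k * g' k l * \<sigma> l)"
      unfolding KG H_def
      by (subst mult_four_block_mat[of _ n n' _ 0 _ n'' _ _ n _ n''])
        (use ck cl cgg in \<open>auto intro!: cong_four_block_mat simp del: assoc_mult_mat\<close>)
    then show ?thesis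
      unfolding reframe_def g1 g2 g3 tri_mat_def \<theta>_def using cgg by simp
  qed
  have "chern_1 g' = chern_1 (reframe K H g')" "chern_2 n' g' = chern_2 n' (reframe K H g')"
    using chern_reframe[OF vb(2) fr] by simp_all
  moreover have "chern_1 (reframe K H g') = chern_1 g + chern_1 g''"
    unfolding chern_1_def using cg cg'' \<theta>
    by (subst (1 2) tri, simp_all) (subst dlog_form_tri_mat[of _ n _ n''], auto)
  moreover have "chern_2 n' (reframe K H g') = chern_2 n g + chern_2 n'' g''"
    unfolding chern_2_def rank tri_mat_one using cg cg'' \<theta>
    by (subst (1 2 3) tri, simp_all) (subst wedge_form_tri_mat[of _ n _ n''], auto)
  ultimately show "chern_1 g' = chern_1 g + chern_1 g''"
    "chern_2 n' g' = chern_2 n g + chern_2 n'' g''" by simp_all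
qed

text \<open>
  The residues are complex numbers, whereas \<open>coh_P2\<close> has rational coefficients. Any
  \<open>\<rat>\<close>-linear retraction preserves additivity and the values on line bundles.
\<close>

lemma additive_retraction_exists:
  obtains p :: "complex \<Rightarrow> rat" where "\<And>x y. p (x + y) = p x + p y" "\<And>d. p (of_int d) = of_int d"
proof -
  interpret vector_space_pair "\<lambda>(q::rat) (z::complex). of_rat q * z" "(*) :: rat \<Rightarrow> rat \<Rightarrow> rat"
    by unfold_locales (auto simp: algebra_simps of_rat_add of_rat_mult)
  have "vs1.independent {1}" by simp
  then obtain p where p: "Vector_Spaces.linear (\<lambda>(q::rat) (z::complex). of_rat q * z) (*) p" "p 1 = (1 :: rat)"
    using linear_independent_extend[of "{1}" "\<lambda>_. 1"] by auto
  interpret p: Vector_Spaces.linear "\<lambda>(q::rat) (z::complex). of_rat q * z" "(*) :: rat \<Rightarrow> rat \<Rightarrow> rat" p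
    by (rule p(1))
  have "p (of_int d) = of_int d" for d
    using p.scale[of "of_int d" 1] p(2) by simp
  then show ?thesis using that p.add by blast
qed

lemma chern_line_bundle:
  "chern_1 (snd (line_bundle d)) = of_int d" "chern_2 1 (snd (line_bundle d)) = of_int (d\<^sup>2)"
proof -
  show "chern_1 (snd (line_bundle d)) = of_int d"
    by (simp add: chern_1_def dlog_form_def res_trace_def line_bundle_def scalar_prod_def
        ratio_power_def monomial_index_def log_deriv_single mult_single hom_exp_def Let_def lookup_single
        zero_prod_def)
  show "chern_2 1 (snd (line_bundle d)) = of_int (d\<^sup>2)"
    by (simp add: chern_2_def wedge_form_def res_trace_def line_bundle_def scalar_prod_def
        ratio_power_def monomial_index_def log_deriv_single mult_single hom_exp_def Let_def lookup_single
        power2_eq_square zero_prod_def)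
qed

lemma chern_line_value:
  "(\<Sum>k\<le>2. (1 / fact k) *\<^sub>Q (of_int d * w2) ^ k) = Coh 1 (of_int d) (of_int (d\<^sup>2) / 2)"
proof -
  have i: "(of_int d :: coh_P2) = Coh (of_int d) 0 0" for d
  proof (induction d rule: int_induct[of _ 0])
    case (step1 i) then show ?case by (simp add: one_coh_P2_def)
  next
    case (step2 i) then show ?case by (simp add: one_coh_P2_def)
  qed (simp add: zero_coh_P2_def)
  show ?thesis
    by (simp add: numeral_2_eq_2 i w2_def one_coh_P2_def power2_eq_square)
qed

text \<open>\<open>chern_character\<close> is picked by \<open>SOME\<close>, so its properties are
  available only once a witness is known. In the witness the coefficient of w^4 is half the trace of
  the squared Atiyah class, in accordance with the exponential.\<close>

theorem chern_character_exists: "is_chern_character chern_character"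
proof -
  obtain p :: "complex \<Rightarrow> rat" where p: "\<And>x y. p (x + y) = p x + p y" "\<And>d. p (of_int d) = of_int d"
    by (rule additive_retraction_exists) blast
  define \<chi> where "\<chi> E = Coh (of_nat (fst E)) (p (chern_1 (snd E))) (p (chern_2 (fst E) (snd E)) / 2)" for E
  have "is_chern_character \<chi>"
    unfolding is_chern_character_def
  proof (intro conjI allI impI)
    fix E E' E'' :: vbundle
    assume A: "vector_bundle E \<and> vector_bundle E' \<and> vector_bundle E'' \<and> short_exact E E' E''"
    obtain n g n' g' n'' g'' where e: "E = (n, g)" "E' = (n', g')" "E'' = (n'', g'')"
      by (cases E, cases E', cases E'') auto
    show "\<chi> E' = \<chi> E + \<chi> E''"
      using chern_short_exact[of n g n' g' n'' g''] A unfolding e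
      by (simp add: \<chi>_def p add_divide_distrib)
  next
    fix d
    have "fst (line_bundle d) = 1" by (simp add: line_bundle_def)
    then show "\<chi> (line_bundle d) = (\<Sum>k\<le>2. (1 / fact k) *\<^sub>Q (of_int d * w2) ^ k)"
      unfolding chern_line_value \<chi>_def by (simp only: chern_line_bundle p) simp
  qed
  then show ?thesis unfolding chern_character_def by (rule someI[of is_chern_character])
qed

section \<open>Modules over the charts\<close>

text \<open>Clearing denominators: multiplication by one large monomial makes finitely many
  monomials regular on U_k.\<close>

lemma regular_minus_single:
  assumes "finite E" "k < 3"
  shows "\<exists>e0. \<forall>e\<in>E. \<forall>i\<in>{0, 1, 2} - {k}. hom_exp i (e0 + e) \<ge> 0"
proof -
  define N where "N = (\<Sum>e\<in>E. \<bar>fst e\<bar> + \<bar>snd e\<bar>)"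
  have N: "\<bar>fst e\<bar> + \<bar>snd e\<bar> \<le> N" if "e \<in> E" for e
    unfolding N_def using assms(1) that by (intro member_le_sum) auto
  have b: "- N \<le> hom_exp i e" if "e \<in> E" for i e
    using N[OF that] by (auto simp: hom_exp_def)
  \<comment> \<open>The monomial (u_i u_j / u_k^2)^N, where i and j are the two indices other than
    k.\<close>
  define e0 where "e0 = (if k = 0 then (N, N) else if k = 1 then (- 2 * N, N) else (N, - 2 * N))"
  have "hom_exp i e0 = N" if "i \<in> {0, 1, 2} - {k}" for i
    using that assms(2) by (auto simp: e0_def hom_exp_def)
  then have "hom_exp i (e0 + e) \<ge> 0" if "e \<in> E" "i \<in> {0, 1, 2} - {k}" for e i
    using b[OF that(1), of i] that(2) by (simp add: hom_exp_add)
  then show ?thesis by blast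
qed

section \<open>Laurent polynomials with coefficients in a vector space\<close>

locale complex_space = vector_space scale
  for scale :: "complex \<Rightarrow> 'b::ab_group_add \<Rightarrow> 'b" (infixr \<open>*s\<close> 75)
begin

lemma lookup_laurent_scale:
  "lookup (laurent_scale scale f m) e =
     (\<Sum>a \<in> keys f. lookup f a *s lookup m (e - a))"
proof -
  have "(\<Sum>b\<in>keys m. lookup (single (a + b) (c *s lookup m b)) e)
      = c *s lookup m (e - a)" for a c
  proof -
    have "(\<Sum>b\<in>keys m. lookup (single (a + b) (c *s lookup m b)) e)
       = (\<Sum>b\<in>keys m. if b = e - a then c *s lookup m b else 0)"
      by (intro sum.cong) (auto simp: lookup_single when_def)
    also have "\<dots> = c *s lookup m (e - a)"
      by (auto simp: in_keys_iff)
    finally show ?thesis .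
  qed
  then show ?thesis
    by (simp add: laurent_scale_def lookup_sum)
qed

lemma lookup_laurent_scale_superset:
  assumes "finite A" "keys f \<subseteq> A"
  shows "lookup (laurent_scale scale f m) e =
     (\<Sum>a \<in> A. lookup f a *s lookup m (e - a))"
  unfolding lookup_laurent_scale
  using assms by (intro sum.mono_neutral_left) (auto simp: in_keys_iff)

lemma laurent_scale_add_left:
  "laurent_scale scale (f + g) m = laurent_scale scale f m + laurent_scale scale g m"
proof (rule poly_mapping_eqI)
  fix e
  let ?A = "keys f \<union> keys g"
  have "finite ?A" "keys (f + g) \<subseteq> ?A" using keys_add[of f g] by auto
  then show "lookup (laurent_scale scale (f + g) m) e =
    lookup (laurent_scale scale f m + laurent_scale scale g m) e"
    by (simp add: lookup_laurent_scale_superset[of ?A] lookup_add scale_left_distrib sum.distrib)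
qed

lemma laurent_scale_add_right:
  "laurent_scale scale f (m + m') = laurent_scale scale f m + laurent_scale scale f m'"
  by (rule poly_mapping_eqI)
    (simp add: lookup_laurent_scale lookup_add scale_right_distrib sum.distrib)

lemma laurent_scale_zero_left [simp]: "laurent_scale scale 0 m = 0"
  by (rule poly_mapping_eqI) (simp add: lookup_laurent_scale)

lemma laurent_scale_zero_right [simp]: "laurent_scale scale f 0 = 0"
  by (rule poly_mapping_eqI) (simp add: lookup_laurent_scale)

lemma lookup_laurent_scale_single:
  "lookup (laurent_scale scale (single a c) m) e = c *s lookup m (e - a)"
  by (subst lookup_laurent_scale_superset[of "{a}"]) auto

lemma laurent_scale_one [simp]: "laurent_scale scale 1 m = m"
proof (rule poly_mapping_eqI)
  fix e show "lookup (laurent_scale scale 1 m) e = lookup m e"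
    using lookup_laurent_scale_single[of 0 1 m e] by simp
qed

lemma laurent_scale_mult:
  "laurent_scale scale (f * g) m = laurent_scale scale f (laurent_scale scale g m)"
proof (induction f rule: poly_mapping_single_induct)
  case (single e c)
  show ?case
  proof (induction g rule: poly_mapping_single_induct)
    case (single e' c')
    show ?case
      by (rule poly_mapping_eqI) (simp add: mult_single lookup_laurent_scale_single algebra_simps)
  qed (auto simp: laurent_scale_add_left laurent_scale_add_right algebra_simps)
qed (auto simp: laurent_scale_add_left algebra_simps)

lemma laurent_scale_sum_left:
  "laurent_scale scale (sum f A) m = (\<Sum>x\<in>A. laurent_scale scale (f x) m)"
  by (induction A rule: infinite_finite_induct) (auto simp: laurent_scale_add_left)

lemma laurent_scale_sum_right:
  "laurent_scale scale f (sum m A) = (\<Sum>x\<in>A. laurent_scale scale f (m x))"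
  by (induction A rule: infinite_finite_induct) (auto simp: laurent_scale_add_right)

definition laurent_comb :: "(nat \<Rightarrow> 'b laurent) \<Rightarrow> complex laurent vec \<Rightarrow> 'b laurent" where
  "laurent_comb b x = (\<Sum>a<dim_vec x. laurent_scale scale (x $ a) (b a))"

text \<open>Passes from the extensional functions of \<open>module_basis\<close> to vectors, on
  which matrices can act.\<close>

lemma module_basis_iff:
  "module_basis scale (regular S) M n b \<longleftrightarrow> bij_betw (laurent_comb b) (regular_vec S n) M"
proof -
  have 1: "bij_betw (vec n) ({..<n} \<rightarrow>\<^sub>E regular S) (regular_vec S n)"
    unfolding bij_betw_def
  proof
    show "inj_on (vec n) ({..<n} \<rightarrow>\<^sub>E regular S)"
    proof (rule inj_onI)
      fix f f' assume f: "f \<in> {..<n} \<rightarrow>\<^sub>E regular S" "f' \<in> {..<n} \<rightarrow>\<^sub>E regular S" and eq: "vec n f = vec n f'"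
      show "f = f'"
        using f
      proof (rule PiE_ext)
        fix a assume "a \<in> {..<n}"
        then show "f a = f' a" using arg_cong[OF eq, of "\<lambda>x. x $ a"] by simp
      qed
    qed
    show "vec n ` ({..<n} \<rightarrow>\<^sub>E regular S) = regular_vec S n"
    proof (intro equalityI subsetI)
      fix x assume x: "x \<in> regular_vec S n"
      then have "vec n (\<lambda>a\<in>{..<n}. x $ a) = x"
        by (intro eq_vecI) (auto simp: regular_vec_def)
      moreover have "(\<lambda>a\<in>{..<n}. x $ a) \<in> {..<n} \<rightarrow>\<^sub>E regular S"
        using x by (simp add: regular_vec_def)
      ultimately show "x \<in> vec n ` ({..<n} \<rightarrow>\<^sub>E regular S)"
        by (metis imageI)
    next
      fix x assume "x \<in> vec n ` ({..<n} \<rightarrow>\<^sub>E regular S)"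
      then obtain f where "x = vec n f" "f \<in> {..<n} \<rightarrow>\<^sub>E regular S" by blast
      then show "x \<in> regular_vec S n"
        using PiE_mem[of f "{..<n}" "\<lambda>_. regular S"] by (simp add: regular_vec_def)
    qed
  qed
  have 2: "(\<lambda>f. \<Sum>a<n. laurent_scale scale (f a) (b a)) = laurent_comb b \<circ> vec n"
    by (auto simp: laurent_comb_def fun_eq_iff)
  show ?thesis
    unfolding module_basis_def 2 by (rule bij_betw_comp_iff[OF 1, symmetric])
qed

lemma laurent_comb_mult_mat:
  assumes "A \<in> carrier_mat m n" "x \<in> carrier_vec n"
  shows "laurent_comb b (A *\<^sub>v x) = (\<Sum>j<n. laurent_scale scale (x $ j) (laurent_comb b (col A j)))"
proof -
  have "laurent_comb b (A *\<^sub>v x) = (\<Sum>i<m. \<Sum>j<n. laurent_scale scale (x $ j * A $$ (i, j)) (b i))"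
    using assms
    by (simp add: laurent_comb_def scalar_prod_def laurent_scale_sum_left atLeast0LessThan mult.commute)
  also have "\<dots> = (\<Sum>j<n. \<Sum>i<m. laurent_scale scale (x $ j * A $$ (i, j)) (b i))"
    by (rule sum.swap)
  also have "\<dots> = (\<Sum>j<n. laurent_scale scale (x $ j) (laurent_comb b (col A j)))"
    using assms by (simp add: laurent_comb_def laurent_scale_mult laurent_scale_sum_right)
  finally show ?thesis .
qed

lemma laurent_comb_smult:
  "laurent_comb b (f \<cdot>\<^sub>v x) = laurent_scale scale f (laurent_comb b x)"
  by (simp add: laurent_comb_def laurent_scale_mult laurent_scale_sum_right)

lemma laurent_comb_zero [simp]: "laurent_comb b (0\<^sub>v n) = 0"
  by (simp add: laurent_comb_def)

text \<open>A basis over U_k stays independent over the triple intersection, because denominators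
  are cleared by a monomial, which is a unit there. Identities between transition matrices are
  tested in this larger module.\<close>

lemma laurent_comb_inj:
  assumes "module_basis scale (regular {k}) M n b" "k < 3"
  shows "inj_on (laurent_comb b) (carrier_vec n)"
proof (rule inj_onI)
  fix x y assume x: "x \<in> carrier_vec n" and y: "y \<in> carrier_vec n"
    and eq: "laurent_comb b x = laurent_comb b y"
  let ?E = "(\<Union>a<n. keys (x $ a)) \<union> (\<Union>a<n. keys (y $ a))"
  have "finite ?E" by auto
  then obtain e0 where e0: "\<forall>e\<in>?E. \<forall>i\<in>{0, 1, 2} - {k}. hom_exp i (e0 + e) \<ge> 0"
    using regular_minus_single assms(2) by meson
  define u :: "complex laurent" where "u = single e0 1"
  have reg: "u * f \<in> regular {k}" if "keys f \<subseteq> ?E" for f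
    unfolding regular_def
  proof (intro CollectI ballI)
    fix e i assume *: "e \<in> keys (u * f)" "i \<in> {0, 1, 2} - {k}"
    have "keys (u * f) \<subseteq> {e0 + e | e. e \<in> keys f}"
      using keys_mult[of u f] by (auto simp: u_def)
    then show "0 \<le> hom_exp i e" using * that e0 by fastforce
  qed
  have "u \<cdot>\<^sub>v x \<in> regular_vec {k} n" "u \<cdot>\<^sub>v y \<in> regular_vec {k} n"
    unfolding regular_vec_def using x y by (auto intro!: reg)
  moreover have "laurent_comb b (u \<cdot>\<^sub>v x) = laurent_comb b (u \<cdot>\<^sub>v y)"
    by (simp add: laurent_comb_smult eq)
  ultimately have uxy: "u \<cdot>\<^sub>v x = u \<cdot>\<^sub>v y"
    using assms(1) unfolding module_basis_iff by (meson bij_betw_imp_inj_on inj_onD)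
  define u' :: "complex laurent" where "u' = single (- e0) 1"
  have "u' * u = 1" by (simp add: u_def u'_def mult_single)
  then have "u' \<cdot>\<^sub>v (u \<cdot>\<^sub>v z) = z" for z
    by (auto simp: mult.assoc[symmetric])
  then show "x = y" using uxy by metis
qed

end

text \<open>The submodules stable under the torus action are of this kind: one space of coefficients
  for each monomial.\<close>

definition graded :: "(int \<times> int \<Rightarrow> 'v::zero set) \<Rightarrow> 'v laurent set" where
  "graded P = {m. \<forall>e. lookup m e \<in> P e}"

definition coeff_map :: "('v::zero \<Rightarrow> 'w::zero) \<Rightarrow> 'v laurent \<Rightarrow> 'w laurent" where
  "coeff_map f = Poly_Mapping.map f"

lemma lookup_coeff_map: "f 0 = 0 \<Longrightarrow> lookup (coeff_map f m) e = f (lookup m e)"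
  by (simp add: coeff_map_def map.rep_eq when_def)

lemma coeff_map_scale:
  assumes "complex_space s" "complex_space s'" "Vector_Spaces.linear s s' f"
  shows "coeff_map f (laurent_scale s h m) = laurent_scale s' h (coeff_map f m)"
proof -
  interpret s: complex_space s by fact
  interpret s': complex_space s' by fact
  interpret f: Vector_Spaces.linear s s' f by fact
  show ?thesis
    by (rule poly_mapping_eqI)
      (simp add: lookup_coeff_map s.lookup_laurent_scale s'.lookup_laurent_scale f.sum f.scale)
qed

lemma coeff_map_sum:
  assumes "Vector_Spaces.linear s s' f"
  shows "coeff_map f (sum m A) = (\<Sum>a\<in>A. coeff_map f (m a))"
proof -
  interpret f: Vector_Spaces.linear s s' f by fact
  show ?thesis
    by (rule poly_mapping_eqI) (simp add: lookup_coeff_map lookup_sum f.sum)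
qed

lemma coeff_map_comb:
  assumes "complex_space s" "complex_space s'" "Vector_Spaces.linear s s' f"
  shows "coeff_map f (complex_space.laurent_comb s b x) =
    complex_space.laurent_comb s' (\<lambda>a. coeff_map f (b a)) x"
  using assms
  by (simp add: complex_space.laurent_comb_def coeff_map_sum[OF assms(3)] coeff_map_scale[OF assms])

section \<open>From linear maps of the coefficients to homomorphisms of bundles\<close>

lemma (in complex_space) sections_ofD:
  assumes "sections_of scale M (n, g)"
  shows "\<exists>b. vector_bundle (n, g) \<and>
    (\<forall>k<3. bij_betw (laurent_comb (b k)) (regular_vec {k} n) (M k)) \<and>
    (\<forall>k<3. inj_on (laurent_comb (b k)) (carrier_vec n)) \<and>
    (\<forall>k<3. \<forall>l<3. \<forall>c<n. b l c = laurent_comb (b k) (col (g k l) c))"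
proof -
  obtain b where b: "\<forall>k<3. module_basis scale (regular {k}) (M k) n (b k)"
    and g: "\<forall>k<3. \<forall>l<3. \<forall>c<n. b l c = (\<Sum>a<n. laurent_scale scale (g k l $$ (a, c)) (b k a))"
    and vb: "vector_bundle (n, g)"
    using assms unfolding sections_of.simps by (elim conjE exE)
  have "b l c = laurent_comb (b k) (col (g k l) c)" if "k < 3" "l < 3" "c < n" for k l c
    using g that vector_bundleD(2)[OF vb that(1,2)] by (simp add: laurent_comb_def)
  moreover have "bij_betw (laurent_comb (b k)) (regular_vec {k} n) (M k)" if "k < 3" for k
    using b that by (simp add: module_basis_iff)
  moreover have "inj_on (laurent_comb (b k)) (carrier_vec n)" if "k < 3" for k
    using b that laurent_comb_inj by blast
  ultimately show ?thesis using vb by blast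
qed

lemma (in complex_space) laurent_comb_unit: "a < n \<Longrightarrow> laurent_comb b (unit_vec n a) = b a"
proof -
  assume a: "a < n"
  have "laurent_comb b (unit_vec n a) = (\<Sum>c<n. if c = a then b a else 0)"
    unfolding laurent_comb_def using a by (intro sum.cong) (simp_all add: unit_vec_def)
  then show ?thesis using a by simp
qed

lemma regular_mat_mult_vec:
  "A \<in> regular_mat S m n \<Longrightarrow> x \<in> regular_vec S n \<Longrightarrow> A *\<^sub>v x \<in> regular_vec S m"
  by (auto simp: regular_mat_def regular_vec_def scalar_prod_def intro!: regular_sum regular_mult)

lemma regular_vec_carrier: "x \<in> regular_vec S n \<Longrightarrow> x \<in> carrier_vec n"
  by (simp add: regular_vec_def)

text \<open>The matrices are read off on the bases. They are compatible with the transition matrices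
  because both composites induce the same map on sections over the triple intersection, where
  \<open>laurent_comb\<close> is injective.\<close>

lemma coeff_map_bundle_hom:
  assumes s: "complex_space s" "complex_space s'" "Vector_Spaces.linear s s' f"
    and M: "\<And>k m. k < 3 \<Longrightarrow> m \<in> M k \<Longrightarrow> coeff_map f m \<in> M' k"
    and b: "vector_bundle (n, g)"
    "\<And>k. k < 3 \<Longrightarrow> bij_betw (complex_space.laurent_comb s (b k)) (regular_vec {k} n) (M k)"
    "\<And>k l c. k < 3 \<Longrightarrow> l < 3 \<Longrightarrow> c < n \<Longrightarrow> b l c = complex_space.laurent_comb s (b k) (col (g k l) c)"
    and b': "vector_bundle (n', g')"
    "\<And>k. k < 3 \<Longrightarrow> bij_betw (complex_space.laurent_comb s' (b' k)) (regular_vec {k} n') (M' k)"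
    "\<And>k. k < 3 \<Longrightarrow> inj_on (complex_space.laurent_comb s' (b' k)) (carrier_vec n')"
    "\<And>k l c. k < 3 \<Longrightarrow> l < 3 \<Longrightarrow> c < n' \<Longrightarrow> b' l c = complex_space.laurent_comb s' (b' k) (col (g' k l) c)"
  shows "\<exists>\<phi>. bundle_hom (n, g) (n', g') \<phi> \<and>
    (\<forall>k<3. \<forall>x \<in> carrier_vec n. complex_space.laurent_comb s' (b' k) (\<phi> k *\<^sub>v x) =
       coeff_map f (complex_space.laurent_comb s (b k) x))"
proof -
  interpret s: complex_space s by fact
  interpret s': complex_space s' by fact
  have "\<exists>y. y \<in> regular_vec {k} n' \<and> s'.laurent_comb (b' k) y = coeff_map f (b k a)" if k: "k < 3" and a: "a < n" for k a
  proof -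
    have "b k a \<in> M k"
      using bij_betw_apply[OF b(2)[OF k] unit_vec_regular[OF a]] s.laurent_comb_unit[OF a] by simp
    then have "coeff_map f (b k a) \<in> M' k" using M[OF k] by blast
    then show ?thesis using b'(2)[OF k] unfolding bij_betw_def by (metis imageE)
  qed
  then obtain y where y: "\<And>k a. k < 3 \<Longrightarrow> a < n \<Longrightarrow> y k a \<in> regular_vec {k} n'"
    "\<And>k a. k < 3 \<Longrightarrow> a < n \<Longrightarrow> s'.laurent_comb (b' k) (y k a) = coeff_map f (b k a)"
    by metis
  define \<phi> where "\<phi> k = mat n' n (\<lambda>(i, a). y k a $ i)" for k
  have \<phi>: "\<phi> k \<in> regular_mat {k} n' n" if "k < 3" for k
    using y(1)[OF that] by (auto simp: \<phi>_def regular_mat_def regular_vec_def)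
  have c\<phi>: "\<phi> k \<in> carrier_mat n' n" for k by (simp add: \<phi>_def)
  have col: "col (\<phi> k) a = y k a" if "k < 3" "a < n" for k a
    using y(1)[OF that] that by (auto simp: \<phi>_def regular_vec_def)
  have main: "s'.laurent_comb (b' k) (\<phi> k *\<^sub>v x) = coeff_map f (s.laurent_comb (b k) x)"
    if k: "k < 3" and x: "x \<in> carrier_vec n" for k x
    unfolding s'.laurent_comb_mult_mat[OF c\<phi> x] coeff_map_comb[OF s] s'.laurent_comb_def[of "\<lambda>a. coeff_map f (b k a)"]
    using x col[OF k] y(2)[OF k] by simp
  have "\<phi> k * g k l = g' k l * \<phi> l" if k: "k < 3" and l: "l < 3" for k l
  proof (rule mat_col_eqI)
    note cg = vector_bundleD(2)[OF b(1) k l] and cg' = vector_bundleD(2)[OF b'(1) k l]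
    show "dim_row (\<phi> k * g k l) = dim_row (g' k l * \<phi> l)" "dim_col (\<phi> k * g k l) = dim_col (g' k l * \<phi> l)"
      using cg cg' by (auto simp: \<phi>_def)
    fix c assume "c < dim_col (g' k l * \<phi> l)"
    then have c: "c < n" by (simp add: \<phi>_def)
    have "s'.laurent_comb (b' k) (\<phi> k *\<^sub>v col (g k l) c) = coeff_map f (b l c)"
      using main[OF k, of "col (g k l) c"] b(3)[OF k l c] cg c by simp
    also have "\<dots> = s'.laurent_comb (b' l) (y l c)"
      using y(2)[OF l c] by simp
    also have "\<dots> = (\<Sum>j<n'. laurent_scale s' (y l c $ j) (s'.laurent_comb (b' k) (col (g' k l) j)))"
      using b'(4)[OF k l] regular_vec_carrier[OF y(1)[OF l c]] by (simp add: s'.laurent_comb_def[of "b' l"])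
    also have "\<dots> = s'.laurent_comb (b' k) (g' k l *\<^sub>v y l c)"
      using s'.laurent_comb_mult_mat[OF cg' regular_vec_carrier[OF y(1)[OF l c]]] by simp
    finally have "\<phi> k *\<^sub>v col (g k l) c = g' k l *\<^sub>v y l c"
      by (rule inj_onD[OF b'(3)[OF k]])
        (use c\<phi>[of k] cg cg' c regular_vec_carrier[OF y(1)[OF l c]] in \<open>auto intro!: mult_mat_vec_carrier[of _ _ n] mult_mat_vec_carrier[of _ _ n']\<close>)
    then show "col (\<phi> k * g k l) c = col (g' k l * \<phi> l) c"
      using c by (simp add: col_mult2[OF c\<phi> cg] col_mult2[OF cg' c\<phi>] col[OF l c])
  qed
  then have "bundle_hom (n, g) (n', g') \<phi>" using \<phi> by simp
  with main show ?thesis by blast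
qed

lemma graded_short_exact:
  fixes P1 :: "nat \<Rightarrow> int \<times> int \<Rightarrow> 'a::ab_group_add set"
    and P2 :: "nat \<Rightarrow> int \<times> int \<Rightarrow> 'b::ab_group_add set"
    and P3 :: "nat \<Rightarrow> int \<times> int \<Rightarrow> 'c::ab_group_add set"
  assumes s1: "complex_space s1" and s2: "complex_space s2" and s3: "complex_space s3"
    and f: "Vector_Spaces.linear s1 s2 f" and h: "Vector_Spaces.linear s2 s3 h"
    and zero: "\<And>k e. k < 3 \<Longrightarrow> 0 \<in> P1 k e" "\<And>k e. k < 3 \<Longrightarrow> 0 \<in> P2 k e"
    and inj: "\<And>k e. k < 3 \<Longrightarrow> inj_on f (P1 k e)"
    and ker: "\<And>k e. k < 3 \<Longrightarrow> f ` P1 k e = {y \<in> P2 k e. h y = 0}"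
    and surj: "\<And>k e. k < 3 \<Longrightarrow> h ` P2 k e = P3 k e"
    and E1: "sections_of s1 (\<lambda>k. graded (P1 k)) E1"
    and E2: "sections_of s2 (\<lambda>k. graded (P2 k)) E2"
    and E3: "sections_of s3 (\<lambda>k. graded (P3 k)) E3"
  shows "short_exact E1 E2 E3"
proof -
  interpret s1: complex_space s1 by fact
  interpret s2: complex_space s2 by fact
  interpret s3: complex_space s3 by fact
  interpret f: Vector_Spaces.linear s1 s2 f by fact
  interpret h: Vector_Spaces.linear s2 s3 h by fact
  \<comment> \<open>A preimage is chosen degree by degree and set to 0 where \<open>m\<close>
    vanishes. This keeps the support finite, and is the reason why 0 must lie in each piece.\<close>
  have lift: "\<exists>m' \<in> graded P. coeff_map q m' = m"
    if q0: "q 0 = 0" and P0: "\<And>e. 0 \<in> P e" and m: "\<And>e. lookup m e \<in> q ` P e"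
    for q :: "'x::ab_group_add \<Rightarrow> 'y::ab_group_add" and P and m :: "'y laurent"
  proof -
    have "\<forall>e. \<exists>x. x \<in> P e \<and> q x = lookup m e" using m by (metis imageE)
    then obtain x where x: "\<And>e. x e \<in> P e \<and> q (x e) = lookup m e" by metis
    define m' where "m' = (\<Sum>e\<in>keys m. single e (x e))"
    have l: "lookup m' e = (if e \<in> keys m then x e else 0)" for e
      by (simp add: m'_def lookup_sum lookup_single when_def)
    have "m' \<in> graded P" using l x P0 by (simp add: graded_def)
    moreover have "coeff_map q m' = m"
      by (rule poly_mapping_eqI) (auto simp: lookup_coeff_map[of q, OF q0] l x q0 in_keys_iff)
    ultimately show ?thesis by blast
  qed
  have im1: "coeff_map f ` graded (P1 k) = {m \<in> graded (P2 k). coeff_map h m = 0}" if k: "k < 3" for k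
  proof (intro equalityI subsetI)
    fix m assume "m \<in> coeff_map f ` graded (P1 k)"
    then obtain m1 where m1: "m1 \<in> graded (P1 k)" "m = coeff_map f m1" by blast
    have "lookup m e \<in> {y \<in> P2 k e. h y = 0}" for e
    proof -
      have "lookup m1 e \<in> P1 k e" using m1(1) unfolding graded_def by blast
      then show ?thesis
        unfolding ker[OF k, symmetric] m1(2) by (simp add: lookup_coeff_map)
    qed
    then show "m \<in> {m \<in> graded (P2 k). coeff_map h m = 0}"
      by (auto simp: graded_def lookup_coeff_map intro!: poly_mapping_eqI)
  next
    fix m assume m: "m \<in> {m \<in> graded (P2 k). coeff_map h m = 0}"
    have "h (lookup m e) = 0" for e
      using m lookup_coeff_map[of h m e] by simp
    then have "lookup m e \<in> f ` P1 k e" for e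
      unfolding ker[OF k] using m unfolding graded_def by blast
    then show "m \<in> coeff_map f ` graded (P1 k)"
      using lift[of f "P1 k" m] zero(1)[OF k] by auto
  qed
  have im2: "coeff_map h ` graded (P2 k) = graded (P3 k)" if k: "k < 3" for k
  proof (intro equalityI subsetI)
    fix m assume "m \<in> coeff_map h ` graded (P2 k)"
    then obtain x where x: "x \<in> graded (P2 k)" "m = coeff_map h x" by blast
    have "lookup m e \<in> P3 k e" for e
      using x(1) surj[OF k, of e] unfolding x(2) lookup_coeff_map[of h, OF h.zero] graded_def by blast
    then show "m \<in> graded (P3 k)" unfolding graded_def by blast
  next
    fix m assume "m \<in> graded (P3 k)"
    then have "lookup m e \<in> h ` P2 k e" for e
      unfolding surj[OF k] graded_def by blast
    then show "m \<in> coeff_map h ` graded (P2 k)"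
      using lift[of h "P2 k" m] zero(2)[OF k] h.zero by blast
  qed
  have inj1: "inj_on (coeff_map f) (graded (P1 k))" if k: "k < 3" for k
  proof (rule inj_onI)
    fix m m' assume m: "m \<in> graded (P1 k)" "m' \<in> graded (P1 k)" "coeff_map f m = coeff_map f m'"
    show "m = m'"
    proof (rule poly_mapping_eqI)
      fix e
      have "f (lookup m e) = f (lookup m' e)"
        using lookup_coeff_map[of f m e] lookup_coeff_map[of f m' e] m(3) by simp
      then show "lookup m e = lookup m' e"
        using inj_onD[OF inj[OF k, of e]] m(1,2) unfolding graded_def by blast
    qed
  qed
  obtain n1 g1 n2 g2 n3 g3 where E: "E1 = (n1, g1)" "E2 = (n2, g2)" "E3 = (n3, g3)"
    by (cases E1, cases E2, cases E3) auto
  obtain b1 where b1: "vector_bundle (n1, g1)"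
    "\<And>k. k < 3 \<Longrightarrow> bij_betw (s1.laurent_comb (b1 k)) (regular_vec {k} n1) (graded (P1 k))"
    "\<And>k. k < 3 \<Longrightarrow> inj_on (s1.laurent_comb (b1 k)) (carrier_vec n1)"
    "\<And>k l c. k < 3 \<Longrightarrow> l < 3 \<Longrightarrow> c < n1 \<Longrightarrow> b1 l c = s1.laurent_comb (b1 k) (col (g1 k l) c)"
    using s1.sections_ofD[OF E1[unfolded E]] by metis
  obtain b2 where b2: "vector_bundle (n2, g2)"
    "\<And>k. k < 3 \<Longrightarrow> bij_betw (s2.laurent_comb (b2 k)) (regular_vec {k} n2) (graded (P2 k))"
    "\<And>k. k < 3 \<Longrightarrow> inj_on (s2.laurent_comb (b2 k)) (carrier_vec n2)"
    "\<And>k l c. k < 3 \<Longrightarrow> l < 3 \<Longrightarrow> c < n2 \<Longrightarrow> b2 l c = s2.laurent_comb (b2 k) (col (g2 k l) c)"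
    using s2.sections_ofD[OF E2[unfolded E]] by metis
  obtain b3 where b3: "vector_bundle (n3, g3)"
    "\<And>k. k < 3 \<Longrightarrow> bij_betw (s3.laurent_comb (b3 k)) (regular_vec {k} n3) (graded (P3 k))"
    "\<And>k. k < 3 \<Longrightarrow> inj_on (s3.laurent_comb (b3 k)) (carrier_vec n3)"
    "\<And>k l c. k < 3 \<Longrightarrow> l < 3 \<Longrightarrow> c < n3 \<Longrightarrow> b3 l c = s3.laurent_comb (b3 k) (col (g3 k l) c)"
    using s3.sections_ofD[OF E3[unfolded E]] by metis
  have M1: "coeff_map f m \<in> graded (P2 k)" if "k < 3" "m \<in> graded (P1 k)" for k m
    using im1[OF that(1)] that(2) by blast
  have M2: "coeff_map h m \<in> graded (P3 k)" if "k < 3" "m \<in> graded (P2 k)" for k m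
    using im2[OF that(1)] that(2) by blast
  have "\<exists>\<phi>. bundle_hom (n1, g1) (n2, g2) \<phi> \<and> (\<forall>k<3. \<forall>x \<in> carrier_vec n1.
      s2.laurent_comb (b2 k) (\<phi> k *\<^sub>v x) = coeff_map f (s1.laurent_comb (b1 k) x))"
    by (rule coeff_map_bundle_hom[OF s1 s2 f M1 b1(1,2,4) b2])
  then obtain \<phi> where \<phi>: "bundle_hom (n1, g1) (n2, g2) \<phi>"
    "\<And>k x. k < 3 \<Longrightarrow> x \<in> carrier_vec n1 \<Longrightarrow> s2.laurent_comb (b2 k) (\<phi> k *\<^sub>v x) = coeff_map f (s1.laurent_comb (b1 k) x)"
    by metis
  have "\<exists>\<psi>. bundle_hom (n2, g2) (n3, g3) \<psi> \<and> (\<forall>k<3. \<forall>x \<in> carrier_vec n2.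
      s3.laurent_comb (b3 k) (\<psi> k *\<^sub>v x) = coeff_map h (s2.laurent_comb (b2 k) x))"
    by (rule coeff_map_bundle_hom[OF s2 s3 h M2 b2(1,2,4) b3])
  then obtain \<psi> where \<psi>: "bundle_hom (n2, g2) (n3, g3) \<psi>"
    "\<And>k x. k < 3 \<Longrightarrow> x \<in> carrier_vec n2 \<Longrightarrow> s3.laurent_comb (b3 k) (\<psi> k *\<^sub>v x) = coeff_map h (s2.laurent_comb (b2 k) x)"
    by metis
  have r\<phi>: "\<phi> k \<in> regular_mat {k} n2 n1" and r\<psi>: "\<psi> k \<in> regular_mat {k} n3 n2" if "k < 3" for k
    using \<phi>(1) \<psi>(1) that by simp_all
  have "inj_on (\<lambda>x. \<phi> k *\<^sub>v x) (regular_vec {k} n1)" if k: "k < 3" for k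
  proof (rule inj_onI)
    fix x y assume x: "x \<in> regular_vec {k} n1" and y: "y \<in> regular_vec {k} n1" and eq: "\<phi> k *\<^sub>v x = \<phi> k *\<^sub>v y"
    have "coeff_map f (s1.laurent_comb (b1 k) x) = coeff_map f (s1.laurent_comb (b1 k) y)"
      using \<phi>(2)[OF k regular_vec_carrier[OF x]] \<phi>(2)[OF k regular_vec_carrier[OF y]] eq by simp
    then have "s1.laurent_comb (b1 k) x = s1.laurent_comb (b1 k) y"
      using inj_onD[OF inj1[OF k]] bij_betw_apply[OF b1(2)[OF k]] x y by blast
    then show "x = y"
      using inj_onD[OF b1(3)[OF k]] regular_vec_carrier x y by blast
  qed
  moreover have "(\<lambda>x. \<phi> k *\<^sub>v x) ` regular_vec {k} n1 = {y \<in> regular_vec {k} n2. \<psi> k *\<^sub>v y = 0\<^sub>v n3}"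
    if k: "k < 3" for k
  proof -
    have z: "\<psi> k *\<^sub>v y = 0\<^sub>v n3 \<longleftrightarrow> coeff_map h (s2.laurent_comb (b2 k) y) = 0" if y: "y \<in> regular_vec {k} n2" for y
    proof -
      have "\<psi> k *\<^sub>v y = 0\<^sub>v n3 \<longleftrightarrow> s3.laurent_comb (b3 k) (\<psi> k *\<^sub>v y) = s3.laurent_comb (b3 k) (0\<^sub>v n3)"
        using inj_on_eq_iff[OF b3(3)[OF k], of "\<psi> k *\<^sub>v y" "0\<^sub>v n3"]
          regular_vec_carrier[OF regular_mat_mult_vec[OF r\<psi>[OF k] y]] by simp
      then show ?thesis using \<psi>(2)[OF k regular_vec_carrier[OF y]] by simp
    qed
    show ?thesis
    proof (intro equalityI subsetI)
      fix y assume "y \<in> (\<lambda>x. \<phi> k *\<^sub>v x) ` regular_vec {k} n1"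
      then obtain x where x: "x \<in> regular_vec {k} n1" "y = \<phi> k *\<^sub>v x" by blast
      then have y: "y \<in> regular_vec {k} n2" using regular_mat_mult_vec[OF r\<phi>[OF k]] by blast
      have "s1.laurent_comb (b1 k) x \<in> graded (P1 k)" using bij_betw_apply[OF b1(2)[OF k] x(1)] .
      then have "coeff_map h (s2.laurent_comb (b2 k) y) = 0"
        using im1[OF k] \<phi>(2)[OF k regular_vec_carrier[OF x(1)]] x(2) by auto
      then show "y \<in> {y \<in> regular_vec {k} n2. \<psi> k *\<^sub>v y = 0\<^sub>v n3}" using y z by blast
    next
      fix y assume "y \<in> {y \<in> regular_vec {k} n2. \<psi> k *\<^sub>v y = 0\<^sub>v n3}"
      then have y: "y \<in> regular_vec {k} n2" and "coeff_map h (s2.laurent_comb (b2 k) y) = 0" using z by auto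
      then have "s2.laurent_comb (b2 k) y \<in> coeff_map f ` graded (P1 k)"
        unfolding im1[OF k] using bij_betw_apply[OF b2(2)[OF k] y] by blast
      then obtain m where m: "m \<in> graded (P1 k)" "s2.laurent_comb (b2 k) y = coeff_map f m" by blast
      then obtain x where x: "x \<in> regular_vec {k} n1" "m = s1.laurent_comb (b1 k) x"
        using bij_betw_imp_surj_on[OF b1(2)[OF k]] by blast
      have "s2.laurent_comb (b2 k) y = s2.laurent_comb (b2 k) (\<phi> k *\<^sub>v x)"
        using \<phi>(2)[OF k regular_vec_carrier[OF x(1)]] m(2) x(2) by simp
      then have "y = \<phi> k *\<^sub>v x"
        using inj_onD[OF b2(3)[OF k]] regular_vec_carrier[OF y]
          regular_vec_carrier[OF regular_mat_mult_vec[OF r\<phi>[OF k] x(1)]] by blast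
      then show "y \<in> (\<lambda>x. \<phi> k *\<^sub>v x) ` regular_vec {k} n1" using x(1) by blast
    qed
  qed
  moreover have "(\<lambda>y. \<psi> k *\<^sub>v y) ` regular_vec {k} n2 = regular_vec {k} n3" if k: "k < 3" for k
  proof (intro equalityI subsetI)
    fix z assume "z \<in> (\<lambda>y. \<psi> k *\<^sub>v y) ` regular_vec {k} n2"
    then show "z \<in> regular_vec {k} n3" using regular_mat_mult_vec[OF r\<psi>[OF k]] by blast
  next
    fix z assume z: "z \<in> regular_vec {k} n3"
    have "s3.laurent_comb (b3 k) z \<in> coeff_map h ` graded (P2 k)"
      unfolding im2[OF k] using bij_betw_apply[OF b3(2)[OF k] z] .
    then obtain m where m: "m \<in> graded (P2 k)" "s3.laurent_comb (b3 k) z = coeff_map h m" by blast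
    then obtain y where y: "y \<in> regular_vec {k} n2" "m = s2.laurent_comb (b2 k) y"
      using bij_betw_imp_surj_on[OF b2(2)[OF k]] by blast
    have "s3.laurent_comb (b3 k) z = s3.laurent_comb (b3 k) (\<psi> k *\<^sub>v y)"
      using \<psi>(2)[OF k regular_vec_carrier[OF y(1)]] m(2) y(2) by simp
    then have "z = \<psi> k *\<^sub>v y"
      using inj_onD[OF b3(3)[OF k]] regular_vec_carrier[OF z]
        regular_vec_carrier[OF regular_mat_mult_vec[OF r\<psi>[OF k] y(1)]] by blast
    then show "z \<in> (\<lambda>y. \<psi> k *\<^sub>v y) ` regular_vec {k} n2" using y(1) by blast
  qed
  ultimately show ?thesis
    unfolding short_exact_def E fst_conv using \<phi>(1) \<psi>(1) by blast
qed

section \<open>Bundles with monomial transition matrices\<close>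

context complex_space
begin

lemma lookup_scale_homogeneous:
  "lookup (laurent_scale scale f (single d v)) e = lookup f (e - d) *s v"
proof -
  have "lookup (laurent_scale scale f (single d v)) e =
      (\<Sum>a\<in>keys f. if a = e - d then lookup f a *s v else 0)"
    unfolding lookup_laurent_scale by (intro sum.cong) (auto simp: lookup_single when_def)
  also have "\<dots> = lookup f (e - d) *s v"
    by (auto simp: in_keys_iff)
  finally show ?thesis .
qed

lemma lookup_comb_homogeneous:
  "lookup (laurent_comb (\<lambda>a. single (d a) (v a)) x) e =
     (\<Sum>a<dim_vec x. lookup (x $ a) (e - d a) *s v a)"
  by (simp add: laurent_comb_def lookup_sum lookup_scale_homogeneous)

text \<open>The condition on \<open>P\<close> says that \<open>P e\<close> is spanned by those
  \<open>v a\<close> for which the monomial of index \<open>e - d a\<close> is regular. By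
  independence the coefficients of a section can then be read off one degree at a time.\<close>

lemma homogeneous_basis:
  assumes indep: "\<And>c. (\<Sum>a<n. c a *s v a) = 0 \<Longrightarrow> \<forall>a<n. c a = 0"
    and P: "\<And>e x. x \<in> P e \<longleftrightarrow> (\<exists>c. x = (\<Sum>a<n. c a *s v a) \<and>
      (\<forall>a<n. c a \<noteq> 0 \<longrightarrow> (\<forall>i\<in>{0, 1, 2} - S. hom_exp i (e - d a) \<ge> 0)))"
  shows "bij_betw (laurent_comb (\<lambda>a. single (d a) (v a))) (regular_vec S n) (graded P)"
    (is "bij_betw ?L _ _")
  unfolding bij_betw_def
proof
  show "inj_on ?L (regular_vec S n)"
  proof (rule inj_onI)
    fix x y assume x: "x \<in> regular_vec S n" and y: "y \<in> regular_vec S n" and eq: "?L x = ?L y"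
    have dim: "dim_vec x = n" "dim_vec y = n" using x y by (auto simp: regular_vec_def)
    have "x $ a = y $ a" if a: "a < n" for a
    proof (rule poly_mapping_eqI)
      fix e'
      define e where "e = e' + d a"
      have "(\<Sum>b<n. (lookup (x $ b) (e - d b) - lookup (y $ b) (e - d b)) *s v b) = 0"
        using arg_cong[OF eq, of "\<lambda>m. lookup m e"]
        by (simp add: lookup_comb_homogeneous dim scale_left_diff_distrib sum_subtractf)
      then have "lookup (x $ a) (e - d a) - lookup (y $ a) (e - d a) = 0"
        using indep[of "\<lambda>b. lookup (x $ b) (e - d b) - lookup (y $ b) (e - d b)"] a
        by blast
      then show "lookup (x $ a) e' = lookup (y $ a) e'"
        by (simp add: e_def)
    qed
    then show "x = y" using dim by (intro eq_vecI) auto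
  qed
  show "?L ` regular_vec S n = graded P"
  proof (intro equalityI subsetI)
    fix m assume "m \<in> ?L ` regular_vec S n"
    then obtain x where x: "x \<in> regular_vec S n" "m = ?L x" by blast
    have dim: "dim_vec x = n" using x by (auto simp: regular_vec_def)
    have "lookup m e \<in> P e" for e
      unfolding P x(2) lookup_comb_homogeneous dim
    proof (intro exI[of _ "\<lambda>a. lookup (x $ a) (e - d a)"] conjI refl allI impI ballI)
      fix a i assume a: "a < n" "lookup (x $ a) (e - d a) \<noteq> 0" "i \<in> {0, 1, 2} - S"
      have "x $ a \<in> regular S" using x a by (simp add: regular_vec_def)
      then show "0 \<le> hom_exp i (e - d a)"
        using a(2,3) unfolding regular_def by (auto simp: in_keys_iff)
    qed
    then show "m \<in> graded P" unfolding graded_def by blast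
  next
    fix m assume "m \<in> graded P"
    then have "\<forall>e. \<exists>c. lookup m e = (\<Sum>a<n. c a *s v a) \<and>
      (\<forall>a<n. c a \<noteq> 0 \<longrightarrow> (\<forall>i\<in>{0, 1, 2} - S. hom_exp i (e - d a) \<ge> 0))"
      unfolding graded_def P by blast
    then obtain c where c: "\<And>e. lookup m e = (\<Sum>a<n. c e a *s v a)"
      "\<And>e a i. a < n \<Longrightarrow> c e a \<noteq> 0 \<Longrightarrow> i \<in> {0, 1, 2} - S \<Longrightarrow> hom_exp i (e - d a) \<ge> 0"
      by metis
    \<comment> \<open>Independence makes the chosen coefficients vanish outside the support of
      \<open>m\<close>, so the finite sums \<open>f a\<close> account for all of them.\<close>
    have c0: "c e a = 0" if "e \<notin> keys m" "a < n" for e a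
      using indep[of "c e"] c(1)[of e] that by (simp add: in_keys_iff)
    define f where "f a = (\<Sum>e\<in>keys m. single (e - d a) (c e a))" for a
    have lf: "lookup (f a) (e - d a) = c e a" if "a < n" for a e
    proof -
      have "lookup (f a) (e - d a) = (\<Sum>e'\<in>keys m. if e' = e then c e a else 0)"
        unfolding f_def lookup_sum by (intro sum.cong) (auto simp: lookup_single when_def)
      then show ?thesis using c0[of e a] that by auto
    qed
    have "f a \<in> regular S" if a: "a < n" for a
      unfolding regular_def
    proof (intro CollectI ballI)
      fix e' i assume e': "e' \<in> keys (f a)" and i: "i \<in> {0, 1, 2} - S"
      have "c (e' + d a) a \<noteq> 0"
        using lf[OF a, of "e' + d a"] e' by (simp add: in_keys_iff)
      from c(2)[OF a this i] show "0 \<le> hom_exp i e'" by simp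
    qed
    then have "vec n f \<in> regular_vec S n" by (simp add: regular_vec_def)
    moreover have "?L (vec n f) = m"
      by (rule poly_mapping_eqI) (simp add: lookup_comb_homogeneous lf c(1))
    ultimately show "m \<in> ?L ` regular_vec S n" by blast
  qed
qed

definition monomial_transition ::
    "nat \<Rightarrow> (nat \<Rightarrow> nat \<Rightarrow> int \<times> int) \<Rightarrow> (nat \<Rightarrow> nat \<Rightarrow> nat \<Rightarrow> nat \<Rightarrow> complex) \<Rightarrow> nat \<Rightarrow> nat \<Rightarrow> complex laurent mat" where
  "monomial_transition n d t k l =
     mat n n (\<lambda>(a, c). single (d l c - d k a) (t k l a c))"

text \<open>The \<open>t k l\<close> are change of basis matrices and satisfy the cocycle identities
  by uniqueness of coordinates; for the monomials the exponents telescope. The hypothesis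
  \<open>reg\<close> is the regularity of the transition matrices on the overlaps.\<close>

lemma sections_of_homogeneous:
  assumes indep: "\<And>k c. k < 3 \<Longrightarrow> (\<Sum>a<n. c a *s v k a) = 0 \<Longrightarrow> \<forall>a<n. c a = 0"
    and P: "\<And>k e x. k < 3 \<Longrightarrow> x \<in> P k e \<longleftrightarrow> (\<exists>c. x = (\<Sum>a<n. c a *s v k a) \<and>
      (\<forall>a<n. c a \<noteq> 0 \<longrightarrow> (\<forall>i\<in>{0, 1, 2} - {k}. hom_exp i (e - d k a) \<ge> 0)))"
    and t: "\<And>k l c. k < 3 \<Longrightarrow> l < 3 \<Longrightarrow> c < n \<Longrightarrow> v l c = (\<Sum>a<n. t k l a c *s v k a)"
    and reg: "\<And>k l a c i. k < 3 \<Longrightarrow> l < 3 \<Longrightarrow> a < n \<Longrightarrow> c < n \<Longrightarrow> t k l a c \<noteq> 0 \<Longrightarrow>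
      i \<in> {0, 1, 2} - {k, l} \<Longrightarrow> hom_exp i (d l c - d k a) \<ge> 0"
  shows "sections_of scale (\<lambda>k. graded (P k)) (n, monomial_transition n d t)"
proof -
  let ?g = "monomial_transition n d t"
  let ?b = "\<lambda>k a. single (d k a) (v k a)"
  have uniq: "\<forall>a<n. c a = c' a" if "k < 3" "(\<Sum>a<n. c a *s v k a) = (\<Sum>a<n. c' a *s v k a)" for k c c'
    using indep[OF that(1), of "\<lambda>a. c a - c' a"] that(2)
    by (simp add: scale_left_diff_distrib sum_subtractf)
  have tkk: "t k k a c = (if a = c then 1 else 0)" if "k < 3" "a < n" "c < n" for k a c
  proof -
    have "(\<Sum>a<n. t k k a c *s v k a) = (\<Sum>a<n. (if a = c then 1 else 0) *s v k a)"
      using t[OF that(1,1,3)] that(3) by (simp add: if_distrib[of "\<lambda>x. x *s _"] cong: if_cong)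
    from uniq[OF that(1) this] that(2) show ?thesis by blast
  qed
  have tcomp: "(\<Sum>b<n. t k l a b * t l m b c) = t k m a c"
    if "k < 3" "l < 3" "m < 3" "a < n" "c < n" for k l m a c
  proof -
    have "(\<Sum>a<n. t k m a c *s v k a) = (\<Sum>b<n. t l m b c *s v l b)"
      using t[OF that(1,3,5)] t[OF that(2,3,5)] by simp
    also have "\<dots> = (\<Sum>b<n. \<Sum>a<n. (t k l a b * t l m b c) *s v k a)"
      using t[OF that(1,2)] by (simp add: scale_sum_right mult.commute)
    also have "\<dots> = (\<Sum>a<n. \<Sum>b<n. (t k l a b * t l m b c) *s v k a)"
      by (rule sum.swap)
    also have "\<dots> = (\<Sum>a<n. (\<Sum>b<n. t k l a b * t l m b c) *s v k a)"
      by (simp add: scale_sum_left)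
    finally show ?thesis using uniq[OF that(1)] that(4) by fastforce
  qed
  have vb: "vector_bundle (n, ?g)"
    unfolding vector_bundle.simps
  proof (intro conjI allI impI)
    fix k l :: nat assume kl: "k < 3" "l < 3"
    show "?g k l \<in> regular_mat {k, l} n n"
      using reg[OF kl] by (auto simp: regular_mat_def monomial_transition_def regular_def)
  next
    fix k :: nat assume k: "k < 3"
    show "?g k k = 1\<^sub>m n"
      by (intro eq_matI) (auto simp: monomial_transition_def tkk[OF k])
  next
    fix k l m :: nat assume klm: "k < 3" "l < 3" "m < 3"
    show "?g k l * ?g l m = ?g k m"
    proof (rule eq_matI)
      fix a c assume "a < dim_row (?g k m)" "c < dim_col (?g k m)"
      then have ac: "a < n" "c < n" by (simp_all add: monomial_transition_def)
      have "(?g k l * ?g l m) $$ (a, c) =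
        (\<Sum>b<n. single (d m c - d k a) (t k l a b * t l m b c))"
        using ac by (simp add: monomial_transition_def scalar_prod_def mult_single atLeast0LessThan)
      also have "\<dots> = single (d m c - d k a) (\<Sum>b<n. t k l a b * t l m b c)"
        by (induction n) (simp_all add: single_add)
      finally show "(?g k l * ?g l m) $$ (a, c) = ?g k m $$ (a, c)"
        using ac tcomp[OF klm ac] by (simp add: monomial_transition_def)
    qed (simp_all add: monomial_transition_def)
  qed
  have mb: "module_basis scale (regular {k}) (graded (P k)) n (?b k)" if "k < 3" for k
    unfolding module_basis_iff by (rule homogeneous_basis[OF indep[OF that] P[OF that]])
  have tr: "?b l c = (\<Sum>a<n. laurent_scale scale (?g k l $$ (a, c)) (?b k a))"
    if "k < 3" "l < 3" "c < n" for k l c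
  proof (rule poly_mapping_eqI)
    fix e
    have "lookup (\<Sum>a<n. laurent_scale scale (?g k l $$ (a, c)) (?b k a)) e =
      (\<Sum>a<n. (t k l a c when d l c = e) *s v k a)"
      unfolding lookup_sum using that(3)
      by (intro sum.cong) (auto simp: lookup_scale_homogeneous monomial_transition_def lookup_single when_def)
    also have "\<dots> = lookup (?b l c) e"
      using t[OF that] by (simp add: lookup_single when_def)
    finally show "lookup (?b l c) e =
      lookup (\<Sum>a<n. laurent_scale scale (?g k l $$ (a, c)) (?b k a)) e" by simp
  qed
  show ?thesis
    unfolding sections_of.simps
    by (intro conjI exI[of _ ?b] allI impI vb mb tr)
qed

lemma sections_of_zero: "sections_of scale (\<lambda>k. graded (\<lambda>e. {0})) (0, monomial_transition 0 d t)"
  by (rule sections_of_homogeneous[where v = undefined]) auto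

end

section \<open>Independence of the transition matrices that present a sheaf\<close>

lemma sections_of_vector_bundle: "sections_of s M E \<Longrightarrow> vector_bundle E"
  by (cases E) simp

lemma chern_short_exact_graded:
  assumes "complex_space s1" "complex_space s2" "complex_space s3"
    "Vector_Spaces.linear s1 s2 f" "Vector_Spaces.linear s2 s3 h"
    "\<And>k e. k < 3 \<Longrightarrow> 0 \<in> P1 k e" "\<And>k e. k < 3 \<Longrightarrow> 0 \<in> P2 k e"
    "\<And>k e. k < 3 \<Longrightarrow> inj_on f (P1 k e)"
    "\<And>k e. k < 3 \<Longrightarrow> f ` P1 k e = {y \<in> P2 k e. h y = 0}"
    "\<And>k e. k < 3 \<Longrightarrow> h ` P2 k e = P3 k e"
    "sections_of s1 (\<lambda>k. graded (P1 k)) E1" "sections_of s2 (\<lambda>k. graded (P2 k)) E2"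
    "sections_of s3 (\<lambda>k. graded (P3 k)) E3"
  shows "chern_character E2 = chern_character E1 + chern_character E3"
  using graded_short_exact[OF assms] assms(11-13)[THEN sections_of_vector_bundle] chern_character_exists
  unfolding is_chern_character_def by blast

text \<open>The identity of the common sheaf of sections gives an exact sequence from E to E' with
  quotient Z presenting the zero sheaf, and additivity forces ch(Z) = 0. So the choice of a bundle
  in \<open>sheaf_chern_character\<close> does not affect the value.\<close>

lemma (in complex_space) chern_graded_unique:
  assumes "sections_of scale (\<lambda>k. graded (P k)) E" "sections_of scale (\<lambda>k. graded (P k)) E'"
    and zero: "\<And>k e. k < 3 \<Longrightarrow> 0 \<in> P k e"
  shows "chern_character E' = chern_character E"
proof -
  have cs: "complex_space scale" ..
  have lin: "Vector_Spaces.linear scale scale (\<lambda>x. x)" "Vector_Spaces.linear scale scale (\<lambda>x. 0)"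
    by unfold_locales (auto simp: algebra_simps)
  obtain Z where Z: "sections_of scale (\<lambda>k. graded (\<lambda>e. {0})) Z" using sections_of_zero by blast
  have "chern_character Z = chern_character Z + chern_character Z"
    by (rule chern_short_exact_graded[OF cs cs cs lin _ _ _ _ _ Z Z Z]) auto
  then have "chern_character Z = 0" by simp
  moreover have "chern_character E' = chern_character E + chern_character Z"
    by (rule chern_short_exact_graded[OF cs cs cs lin _ _ _ _ _ assms(1,2) Z]) (use zero in auto)
  ultimately show ?thesis by simp
qed

lemma sections_of_some: "sections_of s M E \<Longrightarrow> sections_of s M (SOME E. sections_of s M E)"
  by (rule someI)

lemma (in complex_space) sheaf_chern_character_eq:
  assumes "sections_of scale (\<lambda>k. graded (P k)) E" "\<And>k e. k < 3 \<Longrightarrow> 0 \<in> P k e"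
  shows "sheaf_chern_character scale (\<lambda>k. graded (P k)) = chern_character E"
  unfolding sheaf_chern_character_def
  by (rule chern_graded_unique[OF assms(1) sections_of_some[OF assms(1)] assms(2)])

section \<open>Bases adapted to two filtrations\<close>

text \<open>The part of index \<open>e\<close> of the Rees module over U_k. With homogeneous
  exponents one formula serves all charts: the variable u_i belongs to the filtration
  \<open>F i\<close>.\<close>

definition rees_piece :: "(nat \<Rightarrow> int \<Rightarrow> 'v set) \<Rightarrow> nat \<Rightarrow> int \<times> int \<Rightarrow> 'v set" where
  "rees_piece F k e = {x. \<forall>i \<in> {0, 1, 2} - {k}. x \<in> F i (- hom_exp i e)}"

definition three_filtrations ::
    "(int \<Rightarrow> 'v set) \<Rightarrow> (int \<Rightarrow> 'v set) \<Rightarrow> (int \<Rightarrow> 'v set) \<Rightarrow> nat \<Rightarrow> int \<Rightarrow> 'v set" where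
  "three_filtrations F0 F1 F2 i = (if i = 0 then F0 else if i = 1 then F1 else F2)"

lemma three_filtrations_simps [simp]:
  "three_filtrations F0 F1 F2 0 = F0" "three_filtrations F0 F1 F2 (Suc 0) = F1"
  "three_filtrations F0 F1 F2 2 = F2"
  by (simp_all add: three_filtrations_def)

lemma chart_index_bij: "bij (chart_index k)"
proof (rule bijI)
  show "inj (chart_index k)" by (auto simp: inj_def chart_index_def split: if_splits)
  have "e = chart_index k (if k = 0 then e else if k = 1 then (- fst e - snd e, snd e) else (- fst e - snd e, fst e))" for e
    by (auto simp: chart_index_def prod_eq_iff)
  then show "surj (chart_index k)" unfolding surj_def by blast
qed

text \<open>For i < j other than k, \<open>chart_index k (a, b)\<close> has exponent a in u_i and b
  in u_j, so the two coordinates of the chart impose precisely the two conditions of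
  \<open>rees_piece\<close>.\<close>

lemma rees_bundle_graded:
  assumes "k < 3"
  shows "rees_bundle F0 F1 F2 k = graded (rees_piece (three_filtrations F0 F1 F2) k)"
proof -
  have l: "lookup (Poly_Mapping.map_key (chart_index j) m) e =
      lookup m (chart_index j e)" for m :: "'a laurent" and e j
    using chart_index_bij[of j] by (simp add: map_key.rep_eq bij_is_inj)
  have s: "(\<forall>e. Q e) \<longleftrightarrow> (\<forall>p q. Q (chart_index k (- p, - q)))" for Q :: "int \<times> int \<Rightarrow> bool"
  proof
    assume *: "\<forall>p q. Q (chart_index k (- p, - q))"
    show "\<forall>e. Q e"
    proof
      fix e
      obtain a b where ab: "e = chart_index k (a, b)"
        using chart_index_bij[of k] by (metis bij_pointE surj_pair)
      show "Q e" using *[rule_format, of "- a" "- b"] ab by simp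
    qed
  qed blast
  have r: "rees_bundle F0 F1 F2 k = {m. \<forall>p q. lookup m (chart_index k (- p, - q)) \<in>
      (if k = 0 then F1 p \<inter> F2 q else if k = 1 then F0 p \<inter> F2 q else F0 p \<inter> F1 q)}"
    by (auto simp: rees_bundle_def rees2_def l)
  consider "k = 0" | "k = 1" | "k = 2" using assms by linarith
  then show ?thesis
    unfolding graded_def rees_piece_def r s
    by cases (auto simp: chart_index_def hom_exp_def insert_Diff_if)
qed

lemma sections_of_cong:
  assumes "\<And>k. k < 3 \<Longrightarrow> M k = M' k"
  shows "sections_of s M = sections_of s M'"
proof
  fix E show "sections_of s M E = sections_of s M' E"
    using assms by (cases E) simp
qed

lemma sheaf_chern_character_rees:
  "sheaf_chern_character s (rees_bundle F0 F1 F2) =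
   sheaf_chern_character s (\<lambda>k. graded (rees_piece (three_filtrations F0 F1 F2) k))"
  unfolding sheaf_chern_character_def
  by (subst sections_of_cong[OF rees_bundle_graded]) auto

section \<open>Splitting a line off two filtrations\<close>

lemma int_greatest_index:
  fixes P :: "int \<Rightarrow> bool"
  assumes "P a" "\<not> P b" and down: "\<And>m n. m \<le> n \<Longrightarrow> P n \<Longrightarrow> P m"
  obtains p where "\<And>m. P m \<longleftrightarrow> m \<le> p"
proof -
  have lt: "m < b" if "P m" for m using down[of b m] that assms(2) by force
  have fin: "finite {m. P m \<and> a \<le> m}"
    by (rule finite_subset[of _ "{a..b}"]) (auto dest: lt)
  define p where "p = Max {m. P m \<and> a \<le> m}"
  have "p \<in> {m. P m \<and> a \<le> m}"
    unfolding p_def by (rule Max_in[OF fin]) (use assms(1) in auto)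
  then have "P p" "a \<le> p" by auto
  moreover have "m \<le> p" if "P m" for m
  proof (cases "a \<le> m")
    case True
    then show ?thesis unfolding p_def using that by (intro Max_ge fin) auto
  qed (use \<open>a \<le> p\<close> in simp)
  ultimately have "P m \<longleftrightarrow> m \<le> p" for m using down by blast
  then show ?thesis using that by blast
qed

context complex_space
begin

text \<open>Relative to a subspace \<open>W\<close>, so that inductions can pass to kernels of
  functionals without changing the type.\<close>

definition filtration_on :: "'b set \<Rightarrow> (int \<Rightarrow> 'b set) \<Rightarrow> bool" where
  "filtration_on W F \<longleftrightarrow>
     (\<forall>p. subspace (F p) \<and> F p \<subseteq> W) \<and> antimono F \<and> (\<exists>p. F p = W) \<and> (\<exists>q. F q = {0})"

lemma complete_filtration_iff: "complete_filtration scale F \<longleftrightarrow> filtration_on UNIV F"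
  by (simp add: complete_filtration_def filtration_on_def)

lemma filtration_onD:
  assumes "filtration_on W F"
  shows "subspace (F p)" "m \<le> n \<Longrightarrow> F n \<subseteq> F m" "F p \<subseteq> W" "0 \<in> F p" "subspace W"
  using assms by (auto simp: filtration_on_def subspace_0 dest: antimonoD)

lemma functional_exists:
  assumes Y: "subspace Y" and v: "v \<notin> Y"
  obtains g where "Vector_Spaces.linear scale (*) g" "g v = 1" "\<And>y. y \<in> Y \<Longrightarrow> g y = 0"
proof -
  interpret vector_space_pair scale "(*) :: complex \<Rightarrow> complex \<Rightarrow> complex"
    by unfold_locales (auto simp: algebra_simps)
  obtain B where B: "B \<subseteq> Y" "independent B" "Y \<subseteq> span B"
    using maximal_independent_subset[of Y] by blast
  have "span B \<subseteq> Y" using B(1) Y by (simp add: span_minimal)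
  then have "independent (insert v B)" using v B(2) by (meson independent_insertI subsetD)
  then obtain g where g: "Vector_Spaces.linear scale (*) g" "\<forall>x\<in>insert v B. g x = (if x = v then 1 else 0)"
    using linear_independent_extend[of "insert v B" "\<lambda>x. if x = v then 1 else 0"] by blast
  have "g x = 0" if "x \<in> B" for x using g(2) that v B(1) by auto
  then have "g y = 0" if "y \<in> Y" for y
    using linear_eq_0_on_span[OF g(1)] B(3) that by blast
  with g show ?thesis using that by simp
qed

text \<open>
  \<open>F\<close> is the direct sum of its restriction to the kernel of \<open>g\<close> and of the line spanned by \<open>v\<close>,
  placed in degree \<open>p\<close>.
\<close>

definition peels :: "'b \<Rightarrow> ('b \<Rightarrow> complex) \<Rightarrow> int \<Rightarrow> (int \<Rightarrow> 'b set) \<Rightarrow> bool" where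
  "peels v g p F \<longleftrightarrow> (\<forall>m x. x \<in> F m \<longleftrightarrow> (g x \<noteq> 0 \<longrightarrow> m \<le> p) \<and> x - g x *s v \<in> F m)"

lemma peelsI:
  assumes F: "filtration_on W F" and v: "v \<in> F p"
    and above: "\<And>m x. p < m \<Longrightarrow> x \<in> F m \<Longrightarrow> g x = 0"
  shows "peels v g p F"
  unfolding peels_def
proof (intro allI iffI)
  fix m x assume x: "x \<in> F m"
  have le: "g x \<noteq> 0 \<longrightarrow> m \<le> p" using above[of m x] x by fastforce
  moreover have "x - g x *s v \<in> F m"
  proof (cases "g x = 0")
    case False
    then have "v \<in> F m" using le v filtration_onD(2)[OF F] by blast
    then show ?thesis using x filtration_onD(1)[OF F] by (simp add: subspace_diff subspace_scale)
  qed (use x in simp)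
  ultimately show "(g x \<noteq> 0 \<longrightarrow> m \<le> p) \<and> x - g x *s v \<in> F m" by blast
next
  fix m x assume x: "(g x \<noteq> 0 \<longrightarrow> m \<le> p) \<and> x - g x *s v \<in> F m"
  show "x \<in> F m"
  proof (cases "g x = 0")
    case False
    then have "v \<in> F m" using x v filtration_onD(2)[OF F] by blast
    then have "(x - g x *s v) + g x *s v \<in> F m"
      using x filtration_onD(1)[OF F] by (intro subspace_add subspace_scale) auto
    then show ?thesis by simp
  qed (use x in simp)
qed

text \<open>The vector v is taken in the last nonzero step of F and, inside it, as deep in G as
  possible; g is 1 at v and kills the next step of G. That g respects F comes for free, as F
  vanishes above p. This leaves no freedom to accommodate a third filtration.\<close>

lemma peel_exists:
  assumes F: "filtration_on W F" and G: "filtration_on W G" and W: "W \<noteq> {0}"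
  obtains v g p q where "v \<in> W" "Vector_Spaces.linear scale (*) g" "g v = 1"
    "peels v g p F" "peels v g q G"
proof -
  obtain a b where ab: "F a = W" "F b = {0}" using F unfolding filtration_on_def by blast
  have "F m \<noteq> {0}" if "m \<le> n" "F n \<noteq> {0}" for m n
    using filtration_onD(2)[OF F that(1)] filtration_onD(4)[OF F, of n] that(2) by blast
  then obtain p where p: "\<And>m. F m \<noteq> {0} \<longleftrightarrow> m \<le> p"
    using int_greatest_index[of "\<lambda>m. F m \<noteq> {0}" a b] ab W by blast
  obtain a' b' where ab': "G a' = W" "G b' = {0}" using G unfolding filtration_on_def by blast
  have down: "F p \<inter> G m \<noteq> {0}" if "m \<le> n" "F p \<inter> G n \<noteq> {0}" for m n
    using filtration_onD(2)[OF G that(1)] filtration_onD(4)[OF F, of p] filtration_onD(4)[OF G, of n] that(2)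
    by blast
  have top: "F p \<inter> G a' \<noteq> {0}"
    using p[of p] filtration_onD(3)[OF F, of p] ab'(1) by (simp add: Int_absorb2)
  have bot: "\<not> F p \<inter> G b' \<noteq> {0}" using ab'(2) filtration_onD(4)[OF F, of p] by auto
  obtain q where q: "\<And>m. F p \<inter> G m \<noteq> {0} \<longleftrightarrow> m \<le> q"
    by (rule int_greatest_index[of "\<lambda>m. F p \<inter> G m \<noteq> {0}", OF top bot down]) blast+
  have "F p \<inter> G q \<noteq> {0}" "0 \<in> F p \<inter> G q"
    using q[of q] filtration_onD(4)[OF F] filtration_onD(4)[OF G] by auto
  then obtain v where v: "v \<in> F p" "v \<in> G q" "v \<noteq> 0" by blast
  have "F p \<inter> G (q + 1) = {0}" using q[of "q + 1"] by simp
  then have "v \<notin> G (q + 1)" using v by blast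
  then obtain g where g: "Vector_Spaces.linear scale (*) g" "g v = 1" "\<And>y. y \<in> G (q + 1) \<Longrightarrow> g y = 0"
    using functional_exists[OF filtration_onD(1)[OF G]] by blast
  have g0: "g 0 = 0" using g(1) by (rule module_hom.zero[OF Vector_Spaces.linear.axioms(3)])
  have "peels v g p F"
  proof (rule peelsI[OF F v(1)])
    fix m x assume "p < m" "x \<in> F m"
    then show "g x = 0" using p[of m] g0 by auto
  qed
  moreover have "peels v g q G"
  proof (rule peelsI[OF G v(2)])
    fix m x assume "q < m" "x \<in> G m"
    then have "x \<in> G (q + 1)" using filtration_onD(2)[OF G, of "q + 1" m] by auto
    then show "g x = 0" by (rule g(3))
  qed
  moreover have "v \<in> W" using v(1) filtration_onD(3)[OF F] by blast
  ultimately show ?thesis using that g by blast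
qed

lemma filtration_on_kernel:
  assumes F: "filtration_on W F" and g: "Vector_Spaces.linear scale (*) g"
  shows "filtration_on (W \<inter> {x. g x = 0}) (\<lambda>m. F m \<inter> {x. g x = 0})"
proof -
  interpret g: Vector_Spaces.linear scale "(*)" g by fact
  have k: "subspace {x. g x = 0}"
    by (auto simp: subspace_def g.add g.scale)
  obtain a b where ab: "F a = W" "F b = {0}" using F unfolding filtration_on_def by blast
  show ?thesis
    unfolding filtration_on_def
  proof (intro conjI allI)
    fix p show "subspace (F p \<inter> {x. g x = 0})" using filtration_onD(1)[OF F] k by (rule subspace_inter)
    show "F p \<inter> {x. g x = 0} \<subseteq> W \<inter> {x. g x = 0}" using filtration_onD(3)[OF F] by blast
    show "\<exists>p. F p \<inter> {x. g x = 0} = W \<inter> {x. g x = 0}" using ab(1) by blast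
    have "F b \<inter> {x. g x = 0} = {0}" using ab(2) g.zero by auto
    then show "\<exists>q. F q \<inter> {x. g x = 0} = {0}" by blast
    show "antimono (\<lambda>m. F m \<inter> {x. g x = 0})"
      using filtration_onD(2)[OF F] by (intro antimonoI) blast
  qed
qed

end

locale finite_complex_space = complex_space scale + finite_dimensional_vector_space scale B
  for scale :: "complex \<Rightarrow> 'b::ab_group_add \<Rightarrow> 'b" (infixr \<open>*s\<close> 75) and B
begin

lemma dim_kernel:
  assumes X: "subspace X" and g: "Vector_Spaces.linear scale (*) g" and v: "v \<in> X" "g v = 1"
  shows "dim X = dim (X \<inter> {x. g x = 0}) + 1"
proof -
  interpret g: Vector_Spaces.linear scale "(*)" g by fact
  let ?K = "X \<inter> {x. g x = 0}"
  have K: "subspace ?K"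
    using X by (auto simp: subspace_def g.add g.scale)
  have "span (insert v ?K) = X"
  proof
    show "span (insert v ?K) \<subseteq> X" using X v by (intro span_minimal) auto
    show "X \<subseteq> span (insert v ?K)"
    proof
      fix x assume x: "x \<in> X"
      have "x - g x *s v \<in> ?K"
        using x v X by (simp add: subspace_diff subspace_scale g.diff g.scale)
      then show "x \<in> span (insert v ?K)"
        unfolding span_insert by (auto intro: span_base)
    qed
  qed
  then have "dim X = dim (insert v ?K)" by (metis dim_span)
  moreover have "v \<notin> span ?K"
    unfolding span_eq_iff[THEN iffD2, OF K] using v(2) by simp
  ultimately show ?thesis by (simp add: dim_insert)
qed

text \<open>Induction on the dimension: \<open>peel_exists\<close> splits a line off both
  filtrations, and the rest is carried by the kernel of g. The last two conditions say that each
  step is spanned by the basis vectors of sufficient weight.\<close>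

lemma adapted_basis_exists:
  assumes "filtration_on W F" "filtration_on W G" "dim W = n"
  shows "\<exists>v P Q. (\<forall>x. x \<in> W \<longleftrightarrow> (\<exists>c. x = (\<Sum>a<n. c a *s v a))) \<and>
    (\<forall>c. (\<Sum>a<n. c a *s v a) = 0 \<longrightarrow> (\<forall>a<n. c a = 0)) \<and>
    (\<forall>c m. (\<Sum>a<n. c a *s v a) \<in> F m \<longleftrightarrow> (\<forall>a<n. c a \<noteq> 0 \<longrightarrow> m \<le> P a)) \<and>
    (\<forall>c m. (\<Sum>a<n. c a *s v a) \<in> G m \<longleftrightarrow> (\<forall>a<n. c a \<noteq> 0 \<longrightarrow> m \<le> Q a))"
  using assms
proof (induction n arbitrary: W F G)
  case 0
  have "W = {0}" using dim_eq_0[of W] 0 subspace_0[OF filtration_onD(5)[OF 0(1)]] by auto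
  then show ?case using filtration_onD(4)[OF 0(1)] filtration_onD(4)[OF 0(2)] by simp
next
  case (Suc n)
  have "W \<noteq> {0}" using Suc.prems(3) by auto
  then obtain v g p q where v: "v \<in> W" and g: "Vector_Spaces.linear scale (*) g" "g v = 1"
    and pF: "peels v g p F" and qG: "peels v g q G"
    using peel_exists[OF Suc.prems(1,2)] by blast
  interpret g: Vector_Spaces.linear scale "(*)" g by fact
  let ?K = "{x. g x = 0}"
  have W: "subspace W" using filtration_onD(5)[OF Suc.prems(1)] .
  have "dim (W \<inter> ?K) = n"
    using dim_kernel[OF W g(1) v g(2)] Suc.prems(3) by simp
  from Suc.IH[OF filtration_on_kernel[OF Suc.prems(1) g(1)] filtration_on_kernel[OF Suc.prems(2) g(1)] this]
  obtain u P Q where u0: "\<forall>x. x \<in> W \<inter> ?K \<longleftrightarrow> (\<exists>c. x = (\<Sum>a<n. c a *s u a))"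
    "\<forall>c. (\<Sum>a<n. c a *s u a) = 0 \<longrightarrow> (\<forall>a<n. c a = 0)"
    "\<forall>c m. (\<Sum>a<n. c a *s u a) \<in> F m \<inter> ?K \<longleftrightarrow> (\<forall>a<n. c a \<noteq> 0 \<longrightarrow> m \<le> P a)"
    "\<forall>c m. (\<Sum>a<n. c a *s u a) \<in> G m \<inter> ?K \<longleftrightarrow> (\<forall>a<n. c a \<noteq> 0 \<longrightarrow> m \<le> Q a)"
    by (elim exE conjE)
  note u = u0(1)[THEN spec] u0(2)[THEN spec, THEN mp] u0(3)[THEN spec, THEN spec] u0(4)[THEN spec, THEN spec]
  define v' where "v' = u(n := v)"
  define P' where "P' = P(n := p)"
  define Q' where "Q' = Q(n := q)"
  have sum: "(\<Sum>a<Suc n. c a *s v' a) = (\<Sum>a<n. c a *s u a) + c n *s v" for c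
    by (simp add: v'_def)
  have gK: "(\<Sum>a<n. c a *s u a) \<in> W \<inter> ?K" for c using u(1) by blast
  have gsum: "g (\<Sum>a<Suc n. c a *s v' a) = c n" for c
    unfolding sum using gK[of c] g(2) by (simp add: g.add g.scale)
  have rest: "(\<Sum>a<Suc n. c a *s v' a) - c n *s v = (\<Sum>a<n. c a *s u a)" for c
    unfolding sum by simp
  have all: "(\<forall>a<Suc n. R a) \<longleftrightarrow> (\<forall>a<n. R a) \<and> R n" for R
    using less_Suc_eq by auto
  show ?case
  proof (rule exI[of _ v'], rule exI[of _ P'], rule exI[of _ Q'], intro conjI allI)
    fix x
    show "x \<in> W \<longleftrightarrow> (\<exists>c. x = (\<Sum>a<Suc n. c a *s v' a))"
    proof
      assume x: "x \<in> W"
      then have "x - g x *s v \<in> W \<inter> ?K"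
        using W v g(2) by (simp add: subspace_diff subspace_scale g.diff g.scale)
      then obtain c where c: "x - g x *s v = (\<Sum>a<n. c a *s u a)" using u(1) by blast
      have "x = (\<Sum>a<Suc n. (c(n := g x)) a *s v' a)"
        unfolding sum using c by (simp add: algebra_simps)
      then show "\<exists>c. x = (\<Sum>a<Suc n. c a *s v' a)" by blast
    next
      assume "\<exists>c. x = (\<Sum>a<Suc n. c a *s v' a)"
      then show "x \<in> W" unfolding sum using gK W v by (auto intro!: subspace_add subspace_scale)
    qed
  next
    fix c
    show "(\<Sum>a<Suc n. c a *s v' a) = 0 \<longrightarrow> (\<forall>a<Suc n. c a = 0)"
    proof
      assume z: "(\<Sum>a<Suc n. c a *s v' a) = 0"
      have "c n = 0" using gsum[of c] z g.zero by simp
      moreover from this have "(\<Sum>a<n. c a *s u a) = 0" using rest[of c] z by simp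
      ultimately show "\<forall>a<Suc n. c a = 0" using u(2)[of c] unfolding all by simp
    qed
  next
    fix c m
    have "(\<Sum>a<Suc n. c a *s v' a) \<in> F m \<longleftrightarrow> (c n \<noteq> 0 \<longrightarrow> m \<le> p) \<and> (\<Sum>a<n. c a *s u a) \<in> F m"
      using pF[unfolded peels_def, rule_format, of "\<Sum>a<Suc n. c a *s v' a" m] unfolding gsum rest .
    also have "(\<Sum>a<n. c a *s u a) \<in> F m \<longleftrightarrow> (\<forall>a<n. c a \<noteq> 0 \<longrightarrow> m \<le> P a)"
      using u(3)[of c m] gK[of c] by simp
    finally show "(\<Sum>a<Suc n. c a *s v' a) \<in> F m \<longleftrightarrow> (\<forall>a<Suc n. c a \<noteq> 0 \<longrightarrow> m \<le> P' a)"
      unfolding all by (auto simp: P'_def)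
    have "(\<Sum>a<Suc n. c a *s v' a) \<in> G m \<longleftrightarrow> (c n \<noteq> 0 \<longrightarrow> m \<le> q) \<and> (\<Sum>a<n. c a *s u a) \<in> G m"
      using qG[unfolded peels_def, rule_format, of "\<Sum>a<Suc n. c a *s v' a" m] unfolding gsum rest .
    also have "(\<Sum>a<n. c a *s u a) \<in> G m \<longleftrightarrow> (\<forall>a<n. c a \<noteq> 0 \<longrightarrow> m \<le> Q a)"
      using u(4)[of c m] gK[of c] by simp
    finally show "(\<Sum>a<Suc n. c a *s v' a) \<in> G m \<longleftrightarrow> (\<forall>a<Suc n. c a \<noteq> 0 \<longrightarrow> m \<le> Q' a)"
      unfolding all by (auto simp: Q'_def)
  qed
qed

text \<open>Each chart gets its own basis, adapted to the two filtrations that it sees. Bases of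
  different charts are related only by a change of basis that respects the filtration common to
  both, and this is just enough for regular transition matrices.\<close>

lemma rees_sections_exist:
  assumes F: "\<And>i. i < 3 \<Longrightarrow> filtration_on W (F i)"
  shows "\<exists>E. sections_of scale (\<lambda>k. graded (rees_piece F k)) E"
proof -
  define n where "n = dim W"
  define adapted where "adapted k v w \<longleftrightarrow> (\<forall>x. x \<in> W \<longleftrightarrow> (\<exists>c. x = (\<Sum>a<n. c a *s v a))) \<and>
    (\<forall>c. (\<Sum>a<n. c a *s v a) = 0 \<longrightarrow> (\<forall>a<n. c a = 0)) \<and>
    (\<forall>i\<in>{0,1,2}-{k}. \<forall>c m. (\<Sum>a<n. c a *s v a) \<in> F i m \<longleftrightarrow> (\<forall>a<n. c a \<noteq> 0 \<longrightarrow> m \<le> w i a))"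
    for k :: nat and v and w :: "nat \<Rightarrow> nat \<Rightarrow> int"
  have "\<exists>v w. adapted k v w" if "k < 3" for k :: nat
  proof -
    obtain i j :: nat where ij: "{0, 1, 2} - {k} = {i, j}" "i \<noteq> j" "i < 3" "j < 3"
    proof -
      have "{0, 1, 2} - {k} = (if k = 0 then {1, 2} else if k = 1 then {0, 2} else {0, 1})"
        using \<open>k < 3\<close> by auto
      then show ?thesis using that[of 1 2] that[of 0 2] that[of 0 1]
        by (auto split: if_splits)
    qed
    obtain v P Q where v: "\<forall>x. x \<in> W \<longleftrightarrow> (\<exists>c. x = (\<Sum>a<n. c a *s v a))"
      "\<forall>c. (\<Sum>a<n. c a *s v a) = 0 \<longrightarrow> (\<forall>a<n. c a = 0)"
      "\<forall>c m. (\<Sum>a<n. c a *s v a) \<in> F i m \<longleftrightarrow> (\<forall>a<n. c a \<noteq> 0 \<longrightarrow> m \<le> P a)"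
      "\<forall>c m. (\<Sum>a<n. c a *s v a) \<in> F j m \<longleftrightarrow> (\<forall>a<n. c a \<noteq> 0 \<longrightarrow> m \<le> Q a)"
      using adapted_basis_exists[OF F[OF ij(3)] F[OF ij(4)] n_def[symmetric]] by (elim exE conjE)
    show ?thesis
      unfolding adapted_def ij(1)
      by (rule exI[of _ v], rule exI[of _ "\<lambda>i'. if i' = i then P else Q"]) (use v ij(2) in simp)
  qed
  then obtain v w where vw: "\<And>k. k < 3 \<Longrightarrow> adapted k (v k) (w k)"
    by metis
  have W: "x \<in> W \<longleftrightarrow> (\<exists>c. x = (\<Sum>a<n. c a *s v k a))" if "k < 3" for k x
    using vw[OF that] unfolding adapted_def by (elim conjE) (erule spec)
  have indep: "\<forall>a<n. c a = 0" if "k < 3" "(\<Sum>a<n. c a *s v k a) = 0" for k c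
    using vw[OF that(1)] that(2) unfolding adapted_def by (elim conjE) simp
  have wt: "(\<Sum>a<n. c a *s v k a) \<in> F i m \<longleftrightarrow> (\<forall>a<n. c a \<noteq> 0 \<longrightarrow> m \<le> w k i a)"
    if "k < 3" "i \<in> {0,1,2} - {k}" for k i c m
    using vw[OF that(1)] that(2) unfolding adapted_def
    by (elim conjE) (drule (1) bspec, drule spec, erule spec)
  \<comment> \<open>The index whose exponent in u_i is \<open>- w k i a\<close> for both i other
    than k; the exponent of u_k is then forced by degree 0.\<close>
  define d where "d k a = (if k = 0 then (- w k 1 a, - w k 2 a)
      else if k = 1 then (w k 0 a + w k 2 a, - w k 2 a) else (- w k 1 a, w k 0 a + w k 1 a))" for k a
  have d: "hom_exp i (d k a) = - w k i a" if "k < 3" "i \<in> {0,1,2} - {k}" for k i a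
    using that by (auto simp: d_def hom_exp_def)
  have vW: "v k a \<in> W" if "k < 3" "a < n" for k a
  proof -
    have "v k a = (\<Sum>b<n. (if b = a then 1 else 0) *s v k b)"
      using that(2) by (simp add: if_distrib[of "\<lambda>x. x *s _"] cong: if_cong)
    then show ?thesis unfolding W[OF that(1)] by (rule exI[of _ "\<lambda>b. if b = a then 1 else 0"])
  qed
  have ex_t: "\<exists>t. v l c = (\<Sum>a<n. t a *s v k a)" if "k < 3" "l < 3" "c < n" for k l c
    using vW[OF that(2,3)] unfolding W[OF that(1)] .
  define t where "t k l c = (SOME t. v l c = (\<Sum>a<n. t a *s v k a))" for k l c
  have t: "v l c = (\<Sum>a<n. t k l c a *s v k a)" if "k < 3" "l < 3" "c < n" for k l c
    unfolding t_def by (rule someI_ex[OF ex_t[OF that]])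
  have "sections_of scale (\<lambda>k. graded (rees_piece F k)) (n, monomial_transition n d (\<lambda>k l a c. t k l c a))"
  proof (rule sections_of_homogeneous)
    show "\<forall>a<n. c a = 0" if "k < 3" "(\<Sum>a<n. c a *s v k a) = 0" for k c using indep[OF that] .
    show "v l c = (\<Sum>a<n. t k l c a *s v k a)" if "k < 3" "l < 3" "c < n" for k l c using t[OF that] .
  next
    fix k :: nat and e x assume k: "k < 3"
    obtain i where i: "i \<in> {0,1,2} - {k}" "i < 3" using that[of 1] that[of 0] by (cases "k = 0") auto
    have sub: "rees_piece F k e \<subseteq> W"
      using filtration_onD(3)[OF F[OF i(2)]] i(1) unfolding rees_piece_def by blast
    have mem: "(\<Sum>a<n. c a *s v k a) \<in> rees_piece F k e \<longleftrightarrow>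
      (\<forall>a<n. c a \<noteq> 0 \<longrightarrow> (\<forall>i\<in>{0, 1, 2} - {k}. hom_exp i (e - d k a) \<ge> 0))" for c
    proof -
      have "(\<Sum>a<n. c a *s v k a) \<in> rees_piece F k e \<longleftrightarrow>
        (\<forall>i\<in>{0,1,2}-{k}. \<forall>a<n. c a \<noteq> 0 \<longrightarrow> - hom_exp i e \<le> w k i a)"
        unfolding rees_piece_def using wt[OF k] by simp
      also have "\<dots> \<longleftrightarrow> (\<forall>i\<in>{0,1,2}-{k}. \<forall>a<n. c a \<noteq> 0 \<longrightarrow> hom_exp i (e - d k a) \<ge> 0)"
      proof -
        have "- y \<le> z \<longleftrightarrow> 0 \<le> y + z" for y z :: int by linarith
        then show ?thesis using d[OF k] by (intro ball_cong refl) (simp add: hom_exp_diff)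
      qed
      finally show ?thesis by blast
    qed
    show "x \<in> rees_piece F k e \<longleftrightarrow> (\<exists>c. x = (\<Sum>a<n. c a *s v k a) \<and>
      (\<forall>a<n. c a \<noteq> 0 \<longrightarrow> (\<forall>i\<in>{0, 1, 2} - {k}. hom_exp i (e - d k a) \<ge> 0)))"
    proof
      assume x: "x \<in> rees_piece F k e"
      then have "x \<in> W" using sub by blast
      then obtain c where "x = (\<Sum>a<n. c a *s v k a)" unfolding W[OF k] by (elim exE)
      with x mem show "\<exists>c. x = (\<Sum>a<n. c a *s v k a) \<and>
        (\<forall>a<n. c a \<noteq> 0 \<longrightarrow> (\<forall>i\<in>{0, 1, 2} - {k}. hom_exp i (e - d k a) \<ge> 0))"
        by (intro exI[of _ c]) simp
    next
      assume "\<exists>c. x = (\<Sum>a<n. c a *s v k a) \<and>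
        (\<forall>a<n. c a \<noteq> 0 \<longrightarrow> (\<forall>i\<in>{0, 1, 2} - {k}. hom_exp i (e - d k a) \<ge> 0))"
      then obtain c where "x = (\<Sum>a<n. c a *s v k a)"
        "\<forall>a<n. c a \<noteq> 0 \<longrightarrow> (\<forall>i\<in>{0, 1, 2} - {k}. hom_exp i (e - d k a) \<ge> 0)"
        by (elim exE conjE)
      with mem show "x \<in> rees_piece F k e" by simp
    qed
  next
    fix k l a c i :: nat
    assume kl: "k < 3" "l < 3" and ac: "a < n" "c < n" and t0: "t k l c a \<noteq> 0" and i: "i \<in> {0, 1, 2} - {k, l}"
    \<comment> \<open>Both charts see the filtration \<open>F i\<close>. A vector of weight w
      expands over basis vectors of weight at least w, so no pole along u_i = 0 arises where the
      coefficient is nonzero.\<close>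
    have ik: "i \<in> {0,1,2} - {k}" "i \<in> {0,1,2} - {l}" using i by auto
    have "v l c = (\<Sum>b<n. (if b = c then 1 else 0) *s v l b)"
      using ac(2) by (simp add: if_distrib[of "\<lambda>x. x *s _"] cong: if_cong)
    then have "v l c \<in> F i (w l i c)" using wt[OF kl(2) ik(2), of "\<lambda>b. if b = c then 1 else 0"] by simp
    then have "w l i c \<le> w k i a"
      using t[OF kl ac(2)] wt[OF kl(1) ik(1), of "t k l c"] ac(1) t0 by metis
    then show "hom_exp i (d l c - d k a) \<ge> 0"
      using d[OF kl(1) ik(1)] d[OF kl(2) ik(2)] by (simp add: hom_exp_diff)
  qed
  then show ?thesis by blast
qed

end

section \<open>Exact sequences of Rees bundles\<close>

definition rees_chern ::
    "(complex \<Rightarrow> 'v \<Rightarrow> 'v::ab_group_add) \<Rightarrow> (nat \<Rightarrow> int \<Rightarrow> 'v set) \<Rightarrow> coh_P2" where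
  "rees_chern s F = sheaf_chern_character s (\<lambda>k. graded (rees_piece F k))"

definition line_chern :: "int \<Rightarrow> coh_P2" where
  "line_chern d = Coh 1 (of_int d) (of_int (d\<^sup>2) / 2)"

lemma chern_character_line_bundle: "chern_character (line_bundle d) = line_chern d"
  using chern_character_exists unfolding is_chern_character_def line_chern_def chern_line_value by blast

lemma chart_pairs:
  assumes "k < (3::nat)"
  obtains i j where "(i, j) \<in> {(0::nat, 1::nat), (0, 2), (1, 2)}" "{0, 1, 2} - {k} = {i, j}"
proof -
  have "{0, 1, 2} - {k} = (if k = 0 then {1, 2} else if k = 1 then {0, 2} else {0, 1})"
    using assms by auto
  then show ?thesis using that[of 1 2] that[of 0 2] that[of 0 1] by (auto split: if_splits)
qed

text \<open>A chart omits one index, so its pieces are intersections of steps of two filtrations.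
  Nothing is asked about intersections of all three.\<close>

lemma rees_chern_additive:
  assumes fs: "finite_complex_space s1 B1" "finite_complex_space s2 B2" "finite_complex_space s3 B3"
    and lin: "Vector_Spaces.linear s1 s2 f" "Vector_Spaces.linear s2 s3 h"
    and F1: "\<And>i. i < 3 \<Longrightarrow> complex_space.filtration_on s1 W1 (F1 i)"
    and F2: "\<And>i. i < 3 \<Longrightarrow> complex_space.filtration_on s2 W2 (F2 i)"
    and F3: "\<And>i. i < 3 \<Longrightarrow> complex_space.filtration_on s3 W3 (F3 i)"
    and inj: "inj_on f W1"
    and ker: "\<And>i j m l. (i, j) \<in> {(0, 1), (0, 2), (1, 2)} \<Longrightarrow>
      f ` (F1 i m \<inter> F1 j l) = {y \<in> F2 i m \<inter> F2 j l. h y = 0}"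
    and surj: "\<And>i j m l. (i, j) \<in> {(0, 1), (0, 2), (1, 2)} \<Longrightarrow>
      h ` (F2 i m \<inter> F2 j l) = F3 i m \<inter> F3 j l"
  shows "rees_chern s2 F2 = rees_chern s1 F1 + rees_chern s3 F3"
proof -
  interpret s1: finite_complex_space s1 B1 by fact
  interpret s2: finite_complex_space s2 B2 by fact
  interpret s3: finite_complex_space s3 B3 by fact
  have piece: "\<exists>i j m l. (i, j) \<in> {(0, 1), (0, 2), (1, 2)} \<and> i < 3 \<and> rees_piece F1 k e = F1 i m \<inter> F1 j l \<and>
      rees_piece F2 k e = F2 i m \<inter> F2 j l \<and> rees_piece F3 k e = F3 i m \<inter> F3 j l" if "k < 3" for k e
  proof -
    obtain i j where ij: "(i, j) \<in> {(0::nat, 1::nat), (0, 2), (1, 2)}" "{0, 1, 2} - {k} = {i, j}"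
      using chart_pairs[OF \<open>k < 3\<close>] .
    have i3: "i < 3" using ij(1) by auto
    show ?thesis
      by (rule exI[of _ i], rule exI[of _ j], rule exI[of _ "- hom_exp i e"], rule exI[of _ "- hom_exp j e"])
        (use ij i3 in \<open>auto simp: rees_piece_def\<close>)
  qed
  obtain E1 where E1: "sections_of s1 (\<lambda>k. graded (rees_piece F1 k)) E1"
    using s1.rees_sections_exist[of W1 F1, OF F1] by blast
  obtain E2 where E2: "sections_of s2 (\<lambda>k. graded (rees_piece F2 k)) E2"
    using s2.rees_sections_exist[of W2 F2, OF F2] by blast
  obtain E3 where E3: "sections_of s3 (\<lambda>k. graded (rees_piece F3 k)) E3"
    using s3.rees_sections_exist[of W3 F3, OF F3] by blast
  have z1: "0 \<in> rees_piece F1 k e" for k e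
    using s1.filtration_onD(4)[OF F1] by (auto simp: rees_piece_def)
  have z2: "0 \<in> rees_piece F2 k e" for k e
    using s2.filtration_onD(4)[OF F2] by (auto simp: rees_piece_def)
  have z3: "0 \<in> rees_piece F3 k e" for k e
    using s3.filtration_onD(4)[OF F3] by (auto simp: rees_piece_def)
  have "chern_character E2 = chern_character E1 + chern_character E3"
  proof (rule chern_short_exact_graded[OF _ _ _ lin _ _ _ _ _ E1 E2 E3])
    show "complex_space s1" "complex_space s2" "complex_space s3" by unfold_locales
    fix k :: nat and e assume k: "k < 3"
    show "0 \<in> rees_piece F1 k e" "0 \<in> rees_piece F2 k e" by (rule z1 z2)+
    obtain i j m l where p: "(i, j) \<in> {(0, 1), (0, 2), (1, 2)}" "i < 3"
      "rees_piece F1 k e = F1 i m \<inter> F1 j l" "rees_piece F2 k e = F2 i m \<inter> F2 j l"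
      "rees_piece F3 k e = F3 i m \<inter> F3 j l"
      using piece[OF k, of e] by (elim exE conjE)
    show "inj_on f (rees_piece F1 k e)"
      unfolding p(3) using s1.filtration_onD(3)[OF F1[OF p(2)]] by (intro inj_on_subset[OF inj]) blast
    show "f ` rees_piece F1 k e = {y \<in> rees_piece F2 k e. h y = 0}"
      unfolding p(3,4) by (rule ker[OF p(1)])
    show "h ` rees_piece F2 k e = rees_piece F3 k e"
      unfolding p(4,5) by (rule surj[OF p(1)])
  qed
  then show ?thesis
    unfolding rees_chern_def using s1.sheaf_chern_character_eq[OF E1 z1]
      s2.sheaf_chern_character_eq[OF E2 z2] s3.sheaf_chern_character_eq[OF E3 z3] by simp
qed

section \<open>Rees bundles of one-dimensional spaces\<close>

definition line_filtration :: "int \<Rightarrow> int \<Rightarrow> complex set" where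
  "line_filtration r m = {c. c \<noteq> 0 \<longrightarrow> m \<le> r}"

lemma scalars_finite_space: "finite_complex_space ((*) :: complex \<Rightarrow> complex \<Rightarrow> complex) {1}"
proof -
  interpret complex_space "(*) :: complex \<Rightarrow> complex \<Rightarrow> complex"
    by unfold_locales (auto simp: algebra_simps)
  show ?thesis
    by unfold_locales (auto simp: span_singleton)
qed

interpretation scalars: finite_complex_space "(*) :: complex \<Rightarrow> complex \<Rightarrow> complex" "{1}"
  by (rule scalars_finite_space)

lemma line_filtration: "scalars.filtration_on UNIV (line_filtration r)"
  unfolding scalars.filtration_on_def
proof (intro conjI allI)
  show "\<exists>p. line_filtration r p = UNIV" by (rule exI[of _ r]) (auto simp: line_filtration_def)
  show "\<exists>q. line_filtration r q = {0}" by (rule exI[of _ "r + 1"]) (auto simp: line_filtration_def)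
  show "antimono (line_filtration r)" by (auto simp: antimono_def line_filtration_def)
qed (auto simp: line_filtration_def scalars.subspace_def)

lemma rees_chern_line:
  assumes "\<And>i. i < 3 \<Longrightarrow> F i = line_filtration (w i)"
  shows "rees_chern (*) F = line_chern (w 0 + w 1 + w 2)"
proof -
  define D where "D = w 0 + w 1 + w 2"
  \<comment> \<open>The frame over U_k is u_k^D divided by the product of the
    u_i^(\<open>w i\<close>). The product is the same for all charts, so the transition functions
    are those of the line bundle of degree D.\<close>
  define d :: "nat \<Rightarrow> nat \<Rightarrow> int \<times> int" where
    "d k a = (D * fst (monomial_index k) - w 1, D * snd (monomial_index k) - w 2)" for k a
  have dw: "hom_exp i (d k a) = - w i" if "k < 3" "i \<in> {0, 1, 2} - {k}" for k i a
    using that by (auto simp: d_def hom_exp_def monomial_index_def D_def)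
  have piece: "x \<in> rees_piece F k e \<longleftrightarrow>
      (x \<noteq> 0 \<longrightarrow> (\<forall>i\<in>{0, 1, 2} - {k}. hom_exp i (e - d k a) \<ge> 0))" if k: "k < 3" for k e x a
  proof -
    have "x \<in> rees_piece F k e \<longleftrightarrow> (\<forall>i\<in>{0,1,2}-{k}. x \<noteq> 0 \<longrightarrow> - hom_exp i e \<le> w i)"
    proof -
      have "x \<in> F i m \<longleftrightarrow> (x \<noteq> 0 \<longrightarrow> m \<le> w i)" if "i \<in> {0,1,2} - {k}" for i m
        using assms[of i] that by (auto simp: line_filtration_def)
      then show ?thesis unfolding rees_piece_def by (simp only: mem_Collect_eq cong: ball_cong)
    qed
    also have "\<dots> \<longleftrightarrow> (\<forall>i\<in>{0,1,2}-{k}. x \<noteq> 0 \<longrightarrow> hom_exp i (e - d k a) \<ge> 0)"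
    proof (rule ball_cong[OF refl])
      fix i :: nat assume i: "i \<in> {0,1,2} - {k}"
      show "(x \<noteq> 0 \<longrightarrow> - hom_exp i e \<le> w i) \<longleftrightarrow> (x \<noteq> 0 \<longrightarrow> hom_exp i (e - d k a) \<ge> 0)"
        using dw[OF k i, of a] by (auto simp: hom_exp_diff)
    qed
    finally show ?thesis by blast
  qed
  have sec: "sections_of (*) (\<lambda>k. graded (rees_piece F k))
      (1, scalars.monomial_transition 1 d (\<lambda>k l a c. 1))"
  proof (rule scalars.sections_of_homogeneous[where v = "\<lambda>k a. 1"])
    show "x \<in> rees_piece F k e \<longleftrightarrow> (\<exists>c. x = (\<Sum>a<1. c a * 1) \<and>
        (\<forall>a<1. c a \<noteq> 0 \<longrightarrow> (\<forall>i\<in>{0, 1, 2} - {k}. hom_exp i (e - d k a) \<ge> 0)))" if "k < 3" for k e x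
    proof
      assume "x \<in> rees_piece F k e"
      then show "\<exists>c. x = (\<Sum>a<1. c a * 1) \<and>
        (\<forall>a<1. c a \<noteq> 0 \<longrightarrow> (\<forall>i\<in>{0, 1, 2} - {k}. hom_exp i (e - d k a) \<ge> 0))"
        unfolding piece[OF that, of x e 0] by (intro exI[of _ "\<lambda>_. x"]) simp
    next
      assume "\<exists>c. x = (\<Sum>a<1. c a * 1) \<and>
        (\<forall>a<1. c a \<noteq> 0 \<longrightarrow> (\<forall>i\<in>{0, 1, 2} - {k}. hom_exp i (e - d k a) \<ge> 0))"
      then show "x \<in> rees_piece F k e" unfolding piece[OF that, of x e 0] by auto
    qed
    show "hom_exp i (d l c - d k a) \<ge> 0"
      if "k < 3" "l < 3" "i \<in> {0, 1, 2} - {k, l}" for k l a c i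
      using dw[of k i a] dw[of l i c] that by (simp add: hom_exp_diff)
  qed auto
  have "(1, scalars.monomial_transition 1 d (\<lambda>k l a c. 1)) = line_bundle D"
    unfolding line_bundle_def scalars.monomial_transition_def ratio_power_def d_def Let_def
    by (auto simp: fun_eq_iff algebra_simps split: prod.splits intro!: cong_mat)
  moreover have "0 \<in> rees_piece F k e" if "k < 3" for k e using piece[OF that, of 0 e] by simp
  ultimately have "rees_chern (*) F = chern_character (line_bundle D)"
    unfolding rees_chern_def using scalars.sheaf_chern_character_eq[OF sec] by simp
  then show ?thesis by (simp add: chern_character_line_bundle D_def)
qed

context finite_complex_space
begin

text \<open>The functional g maps \<open>W\<close> onto a line placed in the degrees
  \<open>w i\<close>. Multiples of v lift this line on every pairwise intersection, since v lies in
  \<open>F i (w i)\<close> for each i.\<close>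

lemma rees_chern_peel:
  assumes F: "\<And>i. i < 3 \<Longrightarrow> filtration_on W (F i)"
    and v: "v \<in> W" and g: "Vector_Spaces.linear scale (*) g" "g v = 1"
    and peel: "\<And>i. i < 3 \<Longrightarrow> peels v g (w i) (F i)"
  shows "rees_chern scale F =
    rees_chern scale (\<lambda>i m. F i m \<inter> {x. g x = 0}) + line_chern (w 0 + w 1 + w 2)"
proof -
  interpret g: Vector_Spaces.linear scale "(*)" g by fact
  have fs: "finite_complex_space scale B" ..
  have lin_id: "Vector_Spaces.linear scale scale (\<lambda>x. x)" by unfold_locales auto
  have in_line: "g x \<in> line_filtration (w i) m" if "i < 3" "x \<in> F i m" for i m x
    using peel[OF that(1)] that(2) unfolding peels_def line_filtration_def by blast
  have from_line: "c *s v \<in> F i m" if "i < 3" "c \<in> line_filtration (w i) m" for i m c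
    using peel[OF that(1), unfolded peels_def, rule_format, of "c *s v" m] that(2)
      filtration_onD(4)[OF F[OF that(1)]] g(2)
    by (simp add: line_filtration_def g.scale)
  have "rees_chern scale F = rees_chern scale (\<lambda>i m. F i m \<inter> {x. g x = 0}) +
      rees_chern (*) (\<lambda>i. line_filtration (w i))"
  proof (rule rees_chern_additive[OF fs fs scalars_finite_space lin_id g(1) _ F])
    show "filtration_on (W \<inter> {x. g x = 0}) (\<lambda>m. F i m \<inter> {x. g x = 0})" if "i < 3" for i
      by (rule filtration_on_kernel[OF F[OF that] g(1)])
    show "scalars.filtration_on UNIV (line_filtration (w i))" for i by (rule line_filtration)
    fix i j :: nat and m l :: int assume "(i, j) \<in> {(0, 1), (0, 2), (1, 2)}"
    then have ij: "i < 3" "j < 3" by auto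
    show "(\<lambda>x. x) ` (F i m \<inter> {x. g x = 0} \<inter> (F j l \<inter> {x. g x = 0})) = {y \<in> F i m \<inter> F j l. g y = 0}"
      by auto
    show "g ` (F i m \<inter> F j l) = line_filtration (w i) m \<inter> line_filtration (w j) l"
    proof (intro equalityI subsetI)
      fix c assume "c \<in> line_filtration (w i) m \<inter> line_filtration (w j) l"
      then have "c *s v \<in> F i m \<inter> F j l" using from_line ij by blast
      moreover have "g (c *s v) = c" using g(2) by (simp add: g.scale)
      ultimately show "c \<in> g ` (F i m \<inter> F j l)" by (metis imageI)
    qed (use in_line ij in blast)
  qed auto
  then show ?thesis using rees_chern_line[of "\<lambda>i. line_filtration (w i)" w] by simp
qed

text \<open>All pieces vanish, so identity maps form an exact sequence, and the value x satisfies x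
  = x + x.\<close>

lemma rees_chern_zero:
  assumes "\<And>i m. i < 3 \<Longrightarrow> F i m = {0}"
  shows "rees_chern scale F = 0"
proof -
  have fs: "finite_complex_space scale B" ..
  have lin: "Vector_Spaces.linear scale scale (\<lambda>x. x)" by unfold_locales auto
  have F: "filtration_on {0} (F i)" if "i < 3" for i
    using assms[OF that] by (auto simp: filtration_on_def antimono_def)
  have "rees_chern scale F = rees_chern scale F + rees_chern scale F"
    by (rule rees_chern_additive[OF fs fs fs lin lin F F F]) (use assms in auto)
  then show ?thesis by simp
qed

end

section \<open>Elementary modifications of the first filtration\<close>

definition prod_scale ::
    "(complex \<Rightarrow> 'v \<Rightarrow> 'v) \<Rightarrow> complex \<Rightarrow> 'v \<times> complex \<Rightarrow> 'v \<times> complex" where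
  "prod_scale s c x = (s c (fst x), c * snd x)"

context finite_complex_space
begin

lemma prod_scale_finite_space:
  "finite_complex_space (prod_scale scale) (insert (0, 1) ((\<lambda>b. (b, 0)) ` B))"
proof -
  interpret P: complex_space "prod_scale scale"
    by unfold_locales
      (simp_all add: prod_scale_def scale_right_distrib scale_left_distrib distrib_left distrib_right)
  interpret emb: Vector_Spaces.linear scale "prod_scale scale" "\<lambda>y. (y, 0)"
    by unfold_locales (auto simp: prod_scale_def)
  interpret pair: vector_space_pair scale "prod_scale scale" ..
  have span: "P.span ((\<lambda>b. (b, 0)) ` B) = range (\<lambda>y. (y, 0))"
    using emb.span_image[of B] span_Basis by simp
  show ?thesis
  proof unfold_locales
    show "finite (insert (0, 1) ((\<lambda>b. (b, 0)) ` B))" using finite_Basis by simp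
    have "P.independent ((\<lambda>b. (b, 0)) ` B)"
      using pair.linear_independent_injective_image[OF emb.linear_axioms independent_Basis]
      by (simp add: inj_on_def)
    moreover have "(0, 1) \<notin> P.span ((\<lambda>b. (b, 0)) ` B)"
      unfolding span by auto
    ultimately show "P.independent (insert (0, 1) ((\<lambda>b. (b, 0)) ` B))"
      by (intro P.independent_insertI)
    show "P.span (insert (0, 1) ((\<lambda>b. (b, 0)) ` B)) = UNIV"
    proof -
      have "x \<in> P.span (insert (0, 1) ((\<lambda>b. (b, 0)) ` B))" for x
        unfolding P.span_insert span
        by (cases x) (auto simp: prod_scale_def intro!: exI[of _ "snd x"])
      then show ?thesis by blast
    qed
  qed
qed

text \<open>The filtration of \<open>V \<oplus> \<complex>\<close> generated by \<open>F\<close> and the vector \<open>(z, 1)\<close> in degree \<open>w\<close>.\<close>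

definition extend_filtration :: "'b \<Rightarrow> int \<Rightarrow> (int \<Rightarrow> 'b set) \<Rightarrow> int \<Rightarrow> ('b \<times> complex) set" where
  "extend_filtration z w F m = {(y, c). y - c *s z \<in> F m \<and> (c \<noteq> 0 \<longrightarrow> m \<le> w)}"

lemma extend_filtration:
  assumes F: "filtration_on UNIV F"
  shows "complex_space.filtration_on (prod_scale scale) UNIV (extend_filtration z w F)"
proof -
  interpret P: finite_complex_space "prod_scale scale" "insert (0, 1) ((\<lambda>b. (b, 0)) ` B)"
    by (rule prod_scale_finite_space)
  obtain a b where ab: "F a = UNIV" "F b = {0}" using F unfolding filtration_on_def by blast
  note FD = filtration_onD[OF F]
  show ?thesis
    unfolding P.filtration_on_def
  proof (intro conjI allI)
    fix m
    show "P.subspace (extend_filtration z w F m)"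
      unfolding P.subspace_def
    proof (intro conjI ballI allI)
      show "0 \<in> extend_filtration z w F m"
        using FD(4) by (simp add: extend_filtration_def zero_prod_def)
      fix x y assume "x \<in> extend_filtration z w F m" "y \<in> extend_filtration z w F m"
      then obtain x1 x2 y1 y2 where xy: "x = (x1, x2)" "y = (y1, y2)" "x1 - x2 *s z \<in> F m" "x2 \<noteq> 0 \<longrightarrow> m \<le> w"
        "y1 - y2 *s z \<in> F m" "y2 \<noteq> 0 \<longrightarrow> m \<le> w"
        unfolding extend_filtration_def by blast
      have "(x1 - x2 *s z) + (y1 - y2 *s z) \<in> F m" using FD(1) xy by (simp add: subspace_add)
      then have "x1 + y1 - (x2 + y2) *s z \<in> F m" by (simp add: algebra_simps)
      moreover have "x2 + y2 \<noteq> 0 \<longrightarrow> m \<le> w" using xy(4,6) by auto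
      ultimately show "x + y \<in> extend_filtration z w F m"
        by (simp add: xy extend_filtration_def)
    next
      fix c x assume "x \<in> extend_filtration z w F m"
      then obtain x1 x2 where x: "x = (x1, x2)" "x1 - x2 *s z \<in> F m" "x2 \<noteq> 0 \<longrightarrow> m \<le> w"
        unfolding extend_filtration_def by blast
      have "c *s (x1 - x2 *s z) \<in> F m" using FD(1) x by (simp add: subspace_scale)
      then show "prod_scale scale c x \<in> extend_filtration z w F m"
        using x by (simp add: extend_filtration_def prod_scale_def scale_right_diff_distrib)
    qed
    show "extend_filtration z w F m \<subseteq> UNIV" by simp
  next
    show "antimono (extend_filtration z w F)"
      using FD(2) by (auto simp: antimono_def extend_filtration_def)
    have "extend_filtration z w F (min a w) = UNIV"
      using FD(2)[of "min a w" a] ab(1) by (auto simp: extend_filtration_def)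
    then show "\<exists>p. extend_filtration z w F p = UNIV" by blast
    \<comment> \<open>At this index F has reached 0 and the added vector has been dropped.\<close>
    define M where "M = max b (w + 1)"
    have M: "F M = {0}" "\<not> M \<le> w"
      using FD(2)[of b M] FD(4)[of M] ab(2) by (auto simp: M_def)
    have "extend_filtration z w F M = {0}"
    proof (intro equalityI subsetI)
      fix x assume "x \<in> extend_filtration z w F M"
      then obtain y c where "x = (y, c)" "y - c *s z = 0" "c = 0"
        using M unfolding extend_filtration_def by blast
      then show "x \<in> {0}" by (simp add: zero_prod_def)
    qed (simp add: extend_filtration_def zero_prod_def M)
    then show "\<exists>q. extend_filtration z w F q = {0}" by blast
  qed
qed

text \<open>
  The quotient of the two Rees bundles is a line bundle of degree \<open>r + p + q\<close> on the line
  \<open>u\<^sub>0 = 0\<close>. To stay within vector bundles, it is resolved by a common extension \<open>K\<close>: the Rees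
  bundle of \<open>V \<oplus> \<complex>\<close> with the vectors \<open>(0, 1)\<close>, \<open>(0, 1)\<close>, \<open>(x2 - x1, 1)\<close> added to the three
  filtrations. Projecting to \<open>\<complex>\<close> gives \<open>0 \<rightarrow> \<xi>(G) \<rightarrow> K \<rightarrow> \<O>(r + p + q) \<rightarrow> 0\<close>, and
  \<open>(y, c) \<mapsto> y + c x1\<close> gives \<open>0 \<rightarrow> \<O>(r + p + q - 1) \<rightarrow> K \<rightarrow> \<xi>(F) \<rightarrow> 0\<close>.
\<close>

lemma rees_chern_elementary:
  assumes F: "\<And>i. i < 3 \<Longrightarrow> filtration_on UNIV (F i)"
    and top: "\<And>m. r < m \<Longrightarrow> F 0 m = {0}"
    and g: "Vector_Spaces.linear scale (*) g"
    and x: "x1 \<in> F 0 r" "g x1 = 1" "x2 \<in> F 0 r" "g x2 = 1" "x1 \<in> F 1 p" "x2 \<in> F 2 q"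
    and p: "\<And>y m. y \<in> F 0 r \<Longrightarrow> y \<in> F 1 m \<Longrightarrow> g y \<noteq> 0 \<Longrightarrow> m \<le> p"
    and q: "\<And>y m. y \<in> F 0 r \<Longrightarrow> y \<in> F 2 m \<Longrightarrow> g y \<noteq> 0 \<Longrightarrow> m \<le> q"
    and G: "G = F(0 := (F 0)(r := F 0 r \<inter> {x. g x = 0}))"
  shows "filtration_on UNIV (G 0)"
    and "rees_chern scale F + line_chern (r - 1 + p + q) = rees_chern scale G + line_chern (r + p + q)"
proof -
  interpret g: Vector_Spaces.linear scale "(*)" g by fact
  note FD = filtration_onD[OF F]
  have F0: "filtration_on UNIV (F 0)" using F[of 0] by simp
  note F0D = filtration_onD[OF F0]
  have G0: "G 0 m = (if m = r then F 0 r \<inter> {x. g x = 0} else F 0 m)" for m by (simp add: G)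
  have Gi: "G i = F i" if "i \<noteq> 0" for i using that by (simp add: G)
  have GF: "G i m \<subseteq> F i m" for i m by (cases "i = 0") (auto simp: G0 Gi)
  have G0_below: "F 0 r \<subseteq> G 0 m" if "m < r" for m
    using that F0D(2)[of m r] by (simp add: G0)
  show FG0: "filtration_on UNIV (G 0)"
    unfolding filtration_on_def
  proof (intro conjI allI)
    have "subspace {x. g x = 0}" by (auto simp: subspace_def g.add g.scale)
    then show "subspace (G 0 m)" for m
      using F0D(1) by (auto simp: G0 intro: subspace_inter)
    show "antimono (G 0)"
    proof (intro antimonoI)
      fix m n :: int assume mn: "m \<le> n"
      show "G 0 n \<subseteq> G 0 m"
      proof (cases "m = r")
        case True
        then show ?thesis using mn top[of n] F0D(4)[of r] g.zero by (cases "n = r") (auto simp: G0)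
      next
        case False
        then show ?thesis using F0D(2)[OF mn] GF[of 0 n] by (auto simp: G0)
      qed
    qed
    obtain a where a: "F 0 a = UNIV" using F0 unfolding filtration_on_def by blast
    have "F 0 (min a (r - 1)) = UNIV" using F0D(2)[of "min a (r - 1)" a] a by auto
    then have "G 0 (min a (r - 1)) = UNIV" by (simp add: G0)
    then show "\<exists>m. G 0 m = UNIV" by blast
    have "G 0 (r + 1) = {0}" using top[of "r + 1"] by (simp add: G0)
    then show "\<exists>m. G 0 m = {0}" by blast
  qed simp
  have FG: "filtration_on UNIV (G i)" if "i < 3" for i
    using FG0 F[OF that] Gi[of i] by (cases "i = 0") simp_all
  note GD = filtration_onD[OF FG]
  \<comment> \<open>The vector added to the filtration of index i is \<open>(z i, 1)\<close>, in
    degree \<open>w i\<close>. The \<open>w' i\<close> are the degrees of the kernel line of (y, c)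
    \<mapsto> y + c x1: since g x1 = 1, the vector x1 is not in the shrunk step, which costs one
    degree in index 0.\<close>
  define z where "z i = (if i = 2 then x2 - x1 else 0)" for i :: nat
  define w where "w i = (if i = 0 then r else if i = 1 then p else q)" for i :: nat
  define w' where "w' i = (if i = 0 then r - 1 else if i = 1 then p else q)" for i :: nat
  define K where "K i = extend_filtration (z i) (w i) (G i)" for i
  have K: "(y, c) \<in> K i m \<longleftrightarrow> y - c *s z i \<in> G i m \<and> (c \<noteq> 0 \<longrightarrow> m \<le> w i)" for y c i m
    by (simp add: K_def extend_filtration_def)
  let ?ps = "prod_scale scale"
  let ?PB = "insert (0, 1) ((\<lambda>b. (b, 0)) ` B)"
  have fs: "finite_complex_space scale B" ..
  have fp: "finite_complex_space ?ps ?PB" by (rule prod_scale_finite_space)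
  interpret P: finite_complex_space ?ps ?PB by (rule fp)
  have FK: "P.filtration_on UNIV (K i)" if "i < 3" for i
    unfolding K_def by (rule extend_filtration[OF FG[OF that]])
  have diffG: "a - b \<in> G i m" if "i < 3" "a \<in> G i m" "b \<in> G i m" for i m a b
    using GD(1)[OF that(1)] that(2,3) by (rule subspace_diff)
  have addG: "a + b \<in> G i m" if "i < 3" "a \<in> G i m" "b \<in> G i m" for i m a b
    using GD(1)[OF that(1)] that(2,3) by (rule subspace_add)
  have scaleG: "c *s a \<in> G i m" if "i < 3" "a \<in> G i m" for i m a c
    using GD(1)[OF that(1)] that(2) by (rule subspace_scale)
  have addF: "a + b \<in> F i m" if "i < 3" "a \<in> F i m" "b \<in> F i m" for i m a b
    using FD(1)[OF that(1)] that(2,3) by (rule subspace_add)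
  have scaleF: "c *s a \<in> F i m" if "i < 3" "a \<in> F i m" for i m a c
    using FD(1)[OF that(1)] that(2) by (rule subspace_scale)
  have zeroG: "0 \<in> G i m" if "i < 3" for i m by (rule GD(4)[OF that])
  have x1F1: "x1 \<in> F 1 m" if "m \<le> p" for m using FD(2)[of 1 m p] that x(5) by auto
  have x2F2: "x2 \<in> F 2 m" if "m \<le> q" for m using FD(2)[of 2 m q] that x(6) by auto
  have x1F0: "x1 \<in> F 0 m" "x2 \<in> F 0 m" if "m \<le> r" for m using F0D(2)[of m r] that x(1,3) by auto
  have z2G: "x2 - x1 \<in> G 0 m" if "m \<le> r" for m
    using x1F0[OF that] x(2,4) F0D(1) by (auto simp: G0 subspace_diff g.diff)
  have e1: "rees_chern ?ps K = rees_chern scale G + rees_chern (*) (\<lambda>i. line_filtration (w i))"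
  proof (rule rees_chern_additive[where f = "\<lambda>y. (y, 0)" and h = snd, OF fs fp scalars_finite_space _ _ FG FK])
    show "Vector_Spaces.linear scale ?ps (\<lambda>y. (y, 0))" by unfold_locales (auto simp: prod_scale_def)
    show "Vector_Spaces.linear ?ps (*) snd" by unfold_locales (auto simp: prod_scale_def)
    show "scalars.filtration_on UNIV (line_filtration (w i))" for i by (rule line_filtration)
    show "inj_on (\<lambda>y. (y, 0)) UNIV" by (auto simp: inj_on_def)
    fix i j :: nat and m l :: int assume ij: "(i, j) \<in> {(0, 1), (0, 2), (1, 2)}"
    show "(\<lambda>y. (y, 0)) ` (G i m \<inter> G j l) = {y \<in> K i m \<inter> K j l. snd y = 0}"
      by (auto simp: K)
    show "snd ` (K i m \<inter> K j l) = line_filtration (w i) m \<inter> line_filtration (w j) l"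
    proof (intro equalityI subsetI)
      fix c assume "c \<in> snd ` (K i m \<inter> K j l)"
      then show "c \<in> line_filtration (w i) m \<inter> line_filtration (w j) l"
        by (auto simp: K line_filtration_def)
    next
      fix c assume c: "c \<in> line_filtration (w i) m \<inter> line_filtration (w j) l"
      show "c \<in> snd ` (K i m \<inter> K j l)"
      proof (cases "c = 0")
        case True
        have "(0, c) \<in> K i m \<inter> K j l" using ij zeroG True by (auto simp: K)
        then show ?thesis by force
      next
        case False
        then have ml: "m \<le> w i" "l \<le> w j" using c by (auto simp: line_filtration_def)
        \<comment> \<open>The lift of c depends on the pair of filtrations: 0 for the indices 0 and
          1; c (x2 - x1) for 0 and 2, where g kills x2 - x1; and - c x1 for 1 and 2, which becomes -
          c x2 once c (x2 - x1) is subtracted.\<close>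
        define y where "y = (if (i, j) = (0, 1) then 0 else if (i, j) = (0, 2) then c *s (x2 - x1) else - (c *s x1))"
        have "(y, c) \<in> K i m \<inter> K j l"
        proof -
          consider "i = 0" "j = 1" | "i = 0" "j = 2" | "i = 1" "j = 2" using ij by auto
          then show ?thesis
          proof cases
            case 1
            then show ?thesis using ml zeroG by (simp add: K y_def z_def)
          next
            case 2
            then show ?thesis
              using ml zeroG z2G[of m] scaleG[of 0 "x2 - x1" m c] by (simp add: K y_def z_def w_def)
          next
            case 3
            have "- (c *s x1) \<in> G 1 m" "- (c *s x2) \<in> G 2 l"
              using ml 3 x1F1[of m] x2F2[of l] scaleG[of 1 x1 m "- c"] scaleG[of 2 x2 l "- c"]
              by (simp_all add: w_def Gi)
            then show ?thesis using 3 ml by (simp add: K y_def z_def scale_right_diff_distrib)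
          qed
        qed
        then show ?thesis by force
      qed
    qed
  qed
  have e2: "rees_chern ?ps K = rees_chern (*) (\<lambda>i. line_filtration (w' i)) + rees_chern scale F"
  proof (rule rees_chern_additive[where f = "\<lambda>c. (- (c *s x1), c)" and h = "\<lambda>(y, c). y + c *s x1",
        OF scalars_finite_space fp fs _ _ line_filtration FK F])
    show "Vector_Spaces.linear (*) ?ps (\<lambda>c. (- (c *s x1), c))"
      by unfold_locales (auto simp: prod_scale_def algebra_simps)
    show "Vector_Spaces.linear ?ps scale (\<lambda>(y, c). y + c *s x1)"
      by unfold_locales (auto simp: prod_scale_def algebra_simps)
    show "inj_on (\<lambda>c. (- (c *s x1), c)) UNIV" by (auto simp: inj_on_def)
    have kK: "(- (c *s x1), c) \<in> K i m \<longleftrightarrow> c \<in> line_filtration (w' i) m" if i: "i < 3" for c i m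
    proof (cases "c = 0")
      case True
      then show ?thesis using zeroG[OF i] by (simp add: K line_filtration_def)
    next
      case False
      consider "i = 0" | "i = 1" | "i = 2" using i by linarith
      then show ?thesis
      proof cases
        case 1
        have "- (c *s x1) \<in> G 0 m \<longleftrightarrow> m < r" if "m \<le> r"
        proof
          assume "- (c *s x1) \<in> G 0 m"
          then have "m = r \<longrightarrow> g (- (c *s x1)) = 0" by (auto simp: G0)
          then show "m < r" using that False x(2) by (auto simp: g.neg g.scale)
        next
          assume "m < r"
          then have "x1 \<in> G 0 m" using G0_below x(1) by blast
          then show "- (c *s x1) \<in> G 0 m" using scaleG[of 0 x1 m "- c"] by simp
        qed
        then show ?thesis using 1 False by (auto simp: K line_filtration_def z_def w_def w'_def)
      next
        case 2
        have "- (c *s x1) \<in> G 1 m" if "m \<le> p"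
          using scaleG[of 1 x1 m "- c"] x1F1[OF that] by (simp add: Gi)
        then show ?thesis using 2 False by (auto simp: K line_filtration_def z_def w_def w'_def)
      next
        case 3
        have "- (c *s x1) - c *s (x2 - x1) \<in> G 2 m" if "m \<le> q"
          using scaleG[of 2 x2 m "- c"] x2F2[OF that] by (simp add: Gi scale_right_diff_distrib)
        then show ?thesis using 3 False by (auto simp: K line_filtration_def z_def w_def w'_def)
      qed
    qed
    have hK: "y + c *s x1 \<in> F i m" if i: "i < 3" and yc: "(y, c) \<in> K i m" for y c i m
    proof (cases "c = 0")
      case True
      then show ?thesis using yc GF[of i m] by (auto simp: K)
    next
      case False
      have K': "y - c *s z i \<in> F i m" "m \<le> w i" using yc False GF[of i m] by (auto simp: K)
      consider "i = 0" | "i = 1" | "i = 2" using i by linarith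
      then show ?thesis
      proof cases
        case 1
        then show ?thesis using K' addF[of 0 y m "c *s x1"] scaleF[of 0 x1 m c] x1F0[of m]
          by (simp add: z_def w_def)
      next
        case 2
        then show ?thesis using K' addF[of 1 y m "c *s x1"] scaleF[of 1 x1 m c] x1F1[of m]
          by (simp add: z_def w_def)
      next
        case 3
        have "y - c *s (x2 - x1) + c *s x2 \<in> F 2 m"
          using 3 K' addF[of 2 "y - c *s (x2 - x1)" m "c *s x2"] scaleF[of 2 x2 m c] x2F2[of m]
          by (simp add: z_def w_def)
        then show ?thesis using 3 by (simp add: scale_right_diff_distrib)
      qed
    qed
    fix i j :: nat and m l :: int assume ij: "(i, j) \<in> {(0, 1), (0, 2), (1, 2)}"
    then have i3: "i < 3" "j < 3" by auto
    show "(\<lambda>c. (- (c *s x1), c)) ` (line_filtration (w' i) m \<inter> line_filtration (w' j) l) =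
      {y \<in> K i m \<inter> K j l. (case y of (y, c) \<Rightarrow> y + c *s x1) = 0}"
    proof (intro equalityI subsetI)
      fix u assume "u \<in> {y \<in> K i m \<inter> K j l. (case y of (y, c) \<Rightarrow> y + c *s x1) = 0}"
      then obtain y c where u: "u = (y, c)" "(y, c) \<in> K i m" "(y, c) \<in> K j l" "y + c *s x1 = 0"
        by (cases u) auto
      have y: "y = - (c *s x1)" using u(4) by (simp add: eq_neg_iff_add_eq_0)
      then have "c \<in> line_filtration (w' i) m \<inter> line_filtration (w' j) l"
        using kK[OF i3(1), of c m] kK[OF i3(2), of c l] u by simp
      then show "u \<in> (\<lambda>c. (- (c *s x1), c)) ` (line_filtration (w' i) m \<inter> line_filtration (w' j) l)"
        using y u(1) by blast
    qed (use kK[OF i3(1)] kK[OF i3(2)] in auto)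
    show "(\<lambda>(y, c). y + c *s x1) ` (K i m \<inter> K j l) = F i m \<inter> F j l"
    proof (intro equalityI subsetI)
      fix u assume "u \<in> (\<lambda>(y, c). y + c *s x1) ` (K i m \<inter> K j l)"
      then show "u \<in> F i m \<inter> F j l" using hK[OF i3(1)] hK[OF i3(2)] by auto
    next
      fix v assume v: "v \<in> F i m \<inter> F j l"
      \<comment> \<open>Only an element of the step \<open>F 0 r\<close> can be missing from G.
        Subtracting g(v) x1 moves it into the kernel of g, and if g(v) is nonzero, the maximality of
        p and q bounds the degree in the other filtration.\<close>
      define c where "c = (if i = 0 \<and> m = r then g v else 0)"
      have "(v - c *s x1, c) \<in> K i m \<inter> K j l"
      proof (cases "c = 0")
        case True
        have "v \<in> G i m"
        proof (cases "i = 0 \<and> m = r")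
          case True
          then show ?thesis using v \<open>c = 0\<close> by (simp add: c_def G0)
        next
          case False
          then show ?thesis using v by (cases "i = 0") (auto simp: G0 Gi)
        qed
        moreover have "v \<in> G j l" using v ij by (auto simp: Gi)
        ultimately show ?thesis using True by (simp add: K)
      next
        case False
        then have i0: "i = 0" "m = r" "c = g v" by (auto simp: c_def split: if_splits)
        have vX: "v \<in> F 0 r" using v i0 by simp
        have "v - c *s x1 \<in> F 0 r"
          using vX x(1) F0D(1) by (simp add: subspace_diff subspace_scale)
        then have "v - c *s x1 \<in> G 0 m" using x(2) by (simp add: G0 i0 g.diff g.scale)
        then have 1: "(v - c *s x1, c) \<in> K i m" using i0 by (simp add: K z_def w_def)
        have "(v - c *s x1, c) \<in> K j l"
        proof -
          consider "j = 1" | "j = 2" using ij i0 by auto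
          then show ?thesis
          proof cases
            case 1
            have lp: "l \<le> p" using p[OF vX, of l] v False i0 1 by simp
            then have "v - c *s x1 \<in> G 1 l"
              using v 1 diffG[of 1 v l "c *s x1"] scaleG[of 1 x1 l c] x1F1[of l] by (simp add: Gi)
            then show ?thesis using 1 lp by (simp add: K z_def w_def)
          next
            case 2
            have lq: "l \<le> q" using q[OF vX, of l] v False i0 2 by simp
            then have "v - c *s x2 \<in> G 2 l"
              using v 2 diffG[of 2 v l "c *s x2"] scaleG[of 2 x2 l c] x2F2[of l] by (simp add: Gi)
            then show ?thesis using 2 lq by (simp add: K z_def w_def scale_right_diff_distrib)
          qed
        qed
        with 1 show ?thesis by blast
      qed
      moreover have "v = (\<lambda>(y, c). y + c *s x1) (v - c *s x1, c)" by simp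
      ultimately show "v \<in> (\<lambda>(y, c). y + c *s x1) ` (K i m \<inter> K j l)" by (rule rev_image_eqI)
    qed
  qed
  have "line_chern (r - 1 + p + q) = rees_chern (*) (\<lambda>i. line_filtration (w' i))"
    "line_chern (r + p + q) = rees_chern (*) (\<lambda>i. line_filtration (w i))"
    using rees_chern_line[of "\<lambda>i. line_filtration (w i)" w]
      rees_chern_line[of "\<lambda>i. line_filtration (w' i)" w'] by (simp_all add: w_def w'_def)
  then show "rees_chern scale F + line_chern (r - 1 + p + q) = rees_chern scale G + line_chern (r + p + q)"
    using e1 e2 by (simp add: add.commute)
qed

end

section \<open>The Chern character of a Rees bundle\<close>

lemma of_int_mult_Coh: "(of_int k :: coh_P2) * Coh a b c = Coh (of_int k * a) (of_int k * b) (of_int k * c)"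
proof (induction k rule: int_induct[of _ 0])
  case base then show ?case by (simp add: zero_coh_P2_def)
next
  case (step1 i) then show ?case by (simp add: distrib_right)
next
  case (step2 i) then show ?case by (simp add: left_diff_distrib)
qed

lemma sum_Coh: "(\<Sum>x\<in>A. Coh (a x) (b x) (c x)) = Coh (sum a A) (sum b A) (sum c A)"
  by (induction A rule: infinite_finite_induct) (auto simp: zero_coh_P2_def)

context finite_complex_space
begin

definition dim_int :: "'b set \<Rightarrow> int" where
  "dim_int X = int (dim X)"

text \<open>By inclusion-exclusion, the dimension of the iterated graded of V in bidegree (p, q). In
  this form it is symmetric in the two filtrations and involves intersections only.\<close>

definition bigraded_dim :: "(int \<Rightarrow> 'b set) \<Rightarrow> (int \<Rightarrow> 'b set) \<Rightarrow> int \<Rightarrow> int \<Rightarrow> int" where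
  "bigraded_dim F G p q =
     dim_int (F p \<inter> G q) - dim_int (F (p + 1) \<inter> G q) - dim_int (F p \<inter> G (q + 1))
     + dim_int (F (p + 1) \<inter> G (q + 1))"

text \<open>The degree of the filtration induced on X, the sum of m dim Gr^m, provided that the box
  from \<open>lo\<close> to \<open>hi\<close> contains all jumps.\<close>

definition filtration_degree :: "int \<Rightarrow> int \<Rightarrow> (int \<Rightarrow> 'b set) \<Rightarrow> 'b set \<Rightarrow> int" where
  "filtration_degree lo hi F X =
     (\<Sum>m\<in>{lo..<hi}. m * (dim_int (F m \<inter> X) - dim_int (F (m + 1) \<inter> X)))"

lemma dim_int_zero [simp]: "dim_int {0} = 0"
  using dim_eq_0[of "{0}"] by (simp add: dim_int_def)

lemma filtration_on_below:
  assumes "filtration_on W F" "F n = W" "m \<le> n"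
  shows "F m = W"
  using filtration_onD(2)[OF assms(1,3)] filtration_onD(3)[OF assms(1)] assms(2) by blast

lemma filtration_on_above:
  assumes "filtration_on W F" "F n = {0}" "n \<le> m"
  shows "F m = {0}"
  using filtration_onD(2)[OF assms(1,3)] filtration_onD(4)[OF assms(1)] assms(2) by blast

text \<open>If v lies in both steps, the kernel of g is a hyperplane in their intersection;
  otherwise g already vanishes on the intersection.\<close>

lemma dim_int_kernel_peels:
  assumes F: "filtration_on W F" "filtration_on W G"
    and g: "Vector_Spaces.linear scale (*) g" "g v = 1"
    and pe: "peels v g p F" "peels v g q G"
  shows "dim_int (F m \<inter> G l) =
    dim_int (F m \<inter> {x. g x = 0} \<inter> (G l \<inter> {x. g x = 0})) + (if m \<le> p \<and> l \<le> q then 1 else 0)"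
proof -
  have K: "F m \<inter> {x. g x = 0} \<inter> (G l \<inter> {x. g x = 0}) = F m \<inter> G l \<inter> {x. g x = 0}" by blast
  show ?thesis
  proof (cases "m \<le> p \<and> l \<le> q")
    case True
    have "v \<in> F m" "v \<in> G l"
      using pe[unfolded peels_def, rule_format, of v] True g(2)
        filtration_onD(4)[OF F(1)] filtration_onD(4)[OF F(2)] by auto
    then have "dim (F m \<inter> G l) = dim (F m \<inter> G l \<inter> {x. g x = 0}) + 1"
      using filtration_onD(1)[OF F(1)] filtration_onD(1)[OF F(2)] g
      by (intro dim_kernel subspace_inter) auto
    then show ?thesis unfolding K dim_int_def using True by simp
  next
    case False
    then have "g x = 0" if "x \<in> F m \<inter> G l" for x
      using pe that unfolding peels_def by blast
    then have "F m \<inter> G l = F m \<inter> G l \<inter> {x. g x = 0}" by blast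
    then show ?thesis unfolding K using False by auto
  qed
qed

lemma rees_chern_two_filtrations:
  assumes "filtration_on W F" "filtration_on W G"
    and "F lo = W" "G lo = W" "F hi = {0}" "G hi = {0}"
  shows "rees_chern scale (three_filtrations (\<lambda>m. if m \<le> N then W else {0}) F G) =
    (\<Sum>p\<in>{lo..<hi}. \<Sum>q\<in>{lo..<hi}. of_int (bigraded_dim F G p q) * line_chern (N + p + q))"
  using assms
proof (induction "dim W" arbitrary: W F G)
  case 0
  have "W = {0}" using dim_eq_0[of W] 0(1) subspace_0[OF filtration_onD(5)[OF 0(2)]] by auto
  have z: "F m = {0}" "G m = {0}" for m
    using filtration_onD(3,4)[OF 0(2), of m] filtration_onD(3,4)[OF 0(3), of m] \<open>W = {0}\<close> by auto
  have "bigraded_dim F G p q = 0" for p q by (simp add: bigraded_dim_def z)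
  moreover have "rees_chern scale (three_filtrations (\<lambda>m. if m \<le> N then W else {0}) F G) = 0"
    by (rule rees_chern_zero) (simp add: three_filtrations_def z \<open>W = {0}\<close>)
  ultimately show ?case by simp
next
  case (Suc n)
  note F = Suc.prems(1) and G = Suc.prems(2)
  have "W \<noteq> {0}" using Suc.hyps(2) by auto
  then obtain v g p q where v: "v \<in> W" and g: "Vector_Spaces.linear scale (*) g" "g v = 1"
    and pF: "peels v g p F" and qG: "peels v g q G"
    using peel_exists[OF F G] by blast
  interpret g: Vector_Spaces.linear scale "(*)" g by fact
  let ?K = "{x. g x = 0}"
  let ?T = "\<lambda>m. if m \<le> N then W else {0}"
  have W: "subspace W" using filtration_onD(5)[OF F] .
  have v0: "v \<noteq> 0" using g(2) g.zero by auto
  have T: "filtration_on W ?T"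
    unfolding filtration_on_def
  proof (intro conjI allI)
    show "\<exists>p. ?T p = W" by (rule exI[of _ N]) simp
    show "\<exists>q. ?T q = {0}" by (rule exI[of _ "N + 1"]) simp
    show "antimono ?T" using subspace_0[OF W] by (auto simp: antimono_def)
  qed (use W subspace_0[OF W] in auto)
  have NT: "peels v g N ?T"
    by (rule peelsI[OF T]) (use v g.zero in auto)
  define F3 where "F3 = three_filtrations ?T F G"
  have fil: "filtration_on W (F3 i)" if "i < 3" for i
    using T F G by (simp add: F3_def three_filtrations_def)
  have pee: "peels v g (if i = 0 then N else if i = 1 then p else q) (F3 i)" if "i < 3" for i
    using NT pF qG by (simp add: F3_def three_filtrations_def)
  have "rees_chern scale F3 = rees_chern scale (\<lambda>i m. F3 i m \<inter> ?K) + line_chern (N + p + q)"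
    using rees_chern_peel[OF fil v g pee] by simp
  also have "(\<lambda>i m. F3 i m \<inter> ?K) = three_filtrations (\<lambda>m. if m \<le> N then W \<inter> ?K else {0}) (\<lambda>m. F m \<inter> ?K) (\<lambda>m. G m \<inter> ?K)"
    using g.zero by (auto simp: F3_def three_filtrations_def fun_eq_iff)
  also have "rees_chern scale \<dots> = (\<Sum>i\<in>{lo..<hi}. \<Sum>j\<in>{lo..<hi}.
      of_int (bigraded_dim (\<lambda>m. F m \<inter> ?K) (\<lambda>m. G m \<inter> ?K) i j) * line_chern (N + i + j))"
  proof (rule Suc.hyps(1))
    show "n = dim (W \<inter> ?K)" using dim_kernel[OF W g(1) v g(2)] Suc.hyps(2) by simp
  qed (use filtration_on_kernel[OF F g(1)] filtration_on_kernel[OF G g(1)] Suc.prems(3-6) g.zero in auto)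
  \<comment> \<open>The contribution of v is written as an indicator at (p, q) so that it joins the
    double sum. The pair lies in the box because v is a nonzero vector of W.\<close>
  also have "line_chern (N + p + q) = (\<Sum>i\<in>{lo..<hi}. \<Sum>j\<in>{lo..<hi}.
      of_int (if i = p \<and> j = q then 1 else 0) * line_chern (N + i + j))"
  proof -
    have vm: "v \<in> F m \<longleftrightarrow> m \<le> p" "v \<in> G m \<longleftrightarrow> m \<le> q" for m
      using pF[unfolded peels_def, rule_format, of v m] qG[unfolded peels_def, rule_format, of v m]
        filtration_onD(4)[OF F] filtration_onD(4)[OF G] g(2) by auto
    have pq: "p \<in> {lo..<hi}" "q \<in> {lo..<hi}"
      using vm[of lo] vm[of hi] v v0 Suc.prems(3-6) by auto
    have "(\<Sum>i\<in>{lo..<hi}. \<Sum>j\<in>{lo..<hi}. of_int (if i = p \<and> j = q then 1 else 0) * line_chern (N + i + j))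
      = (\<Sum>i\<in>{lo..<hi}. if i = p then line_chern (N + i + q) else 0)"
      using pq by (intro sum.cong refl) (simp add: if_distrib[of "\<lambda>x. of_int x * _"] cong: if_cong)
    then show ?thesis using pq by simp
  qed
  finally have "rees_chern scale F3 = (\<Sum>i\<in>{lo..<hi}. \<Sum>j\<in>{lo..<hi}.
      of_int (bigraded_dim (\<lambda>m. F m \<inter> ?K) (\<lambda>m. G m \<inter> ?K) i j + (if i = p \<and> j = q then 1 else 0))
        * line_chern (N + i + j))"
    by (simp only: sum.distrib distrib_right of_int_add)
  moreover have "bigraded_dim F G i j =
      bigraded_dim (\<lambda>m. F m \<inter> ?K) (\<lambda>m. G m \<inter> ?K) i j + (if i = p \<and> j = q then 1 else 0)" for i j
    unfolding bigraded_dim_def dim_int_kernel_peels[OF F G g pF qG] by auto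
  ultimately show ?case by (simp add: F3_def)
qed

text \<open>The quotient of X by the kernel of g is a line that F m reaches exactly for m \<le> p,
  so it contributes p to the degree.\<close>

lemma filtration_degree_kernel:
  assumes F: "filtration_on UNIV F" and X: "subspace X" and g: "Vector_Spaces.linear scale (*) g"
    and x: "x \<in> X" "x \<in> F p" "g x = 1" and p: "\<And>y m. y \<in> X \<Longrightarrow> y \<in> F m \<Longrightarrow> g y \<noteq> 0 \<Longrightarrow> m \<le> p"
    and lohi: "lo \<le> p" "p < hi"
  shows "filtration_degree lo hi F X = filtration_degree lo hi F (X \<inter> {x. g x = 0}) + p"
proof -
  let ?K = "{x. g x = 0}"
  have d: "dim_int (F m \<inter> X) = dim_int (F m \<inter> (X \<inter> ?K)) + (if m \<le> p then 1 else 0)" for m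
  proof (cases "m \<le> p")
    case True
    then have "x \<in> F m" using x(2) filtration_onD(2)[OF F] by blast
    then have "dim (F m \<inter> X) = dim (F m \<inter> X \<inter> ?K) + 1"
      using filtration_onD(1)[OF F] X g x by (intro dim_kernel subspace_inter) auto
    then show ?thesis unfolding dim_int_def using True by (simp add: Int_assoc)
  next
    case False
    then have "F m \<inter> X = F m \<inter> (X \<inter> ?K)" using p by blast
    then show ?thesis using False by simp
  qed
  have "filtration_degree lo hi F X = (\<Sum>m\<in>{lo..<hi}.
      m * (dim_int (F m \<inter> (X \<inter> ?K)) - dim_int (F (m + 1) \<inter> (X \<inter> ?K))) + (if m = p then m else 0))"
    unfolding filtration_degree_def d by (intro sum.cong) (auto simp: algebra_simps)
  then show ?thesis using lohi by (simp add: filtration_degree_def sum.distrib)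
qed

text \<open>Each hyperplane cut at a step r removes ch(O(d)) - ch(O(d - 1)) = w^2 + (d - 1/2) w^4,
  where d = r + p + q. Over all cuts that shrink X = F0 r to zero, the p and q add up to the degrees
  of F1 and F2 on X, which gives the summand for r. What remains at the end is a single jump at
  \<open>lo\<close>. The induction is on the total dimension of the steps strictly between
  \<open>lo\<close> and \<open>hi\<close>.\<close>

lemma rees_chern_formula:
  assumes "filtration_on UNIV F0" "filtration_on UNIV F1" "filtration_on UNIV F2"
    and "F0 lo = UNIV" "F1 lo = UNIV" "F2 lo = UNIV" "F0 hi = {0}" "F1 hi = {0}" "F2 hi = {0}"
  shows "rees_chern scale (three_filtrations F0 F1 F2) =
    (\<Sum>p\<in>{lo..<hi}. \<Sum>q\<in>{lo..<hi}. of_int (bigraded_dim F1 F2 p q) * line_chern (lo + p + q))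
    + (\<Sum>r\<in>{lo<..<hi}. Coh 0 (of_int (dim_int (F0 r)))
        ((of_int r - 1 / 2) * of_int (dim_int (F0 r))
         + of_int (filtration_degree lo hi F1 (F0 r)) + of_int (filtration_degree lo hi F2 (F0 r))))"
  using assms
proof (induction "\<Sum>r\<in>{lo<..<hi}. dim (F0 r)" arbitrary: F0 rule: less_induct)
  case less
  note F0 = less.prems(1) and F1 = less.prems(2) and F2 = less.prems(3)
  let ?A = "\<Sum>p\<in>{lo..<hi}. \<Sum>q\<in>{lo..<hi}. of_int (bigraded_dim F1 F2 p q) * line_chern (lo + p + q)"
  define c where "c r X = Coh 0 (of_int (dim_int X))
    ((of_int r - 1 / 2) * of_int (dim_int X)
     + of_int (filtration_degree lo hi F1 X) + of_int (filtration_degree lo hi F2 X))" for r :: int and X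
  show ?case
  proof (cases "\<exists>r>lo. F0 r \<noteq> {0}")
    case False
    have "F0 = (\<lambda>m. if m \<le> lo then UNIV else {0})"
      using False filtration_on_below[OF F0 less.prems(4)] by (auto simp: fun_eq_iff)
    moreover have "c r {0} = 0" for r
    proof -
      have "F1 m \<inter> {0} = {0}" "F2 m \<inter> {0} = {0}" for m
        using filtration_onD(4)[OF F1] filtration_onD(4)[OF F2] by auto
      then show ?thesis by (simp add: c_def filtration_degree_def zero_coh_P2_def)
    qed
    then have "(\<Sum>r\<in>{lo<..<hi}. c r (F0 r)) = 0" using False by (intro sum.neutral) auto
    ultimately show ?thesis
      using rees_chern_two_filtrations[OF F1 F2 less.prems(5,6,8,9), of lo] unfolding c_def by simp
  next
    case True
    then obtain r0 where r0: "lo < r0" "F0 r0 \<noteq> {0}" by blast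
    have down: "F0 m \<noteq> {0}" if "m \<le> n" "F0 n \<noteq> {0}" for m n
      using filtration_on_above[OF F0 _ that(1)] that(2) by blast
    obtain r where r: "\<And>m. F0 m \<noteq> {0} \<longleftrightarrow> m \<le> r"
      using int_greatest_index[of "\<lambda>m. F0 m \<noteq> {0}" r0 hi] r0(2) less.prems(7) down by blast
    have rlo: "lo < r" using r[of r0] r0 by simp
    have rhi: "r < hi" using r[of hi] less.prems(7) by simp
    define X where "X = F0 r"
    have X: "subspace X" unfolding X_def by (rule filtration_onD(1)[OF F0])
    have "X \<noteq> {0}" "0 \<in> X" using r[of r] subspace_0[OF X] by (auto simp: X_def)
    then obtain x where x: "x \<in> X" "x \<notin> {0}" by blast
    \<comment> \<open>Any functional that is nonzero on X will do; p and q are determined by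
      it.\<close>
    obtain g where g: "Vector_Spaces.linear scale (*) g" "g x = 1"
      using functional_exists[of "{0}" x] x(2) by auto
    interpret g: Vector_Spaces.linear scale "(*)" g by fact
    \<comment> \<open>The degree in which F meets the quotient line of X by the kernel of g, with a
      representative normalised by g. One functional serves F1 and F2, but the representatives may
      differ.\<close>
    have top: "\<exists>p y. lo \<le> p \<and> p < hi \<and> y \<in> X \<and> y \<in> F p \<and> g y = 1 \<and>
        (\<forall>y m. y \<in> X \<longrightarrow> y \<in> F m \<longrightarrow> g y \<noteq> 0 \<longrightarrow> m \<le> p)"
      if F: "filtration_on UNIV F" "F lo = UNIV" "F hi = {0}" for F
    proof -
      let ?P = "\<lambda>m. \<exists>y. y \<in> X \<and> y \<in> F m \<and> g y \<noteq> 0"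
      have 1: "?P lo" using x(1) g(2) F(2) by (intro exI[of _ x]) simp
      have 2: "\<not> ?P hi" using F(3) g.zero by auto
      have 3: "?P m" if "m \<le> n" "?P n" for m n using filtration_onD(2)[OF F(1) that(1)] that(2) by blast
      obtain p where p: "\<And>m. ?P m \<longleftrightarrow> m \<le> p"
        by (rule int_greatest_index[of ?P, OF 1 2 3]) blast+
      obtain y where y: "y \<in> X" "y \<in> F p" "g y \<noteq> 0" using p[of p] by blast
      have "(1 / g y) *s y \<in> X" "(1 / g y) *s y \<in> F p" "g ((1 / g y) *s y) = 1"
        using y X filtration_onD(1)[OF F(1)] by (auto simp: subspace_scale g.scale)
      moreover have "lo \<le> p" using p[of lo] 1 by simp
      moreover have "p < hi" using 2 unfolding p by simp
      moreover have "\<forall>y m. y \<in> X \<longrightarrow> y \<in> F m \<longrightarrow> g y \<noteq> 0 \<longrightarrow> m \<le> p" using p by blast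
      ultimately show ?thesis by blast
    qed
    obtain p x1 where p: "lo \<le> p" "p < hi" "x1 \<in> X" "x1 \<in> F1 p" "g x1 = 1"
      "\<And>y m. y \<in> X \<Longrightarrow> y \<in> F1 m \<Longrightarrow> g y \<noteq> 0 \<Longrightarrow> m \<le> p"
      using top[OF F1 less.prems(5,8)] by (elim exE conjE) blast
    obtain q x2 where q: "lo \<le> q" "q < hi" "x2 \<in> X" "x2 \<in> F2 q" "g x2 = 1"
      "\<And>y m. y \<in> X \<Longrightarrow> y \<in> F2 m \<Longrightarrow> g y \<noteq> 0 \<Longrightarrow> m \<le> q"
      using top[OF F2 less.prems(6,9)] by (elim exE conjE) blast
    define H where "H = X \<inter> {x. g x = 0}"
    define G0 where "G0 = F0(r := H)"
    let ?F = "three_filtrations F0 F1 F2" and ?G = "three_filtrations G0 F1 F2"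
    have F: "filtration_on UNIV (?F i)" if "i < 3" for i
      using F0 F1 F2 by (simp add: three_filtrations_def)
    have G: "?G = ?F(0 := (?F 0)(r := ?F 0 r \<inter> {x. g x = 0}))"
      by (auto simp: fun_eq_iff three_filtrations_def G0_def H_def X_def)
    have above: "F0 m = {0}" if "r < m" for m using r[of m] that by auto
    have mem: "x1 \<in> ?F 0 r" "x2 \<in> ?F 0 r" "x1 \<in> ?F 1 p" "x2 \<in> ?F 2 q"
      using p(3,4) q(3,4) by (simp_all add: X_def)
    have bound: "m \<le> p" if "y \<in> ?F 0 r" "y \<in> ?F 1 m" "g y \<noteq> 0" for y m
      using p(6)[of y m] that by (simp add: X_def)
    have bound': "m \<le> q" if "y \<in> ?F 0 r" "y \<in> ?F 2 m" "g y \<noteq> 0" for y m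
      using q(6)[of y m] that by (simp add: X_def)
    have above': "?F 0 m = {0}" if "r < m" for m using above[OF that] by simp
    note ind = rees_chern_elementary[OF F above' g(1) mem(1) p(5) mem(2) q(5) mem(3,4) bound bound' G]
    have dX: "dim X = dim H + 1"
      unfolding H_def by (rule dim_kernel[OF X g(1) p(3,5)])
    have "rees_chern scale ?G = ?A + (\<Sum>m\<in>{lo<..<hi}. c m (G0 m))"
      unfolding c_def
    proof (rule less.hyps)
      show "(\<Sum>m\<in>{lo<..<hi}. dim (G0 m)) < (\<Sum>m\<in>{lo<..<hi}. dim (F0 m))"
        by (rule sum_strict_mono_ex1) (use rlo rhi dX in \<open>auto simp: G0_def X_def intro!: bexI[of _ r]\<close>)
      show "filtration_on UNIV G0" using ind(1) by simp
    qed (use less.prems rlo rhi in \<open>auto simp: G0_def\<close>)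
    moreover have "(\<Sum>m\<in>{lo<..<hi}. c m (F0 m)) = (\<Sum>m\<in>{lo<..<hi}. c m (G0 m)) + Coh 0 1 (of_int (r + p + q) - 1 / 2)"
    proof -
      have rm: "r \<in> {lo<..<hi}" using rlo rhi by simp
      have "c r X = c r H + Coh 0 1 (of_int (r + p + q) - 1 / 2)"
        using filtration_degree_kernel[OF F1 X g(1) p(3,4,5,6,1,2)]
          filtration_degree_kernel[OF F2 X g(1) q(3,4,5,6,1,2)] dX
        by (simp add: c_def dim_int_def H_def algebra_simps)
      moreover have "(\<Sum>m\<in>{lo<..<hi} - {r}. c m (F0 m)) = (\<Sum>m\<in>{lo<..<hi} - {r}. c m (G0 m))"
        by (intro sum.cong) (auto simp: G0_def)
      ultimately show ?thesis
        using sum.remove[OF _ rm, of "\<lambda>m. c m (F0 m)"] sum.remove[OF _ rm, of "\<lambda>m. c m (G0 m)"]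
        by (simp add: G0_def X_def add.commute add.left_commute)
    qed
    \<comment> \<open>The difference of d^2/2 and (d - 1)^2/2 is d - 1/2.\<close>
    moreover have "line_chern (r + p + q) = line_chern (r - 1 + p + q) + Coh 0 1 (of_int (r + p + q) - 1 / 2)"
      by (simp add: line_chern_def power2_eq_square field_simps)
    ultimately have "rees_chern scale ?F + line_chern (r - 1 + p + q) =
        ?A + (\<Sum>m\<in>{lo<..<hi}. c m (F0 m)) + line_chern (r - 1 + p + q)"
      using ind(2) by (simp add: add.assoc add.commute add.left_commute)
    then show ?thesis unfolding c_def by simp
  qed
qed

end

section \<open>Dimensions of iterated gradeds\<close>

lemma sum_int_interval_shift:
  fixes f :: "int \<Rightarrow> int"
  assumes "lo \<le> hi"
  shows "(\<Sum>m\<in>{lo..<hi}. f m - f (m + 1)) = f lo - f hi"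
  using assms
proof (induction hi rule: int_ge_induct)
  case (step i)
  have "{lo..<i + 1} = insert i {lo..<i}" using step(1) by auto
  then show ?case using step by simp
qed simp

text \<open>Abel summation, used to pass from dimensions of graded pieces, the differences of
  \<open>a\<close>, to those of filtration steps. The boundary term at \<open>lo\<close>
  survives.\<close>

lemma sum_by_parts_int:
  fixes a \<phi> :: "int \<Rightarrow> int"
  assumes "lo < hi" "a hi = 0"
  shows "(\<Sum>r\<in>{lo..<hi}. \<phi> r * (a r - a (r + 1))) =
    \<phi> lo * a lo + (\<Sum>r\<in>{lo<..<hi}. (\<phi> r - \<phi> (r - 1)) * a r)"
proof -
  have "(\<Sum>r\<in>{lo..<hi}. \<phi> r * (a r - a (r + 1))) =
    (\<Sum>r\<in>{lo..<hi}. (\<phi> (r - 1) * a r - \<phi> (r + 1 - 1) * a (r + 1))) + (\<Sum>r\<in>{lo..<hi}. (\<phi> r - \<phi> (r - 1)) * a r)"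
    by (simp add: sum.distrib[symmetric] algebra_simps)
  also have "(\<Sum>r\<in>{lo..<hi}. (\<phi> (r - 1) * a r - \<phi> (r + 1 - 1) * a (r + 1))) = \<phi> (lo - 1) * a lo - \<phi> (hi - 1) * a hi"
    using sum_int_interval_shift[of lo hi "\<lambda>r. \<phi> (r - 1) * a r"] assms(1) by simp
  also have "(\<Sum>r\<in>{lo..<hi}. (\<phi> r - \<phi> (r - 1)) * a r) =
      (\<phi> lo - \<phi> (lo - 1)) * a lo + (\<Sum>r\<in>{lo<..<hi}. (\<phi> r - \<phi> (r - 1)) * a r)"
  proof -
    have "{lo..<hi} = insert lo {lo<..<hi}" using assms(1) by auto
    then show ?thesis by simp
  qed
  finally show ?thesis using assms(2) by (simp add: left_diff_distrib)
qed

context finite_complex_space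
begin

lemma induced_subspace:
  assumes "subspace X" "subspace Y" "subspace (F p)"
  shows "subspace (induced (X, Y) F p)"
  unfolding induced_def fst_conv snd_conv
  by (rule subspace_sums) (use assms in \<open>auto intro: subspace_inter\<close>)

lemma dim_int_induced:
  assumes "subspace X" "subspace Y" "Y \<subseteq> X" "subspace (F p)"
  shows "dim_int (induced (X, Y) F p) = dim_int (F p \<inter> X) + dim_int Y - dim_int (F p \<inter> Y)"
proof -
  have "dim {x + y |x y. x \<in> F p \<inter> X \<and> y \<in> Y} + dim (F p \<inter> X \<inter> Y) = dim (F p \<inter> X) + dim Y"
    by (rule dim_sums_Int) (use assms in \<open>auto intro: subspace_inter\<close>)
  moreover have "F p \<inter> X \<inter> Y = F p \<inter> Y" using assms(3) by blast
  ultimately show ?thesis by (simp add: induced_def dim_int_def)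
qed

lemma induced_mono: "F q \<subseteq> F p \<Longrightarrow> induced Q F q \<subseteq> induced Q F p"
  unfolding induced_def by blast

text \<open>\<open>quot_dim\<close> subtracts natural numbers; the inclusion of consecutive steps
  makes this a true difference, in which the dimension of \<open>F (p + 1)\<close> cancels.\<close>

lemma quot_dim_gr2:
  assumes F: "\<And>p. subspace (F p)" "antimono F" and G: "\<And>p. subspace (G p)" "antimono G"
  shows "int (quot_dim scale (gr2 F G p q)) = bigraded_dim F G p q"
proof -
  let ?B = "\<lambda>q. induced (F p, F (p + 1)) G q"
  have Fs: "F (p + 1) \<subseteq> F p" using antimonoD[OF F(2), of p "p + 1"] by simp
  have Gs: "G (q + 1) \<subseteq> G q" using antimonoD[OF G(2), of q "q + 1"] by simp
  have d: "dim_int (?B q) = dim_int (F p \<inter> G q) + dim_int (F (p + 1)) - dim_int (F (p + 1) \<inter> G q)" for q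
    using dim_int_induced[of "F p" "F (p + 1)" G q] F(1) G(1) Fs by (simp add: Int_commute)
  have "?B (q + 1) \<subseteq> ?B q" by (rule induced_mono[OF Gs])
  then have "dim (?B (q + 1)) \<le> dim (?B q)" by (rule dim_subset)
  then have "int (quot_dim scale (gr2 F G p q)) = dim_int (?B q) - dim_int (?B (q + 1))"
    by (simp add: quot_dim_def gr2_def gr_def dim_int_def)
  then show ?thesis unfolding d bigraded_dim_def by simp
qed

lemma bigraded_dim_const:
  "F p = F (p + 1) \<or> G q = G (q + 1) \<Longrightarrow> bigraded_dim F G p q = 0"
  by (auto simp: bigraded_dim_def)

lemma bigraded_dim_commute: "bigraded_dim F G p q = bigraded_dim G F q p"
  by (simp add: bigraded_dim_def Int_commute)

text \<open>Telescoping in q. The hypothesis on \<open>G hi\<close> does not ask for 0, because a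
  filtration induced on X / Y is represented by preimages and ends at Y.\<close>

lemma sum_bigraded_dim:
  assumes "lo \<le> hi" "\<And>p. F p \<subseteq> G lo" "\<And>p. G hi \<subseteq> F p"
  shows "(\<Sum>q\<in>{lo..<hi}. bigraded_dim F G p q) = dim_int (F p) - dim_int (F (p + 1))"
proof -
  have "(\<Sum>q\<in>{lo..<hi}. bigraded_dim F G p q) =
    (\<Sum>q\<in>{lo..<hi}. (dim_int (F p \<inter> G q) - dim_int (F (p + 1) \<inter> G q))
       - (dim_int (F p \<inter> G (q + 1)) - dim_int (F (p + 1) \<inter> G (q + 1))))"
    by (simp add: bigraded_dim_def algebra_simps)
  also have "\<dots> = (dim_int (F p \<inter> G lo) - dim_int (F (p + 1) \<inter> G lo))
      - (dim_int (F p \<inter> G hi) - dim_int (F (p + 1) \<inter> G hi))"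
    by (rule sum_int_interval_shift[OF assms(1)])
  also have "\<dots> = dim_int (F p) - dim_int (F (p + 1))"
    using assms(2,3) by (simp add: Int_absorb1 Int_absorb2)
  finally show ?thesis .
qed

end

text \<open>All jumps lie in the box from \<open>lo\<close> to \<open>hi\<close>, so sums over the
  integers become finite. Strictness of \<open>lo < hi\<close> is what allows the term at
  \<open>lo\<close> to be split off in the summation by parts.\<close>

locale boxed_filtrations = finite_complex_space scale B
  for scale :: "complex \<Rightarrow> 'b::ab_group_add \<Rightarrow> 'b" (infixr \<open>*s\<close> 75) and B +
  fixes F0 F1 F2 :: "int \<Rightarrow> 'b set" and lo hi :: int
  assumes fil: "filtration_on UNIV F0" "filtration_on UNIV F1" "filtration_on UNIV F2"
    and low: "F0 lo = UNIV" "F1 lo = UNIV" "F2 lo = UNIV"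
    and high: "F0 hi = {0}" "F1 hi = {0}" "F2 hi = {0}"
    and lo_hi: "lo < hi"
begin

lemma constant_outside:
  assumes "filtration_on UNIV F" "F lo = UNIV" "F hi = {0}" "p \<notin> {lo..<hi}"
  shows "F p = F (p + 1)"
proof (cases "p < lo")
  case True
  then show ?thesis using filtration_on_below[OF assms(1,2), of p] filtration_on_below[OF assms(1,2), of "p + 1"] by simp
next
  case False
  then show ?thesis using assms(4) filtration_on_above[OF assms(1,3), of p] filtration_on_above[OF assms(1,3), of "p + 1"]
    by simp
qed

text \<open>The induced filtrations run from X down to Y. Summing over q leaves the graded pieces of
  F on X / Y, whose degree is the difference of the degrees on X and on Y.\<close>

lemma dim_sum_pairs:
  assumes F: "filtration_on UNIV F" "F lo = UNIV" "F hi = {0}"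
    and G: "filtration_on UNIV G" "G lo = UNIV" "G hi = {0}"
    and X: "subspace X" and Y: "subspace Y" and YX: "Y \<subseteq> X"
  defines "m \<equiv> bigraded_dim (induced (X, Y) F) (induced (X, Y) G)"
  shows "(\<Sum>p\<in>{lo..<hi}. \<Sum>q\<in>{lo..<hi}. m p q) = dim_int X - dim_int Y"
    and "(\<Sum>p\<in>{lo..<hi}. \<Sum>q\<in>{lo..<hi}. m p q * p) = filtration_degree lo hi F X - filtration_degree lo hi F Y"
proof -
  let ?F = "induced (X, Y) F" and ?G = "induced (X, Y) G"
  have "?F p \<subseteq> ?G lo" for p
  proof -
    have "?F p \<subseteq> X" using X YX by (auto simp: induced_def intro!: subspace_add)
    moreover have "X \<subseteq> ?G lo" using G(2) subspace_0[OF Y] by (force simp: induced_def)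
    ultimately show ?thesis by blast
  qed
  moreover have "?G hi \<subseteq> ?F p" for p
    using G(3) filtration_onD(4)[OF F(1), of p] subspace_0[OF X] by (force simp: induced_def)
  ultimately have inner: "(\<Sum>q\<in>{lo..<hi}. m p q) = dim_int (?F p) - dim_int (?F (p + 1))" for p
    unfolding m_def using lo_hi by (intro sum_bigraded_dim) auto
  have d: "dim_int (?F p) = dim_int (F p \<inter> X) + dim_int Y - dim_int (F p \<inter> Y)" for p
    by (rule dim_int_induced[OF X Y YX filtration_onD(1)[OF F(1)]])
  have z: "{0} \<inter> X = {0}" "{0} \<inter> Y = {0}" using subspace_0[OF X] subspace_0[OF Y] by auto
  have "(\<Sum>p\<in>{lo..<hi}. \<Sum>q\<in>{lo..<hi}. m p q) = dim_int (?F lo) - dim_int (?F hi)"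
    unfolding inner using lo_hi by (intro sum_int_interval_shift) simp
  then show "(\<Sum>p\<in>{lo..<hi}. \<Sum>q\<in>{lo..<hi}. m p q) = dim_int X - dim_int Y"
    unfolding d F(2,3) z by simp
  have "(\<Sum>p\<in>{lo..<hi}. \<Sum>q\<in>{lo..<hi}. m p q * p) = (\<Sum>p\<in>{lo..<hi}. p * (dim_int (?F p) - dim_int (?F (p + 1))))"
    unfolding inner[symmetric] by (simp add: sum_distrib_left mult.commute)
  also have "\<dots> = filtration_degree lo hi F X - filtration_degree lo hi F Y"
    unfolding d filtration_degree_def sum_subtractf[symmetric] by (intro sum.cong) (auto simp: algebra_simps)
  finally show "(\<Sum>p\<in>{lo..<hi}. \<Sum>q\<in>{lo..<hi}. m p q * p) = filtration_degree lo hi F X - filtration_degree lo hi F Y" .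
qed

text \<open>The weight q is obtained from the weight p by exchanging the two filtrations, as
  \<open>bigraded_dim\<close> is symmetric.\<close>

lemma weight_sum_pairs:
  assumes F: "filtration_on UNIV F" "F lo = UNIV" "F hi = {0}"
    and G: "filtration_on UNIV G" "G lo = UNIV" "G hi = {0}"
    and XY: "subspace X" "subspace Y" "Y \<subseteq> X"
  defines "m \<equiv> bigraded_dim (induced (X, Y) F) (induced (X, Y) G)"
  shows "(\<Sum>p\<in>{lo..<hi}. \<Sum>q\<in>{lo..<hi}. m p q * (p + q)) =
    filtration_degree lo hi F X + filtration_degree lo hi G X
    - (filtration_degree lo hi F Y + filtration_degree lo hi G Y)"
proof -
  have "(\<Sum>p\<in>{lo..<hi}. \<Sum>q\<in>{lo..<hi}. m p q * q) =
      (\<Sum>q\<in>{lo..<hi}. \<Sum>p\<in>{lo..<hi}. bigraded_dim (induced (X, Y) G) (induced (X, Y) F) q p * q)"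
    unfolding m_def by (subst sum.swap) (simp add: bigraded_dim_commute[of "induced (X, Y) F"])
  then show ?thesis
    using dim_sum_pairs(2)[OF F G XY] dim_sum_pairs(2)[OF G F XY]
    by (simp add: m_def sum.distrib distrib_left)
qed

definition triple_dim :: "int \<Rightarrow> int \<Rightarrow> int \<Rightarrow> int" where
  "triple_dim r = bigraded_dim (induced (F0 r, F0 (r + 1)) F1) (induced (F0 r, F0 (r + 1)) F2)"

definition layer_dim :: "int \<Rightarrow> int" where
  "layer_dim r = dim_int (F0 r)"

definition layer_degree :: "int \<Rightarrow> int" where
  "layer_degree r = filtration_degree lo hi F1 (F0 r) + filtration_degree lo hi F2 (F0 r)"

lemma F0_subspace: "subspace (F0 r)" "F0 (r + 1) \<subseteq> F0 r"
  using filtration_onD(1)[OF fil(1)] filtration_onD(2)[OF fil(1), of r "r + 1"] by auto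

lemma quot_dim_gr3: "int (quot_dim scale (gr3 F0 F1 F2 r p q)) = triple_dim r p q"
  unfolding gr3_def triple_dim_def gr_def
  by (intro quot_dim_gr2 induced_subspace antimonoI induced_mono F0_subspace(1))
    (use filtration_onD(1,2)[OF fil(2)] filtration_onD(1,2)[OF fil(3)] in auto)

text \<open>For r outside the box the subquotient is zero, represented by the constant preimage
  \<open>F0 r\<close>; for p or q outside it the filtration in question does not jump.\<close>

lemma triple_dim_outside:
  assumes "r \<notin> {lo..<hi} \<or> p \<notin> {lo..<hi} \<or> q \<notin> {lo..<hi}"
  shows "triple_dim r p q = 0"
proof -
  have "p \<notin> {lo..<hi} \<Longrightarrow> F1 p = F1 (p + 1)" "q \<notin> {lo..<hi} \<Longrightarrow> F2 q = F2 (q + 1)"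
    using constant_outside[OF fil(2) low(2) high(2)] constant_outside[OF fil(3) low(3) high(3)] by auto
  moreover have "induced (F0 r, F0 (r + 1)) F1 p = induced (F0 r, F0 (r + 1)) F1 (p + 1)" if "r \<notin> {lo..<hi}"
  proof -
    have e: "F0 r = F0 (r + 1)" by (rule constant_outside[OF fil(1) low(1) high(1) that])
    have "induced (F0 r, F0 r) F1 m = F0 r" for m
    proof
      show "induced (F0 r, F0 r) F1 m \<subseteq> F0 r"
        using F0_subspace(1) by (auto simp: induced_def intro!: subspace_add)
      show "F0 r \<subseteq> induced (F0 r, F0 r) F1 m"
        using filtration_onD(4)[OF fil(2), of m] subspace_0[OF F0_subspace(1), of r]
        by (force simp: induced_def)
    qed
    then show ?thesis using e by metis
  qed
  moreover have "F p = F (p + 1) \<Longrightarrow> induced Q F p = induced Q F (p + 1)" for Q and F :: "int \<Rightarrow> 'b set" and p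
    by (simp only: induced_def)
  ultimately show ?thesis
    using assms unfolding triple_dim_def by (intro bigraded_dim_const) metis
qed

lemma sum_triple_dim:
  "(\<Sum>p\<in>{lo..<hi}. \<Sum>q\<in>{lo..<hi}. triple_dim r p q) = layer_dim r - layer_dim (r + 1)"
  "(\<Sum>p\<in>{lo..<hi}. \<Sum>q\<in>{lo..<hi}. triple_dim r p q * (p + q)) = layer_degree r - layer_degree (r + 1)"
proof -
  note XY = F0_subspace(1)[of r] F0_subspace(1)[of "r + 1"] F0_subspace(2)[of r]
  note F12 = fil(2) low(2) high(2) fil(3) low(3) high(3)
  show "(\<Sum>p\<in>{lo..<hi}. \<Sum>q\<in>{lo..<hi}. triple_dim r p q) = layer_dim r - layer_dim (r + 1)"
    using dim_sum_pairs(1)[OF F12 XY] by (simp add: triple_dim_def layer_dim_def)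
  show "(\<Sum>p\<in>{lo..<hi}. \<Sum>q\<in>{lo..<hi}. triple_dim r p q * (p + q)) = layer_degree r - layer_degree (r + 1)"
    using weight_sum_pairs[OF F12 XY] by (simp add: triple_dim_def layer_degree_def)
qed

lemma sum_double_dim:
  "(\<Sum>p\<in>{lo..<hi}. \<Sum>q\<in>{lo..<hi}. bigraded_dim F1 F2 p q) = layer_dim lo"
  "(\<Sum>p\<in>{lo..<hi}. \<Sum>q\<in>{lo..<hi}. bigraded_dim F1 F2 p q * (p + q)) = layer_degree lo"
proof -
  \<comment> \<open>The pair (UNIV, {0}) represents V itself, which is the layer at
    \<open>lo\<close>; so the sums for subquotients specialise to V.\<close>
  have i: "induced (UNIV, {0}) F = F" for F :: "int \<Rightarrow> 'b set"
    by (auto simp: induced_def fun_eq_iff)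
  have XY: "subspace (UNIV :: 'b set)" "subspace ({0} :: 'b set)" "{0} \<subseteq> (UNIV :: 'b set)" by auto
  note F12 = fil(2) low(2) high(2) fil(3) low(3) high(3)
  have z: "filtration_degree lo hi F {0} = 0" if "filtration_on UNIV F" for F
    using filtration_onD(4)[OF that] by (simp add: filtration_degree_def)
  show "(\<Sum>p\<in>{lo..<hi}. \<Sum>q\<in>{lo..<hi}. bigraded_dim F1 F2 p q) = layer_dim lo"
    using dim_sum_pairs(1)[OF F12 XY, unfolded i] by (simp add: layer_dim_def low)
  show "(\<Sum>p\<in>{lo..<hi}. \<Sum>q\<in>{lo..<hi}. bigraded_dim F1 F2 p q * (p + q)) = layer_degree lo"
    using weight_sum_pairs[OF F12 XY, unfolded i] z[OF fil(2)] z[OF fil(3)]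
    by (simp add: layer_degree_def low)
qed

lemma layer_high: "layer_dim hi = 0" "layer_degree hi = 0"
proof -
  have "F1 m \<inter> {0} = {0}" "F2 m \<inter> {0} = {0}" for m
    using filtration_onD(4)[OF fil(2), of m] filtration_onD(4)[OF fil(3), of m] by auto
  then show "layer_dim hi = 0" "layer_degree hi = 0"
    by (simp_all add: layer_dim_def layer_degree_def high filtration_degree_def)
qed

text \<open>Both weights are at most linear in p and q, so for fixed r the inner sums depend only on
  the dimension and the degrees of a layer. Summation by parts in r then turns r^2 into r^2 - (r -
  1)^2 = 2r - 1 and 2r into 2.\<close>

lemma sum_triple_weights:
  "(\<Sum>r\<in>{lo..<hi}. \<Sum>p\<in>{lo..<hi}. \<Sum>q\<in>{lo..<hi}. triple_dim r p q * (r + p + q)) =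
     lo * layer_dim lo + (\<Sum>r\<in>{lo<..<hi}. layer_dim r) + layer_degree lo"
  "(\<Sum>r\<in>{lo..<hi}. \<Sum>p\<in>{lo..<hi}. \<Sum>q\<in>{lo..<hi}. triple_dim r p q * (r\<^sup>2 + 2 * r * p + 2 * r * q)) =
     lo\<^sup>2 * layer_dim lo + 2 * lo * layer_degree lo
     + (\<Sum>r\<in>{lo<..<hi}. (2 * r - 1) * layer_dim r + 2 * layer_degree r)"
proof -
  have "(\<Sum>p\<in>{lo..<hi}. \<Sum>q\<in>{lo..<hi}. triple_dim r p q * (r + p + q)) =
      r * (layer_dim r - layer_dim (r + 1)) + (layer_degree r - layer_degree (r + 1))" for r
    unfolding sum_triple_dim[symmetric] by (simp add: sum_distrib_left sum.distrib[symmetric] algebra_simps)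
  then show "(\<Sum>r\<in>{lo..<hi}. \<Sum>p\<in>{lo..<hi}. \<Sum>q\<in>{lo..<hi}. triple_dim r p q * (r + p + q)) =
     lo * layer_dim lo + (\<Sum>r\<in>{lo<..<hi}. layer_dim r) + layer_degree lo"
    using sum_by_parts_int[of lo hi layer_dim "\<lambda>r. r"] sum_int_interval_shift[of lo hi layer_degree]
      lo_hi layer_high by (simp add: sum.distrib)
  have "(\<Sum>p\<in>{lo..<hi}. \<Sum>q\<in>{lo..<hi}. triple_dim r p q * (r\<^sup>2 + 2 * r * p + 2 * r * q)) =
      r\<^sup>2 * (layer_dim r - layer_dim (r + 1)) + 2 * r * (layer_degree r - layer_degree (r + 1))" for r
    unfolding sum_triple_dim[symmetric] by (simp add: sum_distrib_left sum.distrib[symmetric] algebra_simps)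
  then have "(\<Sum>r\<in>{lo..<hi}. \<Sum>p\<in>{lo..<hi}. \<Sum>q\<in>{lo..<hi}. triple_dim r p q * (r\<^sup>2 + 2 * r * p + 2 * r * q)) =
      (\<Sum>r\<in>{lo..<hi}. r\<^sup>2 * (layer_dim r - layer_dim (r + 1)))
      + (\<Sum>r\<in>{lo..<hi}. 2 * r * (layer_degree r - layer_degree (r + 1)))"
    by (simp only: sum.distrib)
  also have "\<dots> = (lo\<^sup>2 * layer_dim lo + (\<Sum>r\<in>{lo<..<hi}. (r\<^sup>2 - (r - 1)\<^sup>2) * layer_dim r))
      + (2 * lo * layer_degree lo + (\<Sum>r\<in>{lo<..<hi}. (2 * r - 2 * (r - 1)) * layer_degree r))"
    by (intro arg_cong2[of _ _ _ _ "(+)"] sum_by_parts_int lo_hi layer_high)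
  also have "\<dots> = lo\<^sup>2 * layer_dim lo + 2 * lo * layer_degree lo
      + ((\<Sum>r\<in>{lo<..<hi}. (r\<^sup>2 - (r - 1)\<^sup>2) * layer_dim r)
        + (\<Sum>r\<in>{lo<..<hi}. (2 * r - 2 * (r - 1)) * layer_degree r))"
    by simp
  also have "\<dots> = lo\<^sup>2 * layer_dim lo + 2 * lo * layer_degree lo
     + (\<Sum>r\<in>{lo<..<hi}. (2 * r - 1) * layer_dim r + 2 * layer_degree r)"
    unfolding sum.distrib[symmetric]
    by (intro arg_cong2[of _ _ _ _ "(+)"] refl sum.cong) (simp_all add: power2_eq_square algebra_simps)
  finally show "(\<Sum>r\<in>{lo..<hi}. \<Sum>p\<in>{lo..<hi}. \<Sum>q\<in>{lo..<hi}. triple_dim r p q * (r\<^sup>2 + 2 * r * p + 2 * r * q)) =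
     lo\<^sup>2 * layer_dim lo + 2 * lo * layer_degree lo
     + (\<Sum>r\<in>{lo<..<hi}. (2 * r - 1) * layer_dim r + 2 * layer_degree r)" .
qed

end

section \<open>From sums over the box to the formula\<close>

lemma sum_triples:
  fixes f :: "'a \<Rightarrow> 'b \<Rightarrow> 'c \<Rightarrow> 'd::comm_monoid_add"
  shows "(\<Sum>(p, q, r)\<in>A \<times> B \<times> C. f p q r) = (\<Sum>r\<in>C. \<Sum>p\<in>A. \<Sum>q\<in>B. f p q r)"
proof -
  have "(\<Sum>(p, q, r)\<in>A \<times> B \<times> C. f p q r) = (\<Sum>p\<in>A. \<Sum>q\<in>B. \<Sum>r\<in>C. f p q r)"
    by (simp add: sum.cartesian_product)
  also have "\<dots> = (\<Sum>p\<in>A. \<Sum>r\<in>C. \<Sum>q\<in>B. f p q r)"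
    by (intro sum.cong refl sum.swap)
  also have "\<dots> = (\<Sum>r\<in>C. \<Sum>p\<in>A. \<Sum>q\<in>B. f p q r)"
    by (rule sum.swap)
  finally show ?thesis .
qed

lemma of_nat_mult_weight:
  "(of_nat k :: coh_P2) * (of_int a * w2 + (1 / 2) *\<^sub>Q (of_int b * w4)) =
    Coh 0 (of_int (int k * a)) (of_int (int k * b) / 2)"
  "(of_nat k :: coh_P2) * ((1 / 2) *\<^sub>Q (of_int b * w4)) = Coh 0 0 (of_int (int k * b) / 2)"
proof -
  have k: "(of_nat k :: coh_P2) = of_int (int k)" by simp
  show "(of_nat k :: coh_P2) * (of_int a * w2 + (1 / 2) *\<^sub>Q (of_int b * w4)) =
    Coh 0 (of_int (int k * a)) (of_int (int k * b) / 2)"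
    "(of_nat k :: coh_P2) * ((1 / 2) *\<^sub>Q (of_int b * w4)) = Coh 0 0 (of_int (int k * b) / 2)"
    unfolding k w2_def w4_def by (simp_all add: of_int_mult_Coh del: of_int_of_nat_eq)
qed

lemma of_nat_Coh: "(of_nat k :: coh_P2) = Coh (of_nat k) 0 0"
  by (induction k) (simp_all add: zero_coh_P2_def one_coh_P2_def)

context boxed_filtrations
begin

lemma sum_gr3:
  "Sum_any (\<lambda>(p, q, r). of_nat (quot_dim scale (gr3 F0 F1 F2 r p q)) *
      (of_int (r + p + q) * w2 + (1 / 2) *\<^sub>Q (of_int (r\<^sup>2 + 2 * r * p + 2 * r * q) * w4))) =
    Coh 0 (of_int (lo * layer_dim lo + (\<Sum>r\<in>{lo<..<hi}. layer_dim r) + layer_degree lo))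
      (of_int (lo\<^sup>2 * layer_dim lo + 2 * lo * layer_degree lo
         + (\<Sum>r\<in>{lo<..<hi}. (2 * r - 1) * layer_dim r + 2 * layer_degree r)) / 2)"
proof -
  let ?f = "\<lambda>(p, q, r). Coh 0 (of_int (triple_dim r p q * (r + p + q)))
      (of_int (triple_dim r p q * (r\<^sup>2 + 2 * r * p + 2 * r * q)) / 2)"
  let ?I = "{lo..<hi}"
  \<comment> \<open>\<open>Sum_any\<close> has value 0 on infinite supports by convention; here it
    is a genuine finite sum because the terms vanish outside the box.\<close>
  have "Sum_any ?f = sum ?f (?I \<times> ?I \<times> ?I)"
    by (rule Sum_any.expand_superset) (auto simp: zero_coh_P2_def intro!: triple_dim_outside)
  also have "\<dots> = Coh 0
      (of_int (\<Sum>(p, q, r)\<in>?I \<times> ?I \<times> ?I. triple_dim r p q * (r + p + q)))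
      (of_int (\<Sum>(p, q, r)\<in>?I \<times> ?I \<times> ?I. triple_dim r p q * (r\<^sup>2 + 2 * r * p + 2 * r * q)) / 2)"
    by (simp add: case_prod_unfold sum_Coh sum_divide_distrib)
  finally show ?thesis
    unfolding of_nat_mult_weight quot_dim_gr3 sum_triples sum_triple_weights .
qed

lemma sum_gr2:
  "Sum_any (\<lambda>(p, q). of_nat (quot_dim scale (gr2 F1 F2 p q)) * ((1 / 2) *\<^sub>Q (of_int ((p + q)\<^sup>2) * w4))) =
    Coh 0 0 (of_int (\<Sum>p\<in>{lo..<hi}. \<Sum>q\<in>{lo..<hi}. bigraded_dim F1 F2 p q * (p + q)\<^sup>2) / 2)"
proof -
  let ?f = "\<lambda>(p, q). Coh 0 0 (of_int (bigraded_dim F1 F2 p q * (p + q)\<^sup>2) / 2)"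
  let ?I = "{lo..<hi}"
  have out: "bigraded_dim F1 F2 p q = 0" if "p \<notin> ?I \<or> q \<notin> ?I" for p q
    using that constant_outside[OF fil(2) low(2) high(2)] constant_outside[OF fil(3) low(3) high(3)]
    by (intro bigraded_dim_const) blast
  have "Sum_any ?f = sum ?f (?I \<times> ?I)"
    by (rule Sum_any.expand_superset) (auto simp: zero_coh_P2_def intro!: out)
  also have "\<dots> = Coh 0 0 (of_int (\<Sum>(p, q)\<in>?I \<times> ?I. bigraded_dim F1 F2 p q * (p + q)\<^sup>2) / 2)"
    by (simp add: case_prod_unfold sum_Coh sum_divide_distrib)
  moreover have "int (quot_dim scale (gr2 F1 F2 p q)) = bigraded_dim F1 F2 p q" for p q
    using filtration_onD(1,2)[OF fil(2)] filtration_onD(1,2)[OF fil(3)]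
    by (intro quot_dim_gr2 antimonoI) auto
  ultimately show ?thesis
    unfolding of_nat_mult_weight by (simp add: sum.cartesian_product)
qed

text \<open>In (lo + p + q)^2, summed over the bidegrees of V, the part (p + q)^2 gives the sum over
  \<open>gr2\<close>. The parts that contain \<open>lo\<close> are the boundary terms at
  \<open>lo\<close> of the summation by parts, so the choice of the box drops out.\<close>

lemma rees_chern_total:
  "rees_chern scale (three_filtrations F0 F1 F2) =
    of_nat (dim UNIV)
    + Sum_any (\<lambda>(p, q, r). of_nat (quot_dim scale (gr3 F0 F1 F2 r p q)) *
        (of_int (r + p + q) * w2 + (1 / 2) *\<^sub>Q (of_int (r\<^sup>2 + 2 * r * p + 2 * r * q) * w4)))
    + Sum_any (\<lambda>(p, q). of_nat (quot_dim scale (gr2 F1 F2 p q)) *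
        ((1 / 2) *\<^sub>Q (of_int ((p + q)\<^sup>2) * w4)))"
proof -
  let ?I = "{lo..<hi}" and ?m = "bigraded_dim F1 F2"
  have m1: "(\<Sum>p\<in>?I. \<Sum>q\<in>?I. ?m p q * (lo + p + q)) = lo * layer_dim lo + layer_degree lo"
    unfolding sum_double_dim[symmetric] by (simp add: sum_distrib_left sum.distrib[symmetric] algebra_simps)
  have m2: "(\<Sum>p\<in>?I. \<Sum>q\<in>?I. ?m p q * (lo + p + q)\<^sup>2) =
      lo\<^sup>2 * layer_dim lo + 2 * lo * layer_degree lo + (\<Sum>p\<in>?I. \<Sum>q\<in>?I. ?m p q * (p + q)\<^sup>2)"
    unfolding sum_double_dim[symmetric]
    by (simp add: sum_distrib_left sum.distrib[symmetric] power2_eq_square algebra_simps)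
  have "(\<Sum>p\<in>?I. \<Sum>q\<in>?I. of_int (?m p q) * line_chern (lo + p + q)) =
    Coh (of_int (\<Sum>p\<in>?I. \<Sum>q\<in>?I. ?m p q)) (of_int (\<Sum>p\<in>?I. \<Sum>q\<in>?I. ?m p q * (lo + p + q)))
      (of_int (\<Sum>p\<in>?I. \<Sum>q\<in>?I. ?m p q * (lo + p + q)\<^sup>2) / 2)"
    by (simp add: line_chern_def of_int_mult_Coh sum_Coh sum_divide_distrib)
  then have first: "(\<Sum>p\<in>?I. \<Sum>q\<in>?I. of_int (?m p q) * line_chern (lo + p + q)) =
    Coh (of_int (layer_dim lo)) (of_int (lo * layer_dim lo + layer_degree lo))
      (of_int (lo\<^sup>2 * layer_dim lo + 2 * lo * layer_degree lo + (\<Sum>p\<in>?I. \<Sum>q\<in>?I. ?m p q * (p + q)\<^sup>2)) / 2)"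
    unfolding m1 m2 sum_double_dim(1) .
  have second: "(\<Sum>r\<in>{lo<..<hi}. Coh 0 (of_int (dim_int (F0 r)))
        ((of_int r - 1 / 2) * of_int (dim_int (F0 r))
         + of_int (filtration_degree lo hi F1 (F0 r)) + of_int (filtration_degree lo hi F2 (F0 r)))) =
    Coh 0 (of_int (\<Sum>r\<in>{lo<..<hi}. layer_dim r))
      (of_int (\<Sum>r\<in>{lo<..<hi}. (2 * r - 1) * layer_dim r + 2 * layer_degree r) / 2)"
    unfolding layer_dim_def[symmetric] sum_Coh sum.neutral_const of_int_sum sum_divide_distrib layer_degree_def
    by (intro arg_cong2[of _ _ _ _ "Coh 0"] refl sum.cong) (simp add: field_simps)
  have n: "(of_nat (dim UNIV) :: coh_P2) = Coh (of_int (layer_dim lo)) 0 0"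
    by (simp add: of_nat_Coh layer_dim_def low dim_int_def)
  show ?thesis
    unfolding rees_chern_formula[OF fil low high] first second sum_gr3 sum_gr2 n
    by (simp add: add_divide_distrib)
qed

end

theorem proposition3:
  fixes s :: "complex \<Rightarrow> 'v::ab_group_add \<Rightarrow> 'v"
    and B :: "'v set"
    and F0 F1 F2 :: "int \<Rightarrow> 'v set"
  assumes "finite_dimensional_vector_space s B"
    and "complete_filtration s F0"
    and "complete_filtration s F1"
    and "complete_filtration s F2"
  shows "sheaf_chern_character s (rees_bundle F0 F1 F2) =
    of_nat (vector_space.dim s (UNIV :: 'v set))
    + Sum_any (\<lambda>(p, q, r). of_nat (quot_dim s (gr3 F0 F1 F2 r p q)) *
        (of_int (r + p + q) * w2 + (1 / 2) *\<^sub>Q (of_int (r\<^sup>2 + 2 * r * p + 2 * r * q) * w4)))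
    + Sum_any (\<lambda>(p, q). of_nat (quot_dim s (gr2 F1 F2 p q)) *
        ((1 / 2) *\<^sub>Q (of_int ((p + q)\<^sup>2) * w4)))"
proof -
  interpret V: finite_dimensional_vector_space s B by fact
  interpret finite_complex_space s B ..
  have fil: "filtration_on UNIV F0" "filtration_on UNIV F1" "filtration_on UNIV F2"
    using assms(2-4) by (simp_all add: complete_filtration_iff)
  obtain a0 a1 a2 b0 b1 b2 where ab: "F0 a0 = UNIV" "F1 a1 = UNIV" "F2 a2 = UNIV"
    "F0 b0 = {0}" "F1 b1 = {0}" "F2 b2 = {0}"
    using assms(2-4) unfolding complete_filtration_def by blast
  define lo where "lo = min a0 (min a1 a2)"
  \<comment> \<open>The maximum with \<open>lo + 1\<close> matters for V = 0, where the indices of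
    the full and of the zero step may coincide or cross.\<close>
  define hi where "hi = max (lo + 1) (max b0 (max b1 b2))"
  interpret boxed_filtrations s B F0 F1 F2 lo hi
  proof
    show "F0 lo = UNIV" "F1 lo = UNIV" "F2 lo = UNIV"
      using filtration_on_below[OF fil(1) ab(1)] filtration_on_below[OF fil(2) ab(2)]
        filtration_on_below[OF fil(3) ab(3)] by (simp_all add: lo_def)
    show "F0 hi = {0}" "F1 hi = {0}" "F2 hi = {0}"
      using filtration_on_above[OF fil(1) ab(4)] filtration_on_above[OF fil(2) ab(5)]
        filtration_on_above[OF fil(3) ab(6)] by (simp_all add: hi_def)
    show "lo < hi" by (simp add: hi_def)
  qed (fact fil)+
  show ?thesis
    unfolding sheaf_chern_character_rees rees_chern_def[symmetric] by (rule rees_chern_total)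
qed

end
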